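(* Fix any $0<\beta<0.46$ in advance (for example, one can choose $\beta=0.45$). There is an algorithm which, given an $m\times n$ integer matrix $A=(a_{ij})$ having at most $r$ non-zero entries in every row ($r\geq 2$) and at most $c$ non-zero entries in every column ($c\geq 1$), complex weights $w_1,\ldots,w_n$ satisfying $$|w_j|\leq\frac{\beta}{r\sqrt{c}}\quad\text{for } j=1,\ldots,n,$$ and a number $\epsilon>0$, approximates within relative error $\epsilon$ the weight $w(X)$ of the set $$X=\Bigl\{x\in\{0,1\}^n,\ x=(\xi_1,\ldots,\xi_n):\ \sum_{j=1}^n a_{ij}\xi_j=0\ \text{ for } i=1,\ldots,m\Bigr\}$$ in $(rc)^{O(\ln n-\ln\epsilon)}$ time, where the implied constant in the "$O$" notation depends only on $\beta$. In particular, if $r$ and $c$ are fixed in advance, this is a polynomial time approximation algorithm.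
   Context: For complex weights $w_1,\ldots,w_n$ and $X\subset\{0,1\}^n$, the weight of $X$ is $w(X)=\sum_{x=(\xi_1,\ldots,\xi_n)\in X}w_1^{\xi_1}\cdots w_n^{\xi_n}$, with $0^0=1$. A number $e^{T}$, $T\in\mathbb{C}$, approximates $w(X)\neq 0$ within relative error $\epsilon$ if $|\ln w(X)-T|\leq\epsilon$ for some value of the logarithm. The computational model is the standard RAM machine model with logarithmic-sized words; it is additionally assumed that, given a column index $j$ of $A=(a_{ij})$, the row indices $i$ with $a_{ij}\neq 0$ can be computed in time $O(c)$.
   Formalization: The exponent O(ln n − ln ε) is read as O(max(1, ln n − ln min(ε,1))), since the literal one vanishes or turns negative (e.g. n = 1, ε ≥ 1), which no algorithm can meet; an ε > 1 gets the time bound of ε = 1. *)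

theory Defs
  imports Complex_Main "HOL-Library.FuncSet"
begin

text \<open>
  An \<open>m \<times> n\<close> matrix is a function \<open>A\<close> of which only the values \<open>A i j\<close> with \<open>i < m\<close> and \<open>j < n\<close>
  matter; rows and columns are numbered from 0. Vectors are treated likewise.
\<close>

definition sparse_matrix :: "nat \<Rightarrow> nat \<Rightarrow> nat \<Rightarrow> nat \<Rightarrow> (nat \<Rightarrow> nat \<Rightarrow> int) \<Rightarrow> bool" where
  "sparse_matrix m n r c A \<longleftrightarrow>
     (\<forall>i<m. card {j. j < n \<and> A i j \<noteq> 0} \<le> r) \<and>
     (\<forall>j<n. card {i. i < m \<and> A i j \<noteq> 0} \<le> c)"

definition solutions :: "nat \<Rightarrow> nat \<Rightarrow> (nat \<Rightarrow> nat \<Rightarrow> int) \<Rightarrow> (nat \<Rightarrow> nat) set" where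
  "solutions m n A =
     {x \<in> {..<n} \<rightarrow>\<^sub>E {0, 1}. \<forall>i<m. (\<Sum>j<n. A i j * int (x j)) = 0}"

lemma finite_solutions: "finite (solutions m n A)"
  unfolding solutions_def by (rule finite_Collect_conjI) (simp add: finite_PiE)

definition weight :: "nat \<Rightarrow> (nat \<Rightarrow> complex) \<Rightarrow> (nat \<Rightarrow> nat) set \<Rightarrow> complex" where
  "weight n w X = (\<Sum>x\<in>X. \<Prod>j<n. w j ^ x j)"

definition approximates :: "real \<Rightarrow> complex \<Rightarrow> complex \<Rightarrow> bool" where
  "approximates \<epsilon> T z \<longleftrightarrow> z \<noteq> 0 \<and> (\<exists>L. exp L = z \<and> cmod (L - T) \<le> \<epsilon>)"

text \<open>
  The machine is a random access machine with two zero-initialised memories. The cells of \<open>wmem\<close>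
  hold machine words, which serve as indices and addresses; the cells of \<open>nmem\<close> hold complex
  numbers with exact field operations at unit cost. Weights, matrix entries and the error are
  arbitrary numbers that do not fit into words, and the running time is meant not to depend on
  their bit lengths. There is no operation turning a number into a word, and numbers can only be
  tested for zero or compared by their real parts.
\<close>

record problem =
  rows :: nat
  cols :: nat
  entry :: "nat \<Rightarrow> nat \<Rightarrow> int"
  wt :: "nat \<Rightarrow> complex"
  err :: real

record ram_state =
  pc :: nat
  wmem :: "nat \<Rightarrow> nat"
  nmem :: "nat \<Rightarrow> complex"

datatype instr =
    WConst nat nat
  | WCopy nat nat
  | WLoad nat nat
  | WStore nat nat
  | WAdd nat nat nat
  | WSub nat nat nat
  | WMult nat nat nat
  | WDiv nat nat nat
  | WMod nat nat nat
  | Jump nat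
  | JumpIfZero nat nat
  | JumpIfLess nat nat nat
  | NConst nat int
  | NOfWord nat nat
  | NCopy nat nat
  | NLoad nat nat
  | NStore nat nat
  | NAdd nat nat nat
  | NSub nat nat nat
  | NMult nat nat nat
  | NDiv nat nat nat
  | NJumpIfZero nat nat
  | NJumpIfLess nat nat nat
  | GetEntry nat nat nat
  | GetWeight nat nat
  | GetColumn nat nat

definition column_support :: "problem \<Rightarrow> nat \<Rightarrow> nat list" where
  "column_support Q j =
     sorted_list_of_set {i. i < rows Q \<and> j < cols Q \<and> entry Q i j \<noteq> 0}"

definition write_list :: "nat \<Rightarrow> nat list \<Rightarrow> (nat \<Rightarrow> nat) \<Rightarrow> nat \<Rightarrow> nat" where
  "write_list a xs f = (\<lambda>k. if a \<le> k \<and> k < a + length xs then xs ! (k - a) else f k)"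

definition wput :: "nat \<Rightarrow> nat \<Rightarrow> ram_state \<Rightarrow> ram_state" where
  "wput a v s = s\<lparr>pc := Suc (pc s), wmem := (wmem s)(a := v)\<rparr>"

definition nput :: "nat \<Rightarrow> complex \<Rightarrow> ram_state \<Rightarrow> ram_state" where
  "nput a v s = s\<lparr>pc := Suc (pc s), nmem := (nmem s)(a := v)\<rparr>"

definition branch :: "bool \<Rightarrow> nat \<Rightarrow> ram_state \<Rightarrow> ram_state" where
  "branch p l s = s\<lparr>pc := (if p then l else Suc (pc s))\<rparr>"

text \<open>
  \<open>WSub\<close> is truncated subtraction, and division by zero yields zero. Reading outside of the
  \<open>m \<times> n\<close> range yields zero, so that the junk values of the input functions are invisible.
  \<open>GetColumn a b\<close> is the assumed access to the rows in which a column has non-zero entries: it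
  writes their number, followed by their list, to the words starting at the address in word \<open>a\<close>.
\<close>

primrec ram_step :: "problem \<Rightarrow> instr \<Rightarrow> ram_state \<Rightarrow> ram_state" where
  "ram_step Q (WConst a k) s = wput a k s"
| "ram_step Q (WCopy a b) s = wput a (wmem s b) s"
| "ram_step Q (WLoad a b) s = wput a (wmem s (wmem s b)) s"
| "ram_step Q (WStore a b) s = wput (wmem s a) (wmem s b) s"
| "ram_step Q (WAdd a b d) s = wput a (wmem s b + wmem s d) s"
| "ram_step Q (WSub a b d) s = wput a (wmem s b - wmem s d) s"
| "ram_step Q (WMult a b d) s = wput a (wmem s b * wmem s d) s"
| "ram_step Q (WDiv a b d) s = wput a (wmem s b div wmem s d) s"
| "ram_step Q (WMod a b d) s = wput a (wmem s b mod wmem s d) s"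
| "ram_step Q (Jump l) s = branch True l s"
| "ram_step Q (JumpIfZero a l) s = branch (wmem s a = 0) l s"
| "ram_step Q (JumpIfLess a b l) s = branch (wmem s a < wmem s b) l s"
| "ram_step Q (NConst a k) s = nput a (of_int k) s"
| "ram_step Q (NOfWord a b) s = nput a (of_nat (wmem s b)) s"
| "ram_step Q (NCopy a b) s = nput a (nmem s b) s"
| "ram_step Q (NLoad a b) s = nput a (nmem s (wmem s b)) s"
| "ram_step Q (NStore a b) s = nput (wmem s a) (nmem s b) s"
| "ram_step Q (NAdd a b d) s = nput a (nmem s b + nmem s d) s"
| "ram_step Q (NSub a b d) s = nput a (nmem s b - nmem s d) s"
| "ram_step Q (NMult a b d) s = nput a (nmem s b * nmem s d) s"
| "ram_step Q (NDiv a b d) s = nput a (nmem s b / nmem s d) s"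
| "ram_step Q (NJumpIfZero a l) s = branch (nmem s a = 0) l s"
| "ram_step Q (NJumpIfLess a b l) s = branch (Re (nmem s a) < Re (nmem s b)) l s"
| "ram_step Q (GetEntry a b d) s =
     nput a (if wmem s b < rows Q \<and> wmem s d < cols Q
             then of_int (entry Q (wmem s b) (wmem s d)) else 0) s"
| "ram_step Q (GetWeight a b) s =
     nput a (if wmem s b < cols Q then wt Q (wmem s b) else 0) s"
| "ram_step Q (GetColumn a b) s =
     (let xs = column_support Q (wmem s b)
      in s\<lparr>pc := Suc (pc s), wmem := write_list (wmem s a) (length xs # xs) (wmem s)\<rparr>)"

text \<open>
  Here \<open>c\<close> is the bound on the number of non-zero entries in a column.
\<close>

definition instr_cost :: "nat \<Rightarrow> instr \<Rightarrow> nat" where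
  "instr_cost c i = (case i of GetColumn a b \<Rightarrow> c | _ \<Rightarrow> 1)"

definition fits_word_length :: "nat \<Rightarrow> ram_state \<Rightarrow> bool" where
  "fits_word_length b s \<longleftrightarrow>
     (\<forall>a. wmem s a < 2 ^ b) \<and> (\<forall>a\<ge>2 ^ b. wmem s a = 0 \<and> nmem s a = 0)"

text \<open>
  \<open>ram_exec P Q c b s t s'\<close>: started in \<open>s\<close>, the program \<open>P\<close> halts in \<open>s'\<close> after time \<open>t\<close>, and all
  words and all addresses in use fit into \<open>b\<close> bits throughout. A program halts when control leaves
  it.
\<close>

inductive ram_exec ::
  "instr list \<Rightarrow> problem \<Rightarrow> nat \<Rightarrow> nat \<Rightarrow> ram_state \<Rightarrow> nat \<Rightarrow> ram_state \<Rightarrow> bool"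
  for P :: "instr list" and Q :: problem and c b :: nat where
  halted: "\<lbrakk>fits_word_length b s; length P \<le> pc s\<rbrakk> \<Longrightarrow> ram_exec P Q c b s 0 s"
| running: "\<lbrakk>fits_word_length b s; pc s < length P;
            ram_exec P Q c b (ram_step Q (P ! pc s) s) t s'\<rbrakk>
           \<Longrightarrow> ram_exec P Q c b s (instr_cost c (P ! pc s) + t) s'"

definition ram_init :: "problem \<Rightarrow> ram_state" where
  "ram_init Q = \<lparr>pc = 0, wmem = (\<lambda>_. 0)(0 := rows Q, 1 := cols Q),
                 nmem = (\<lambda>_. 0)(0 := of_real (err Q))\<rparr>"

definition ram_computes ::
  "instr list \<Rightarrow> problem \<Rightarrow> nat \<Rightarrow> nat \<Rightarrow> nat \<Rightarrow> complex \<Rightarrow> bool" where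
  "ram_computes P Q c b t T \<longleftrightarrow> (\<exists>s. ram_exec P Q c b (ram_init Q) t s \<and> nmem s 0 = T)"

end

theory Submission
  imports "HOL-Complex_Analysis.Complex_Analysis" Defs
begin

text \<open>
  Let \<open>Z(U, b)\<close> be the total weight of the sets of columns in \<open>U\<close> whose sum is \<open>b\<close>. Imposing one more
  equation averages \<open>Z(U, b)\<close> over multiplications of the weights by characters of that row. If deleting
  a column changes the argument of \<open>Z(U, 0)\<close> by at most \<open>\<phi> / r\<close>, then all the averaged numbers lie
  within angle \<open>\<phi>\<close> of a common direction, so the average loses at most a factor \<open>cos \<phi>\<close> in absolute
  value. A column meets at most \<open>c\<close> rows, hence its deletion is controlled by \<open>cos \<phi>\<close> to the power
  \<open>c\<close>, and the induction over the rows closes for \<open>\<phi> = 0.8 / \<surd>c\<close>. In particular the weight has no zeros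
  in a polydisc that exceeds the given one by the factor \<open>0.46 / \<beta>\<close>, and the Taylor polynomial of degree
  \<open>O(ln n - ln \<epsilon>)\<close> of its logarithm is a sufficiently good approximation.

  For the Taylor polynomial, write the logarithm as the sum of the \<open>ln (1 + z w\<^sub>j Q\<^sub>j)\<close>, where
  \<open>Q\<^sub>j = Z({..<j}, - a\<^sub>j) / Z({..<j}, 0)\<close>. Splitting off one column \<open>k\<close> expresses \<open>Q(U, b)\<close> as
  \<open>Q(U - k, b) + z w\<^sub>k (Q(U - k, b - a\<^sub>k) - Q(U, b) Q(U - k, - a\<^sub>k))\<close>. If \<open>k\<close> is always taken from the
  same row in which \<open>b\<close> does not vanish, then after \<open>r\<close> steps without a factor \<open>z\<close> the quotient is 0, so
  the tree that expands products of such quotients up to degree \<open>N\<close> has \<open>O(r)\<^sup>N\<close> nodes. As the expansion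
  is linear, it can be summed depth first with a stack of items and one accumulator.
\<close>

section \<open>Zero-free polydiscs\<close>

text \<open>The angle scales like 1 / sqrt c because up to \<open>c\<close> rows each cost a factor
  \<open>cos \<phi>\<close>, and \<open>cos \<phi> ^ c\<close> stays away from 0 only if c times the
  square of \<phi> is bounded; sharing the angle among the \<open>r\<close> columns of a row gives a
  radius of order 1 / (r sqrt c). The induction carries two assertions: nonvanishing, to have
  arguments at all, and a comparison with nonzero right-hand sides, to control the deletion of a
  column. The comparison also bounds every single term z w_j Q_j by 2/5, so the Taylor error is
  estimated for each factor separately and summed over the \<open>n\<close> columns. The machine
  imposes three more constraints. Words have O(log (m + n + 1/\<epsilon>)) bits, so the stack must
  have polynomial height. The time must not involve \<open>m\<close>, so only rows met by a chosen
  column are inspected. Numbers never become words, so the order \<open>N\<close> is found by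
  counting multiplications. Factors polynomial in \<open>n\<close> and \<open>N\<close> are absorbed
  at the end: r c \<ge> 2 makes n at most the square of (r c)^(ln n).\<close>

definition psum :: "(nat \<Rightarrow> nat \<Rightarrow> int) \<Rightarrow> nat set \<Rightarrow> nat set \<Rightarrow> (nat \<Rightarrow> int) \<Rightarrow> (nat \<Rightarrow> 'a) \<Rightarrow> 'a::comm_semiring_1" where
  "psum A F U b w = (\<Sum>S | S \<subseteq> U \<and> (\<forall>i\<in>F. (\<Sum>j\<in>S. A i j) = b i). \<Prod>j\<in>S. w j)"

lemma psum_insert:
  assumes "finite U" "j \<notin> U"
  shows "psum A F (insert j U) b w = psum A F U b w + w j * psum A F U (\<lambda>i. b i - A i j) w"
proof -
  let ?P = "\<lambda>b S. S \<subseteq> U \<and> (\<forall>i\<in>F. (\<Sum>j\<in>S. A i j) = b i)"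
  let ?b = "\<lambda>i. b i - A i j"
  have fin: "finite {S. ?P b S}" "finite {S. ?P ?b S}"
    using assms(1) by (auto intro: finite_subset[of _ "Pow U"])
  have S: "finite S" "j \<notin> S" if "S \<subseteq> U" for S
    using that assms by (auto dest: finite_subset)
  have eq: "{S. S \<subseteq> insert j U \<and> (\<forall>i\<in>F. (\<Sum>j\<in>S. A i j) = b i)} = {S. ?P b S} \<union> insert j ` {S. ?P ?b S}"
  proof (intro set_eqI iffI)
    fix S assume *: "S \<in> {S. S \<subseteq> insert j U \<and> (\<forall>i\<in>F. (\<Sum>j\<in>S. A i j) = b i)}"
    show "S \<in> {S. ?P b S} \<union> insert j ` {S. ?P ?b S}"
    proof (cases "j \<in> S")
      case True
      define S' where "S' = S - {j}"
      have S': "S = insert j S'" "S' \<subseteq> U" using True * by (auto simp: S'_def)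
      have "?P ?b S'" using * S' S(1,2)[OF S'(2)] by (simp add: eq_diff_eq add.commute)
      then show ?thesis using S'(1) by blast
    next
      case False
      then show ?thesis using * by auto
    qed
  next
    fix S assume "S \<in> {S. ?P b S} \<union> insert j ` {S. ?P ?b S}"
    then show "S \<in> {S. S \<subseteq> insert j U \<and> (\<forall>i\<in>F. (\<Sum>j\<in>S. A i j) = b i)}"
    proof
      assume "S \<in> insert j ` {S. ?P ?b S}"
      then obtain S' where S': "S = insert j S'" "?P ?b S'" by blast
      then show ?thesis using S(1,2)[of S'] by auto
    qed auto
  qed
  have inj: "inj_on (insert j) {S. ?P ?b S}"
  proof (rule inj_onI)
    fix S S' assume "S \<in> {S. ?P ?b S}" "S' \<in> {S. ?P ?b S}" and eq: "insert j S = insert j S'"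
    then have "j \<notin> S" "j \<notin> S'" using S by blast+
    then show "S = S'" using eq by (simp add: insert_ident)
  qed
  have "psum A F (insert j U) b w = psum A F U b w + (\<Sum>S\<in>insert j ` {S. ?P ?b S}. \<Prod>j\<in>S. w j)"
    unfolding psum_def eq
  proof (rule sum.union_disjoint)
    show "{S. ?P b S} \<inter> insert j ` {S. ?P ?b S} = {}" using assms(2) by blast
  qed (use fin in simp_all)
  also have "(\<Sum>S\<in>insert j ` {S. ?P ?b S}. \<Prod>j\<in>S. w j) = (\<Sum>S | ?P ?b S. w j * (\<Prod>j\<in>S. w j))"
    unfolding sum.reindex[OF inj]
  proof (rule sum.cong)
    fix S assume "S \<in> {S. ?P ?b S}"
    then have "S \<subseteq> U" by simp
    from S[OF this] show "(prod w \<circ> insert j) S = w j * (\<Prod>j\<in>S. w j)" by simp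
  qed simp
  finally show ?thesis by (simp add: psum_def sum_distrib_left)
qed

lemma psum_cong:
  assumes "\<And>j. j \<in> U \<Longrightarrow> w j = w' j" "\<And>i. i \<in> F \<Longrightarrow> b i = b' i"
  shows "psum A F U b w = psum A F U b' w'"
  unfolding psum_def
proof (rule sum.cong)
  show "{S. S \<subseteq> U \<and> (\<forall>i\<in>F. (\<Sum>j\<in>S. A i j) = b i)} = {S. S \<subseteq> U \<and> (\<forall>i\<in>F. (\<Sum>j\<in>S. A i j) = b' i)}"
    using assms(2) by simp
  show "(\<Prod>j\<in>S. w j) = (\<Prod>j\<in>S. w' j)"
    if "S \<in> {S. S \<subseteq> U \<and> (\<forall>i\<in>F. (\<Sum>j\<in>S. A i j) = b' i)}" for S
    using that assms(1) by (intro prod.cong) auto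
qed

lemma psum_no_rows: "finite U \<Longrightarrow> psum A {} U b w = (\<Prod>j\<in>U. 1 + w j)"
proof (induction U arbitrary: b rule: finite_induct)
  case empty
  then show ?case by (simp add: psum_def)
next
  case (insert j U)
  then show ?case by (simp add: psum_insert algebra_simps)
qed

lemma psum_eq_0:
  assumes "i \<in> F" "b i \<noteq> 0" "\<And>j. j \<in> U \<Longrightarrow> A i j = 0"
  shows "psum A F U b w = 0"
proof -
  have "(\<Sum>j\<in>S. A i j) = 0" if "S \<subseteq> U" for S using assms(3) that by (intro sum.neutral) auto
  then have "{S. S \<subseteq> U \<and> (\<forall>i\<in>F. (\<Sum>j\<in>S. A i j) = b i)} = {}"
    using assms(1,2) by fastforce
  then show ?thesis unfolding psum_def by (simp only: sum.empty)
qed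

text \<open>This is a geometric series in an M-th root of unity. The bound on \<open>s\<close>
  leaves 0 as the only multiple of \<open>M\<close> in range, so finitely many roots already
  separate the attainable row sums.\<close>

lemma sum_cis_root:
  fixes s :: int
  assumes "0 < M" "\<bar>s\<bar> < int M"
  shows "(\<Sum>k<M. cis (2 * pi * real k * of_int s / real M)) = (if s = 0 then of_nat M else 0)"
proof (cases "s = 0")
  case True
  then show ?thesis by simp
next
  case False
  let ?x = "cis (2 * pi * of_int s / real M)"
  have eq: "cis (2 * pi * real k * of_int s / real M) = ?x ^ k" for k
    using Complex.DeMoivre[of "2 * pi * of_int s / real M" k] by (simp add: mult_ac)
  have "?x ^ M = cis (real M * (2 * pi * of_int s / real M))" by (rule Complex.DeMoivre)
  also have "real M * (2 * pi * of_int s / real M) = 2 * pi * of_int s" using assms(1) by simp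
  also have "cis (2 * pi * of_int s) = 1" by simp
  finally have one: "?x ^ M = 1" .
  have "?x \<noteq> 1"
  proof
    assume "?x = 1"
    then have "cos (2 * pi * of_int s / real M) = 1" by (metis cis.simps(1) one_complex.simps(1))
    then obtain l where "2 * pi * of_int s / real M = of_int l * 2 * pi"
      by (auto simp: cos_one_2pi_int)
    then have "real_of_int s = real_of_int l * real M" using assms(1) by (simp add: field_simps)
    then have "s = l * int M" by (metis of_int_eq_iff of_int_mult of_int_of_nat_eq)
    then show False using assms(2) False
      by (metis abs_mult abs_of_nat dvd_triv_right dvd_imp_le_int linorder_not_less)
  qed
  then show ?thesis using False one by (simp add: eq geometric_sum)
qed

text \<open>Averaging over roots of unity of large order replaces the integral over the torus.\<close>

lemma psum_average:
  fixes w :: "nat \<Rightarrow> complex"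
  assumes "finite U" "i \<notin> F" "0 < M" "(\<Sum>j\<in>U. \<bar>A i j\<bar>) + \<bar>b i\<bar> < int M"
  shows "of_nat M * psum A (insert i F) U b w =
    (\<Sum>k<M. cis (- 2 * pi * real k * of_int (b i) / real M) *
            psum A F U b (\<lambda>j. w j * cis (2 * pi * real k * of_int (A i j) / real M)))"
proof -
  let ?P = "\<lambda>S. S \<subseteq> U \<and> (\<forall>i\<in>F. (\<Sum>j\<in>S. A i j) = b i)"
  have fin: "finite {S. ?P S}" using assms(1) by (auto intro: finite_subset[of _ "Pow U"])
  have summand: "cis (- 2 * pi * real k * of_int (b i) / real M) *
       (\<Prod>j\<in>S. w j * cis (2 * pi * real k * of_int (A i j) / real M)) =
       (\<Prod>j\<in>S. w j) * cis (2 * pi * real k * of_int ((\<Sum>j\<in>S. A i j) - b i) / real M)" 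
    if "finite S" for S k
  proof -
    have "(\<Prod>j\<in>S. cis (2 * pi * real k * of_int (A i j) / real M)) =
          cis (2 * pi * real k * of_int (\<Sum>j\<in>S. A i j) / real M)"
      using that by (induction S rule: finite_induct) (simp_all add: cis_mult ring_distribs add_divide_distrib)
    then show ?thesis by (simp add: prod.distrib cis_mult ring_distribs add_divide_distrib diff_divide_distrib mult_ac)
  qed
  have "(\<Sum>k<M. cis (- 2 * pi * real k * of_int (b i) / real M) *
            psum A F U b (\<lambda>j. w j * cis (2 * pi * real k * of_int (A i j) / real M)))
    = (\<Sum>S | ?P S. \<Sum>k<M. (\<Prod>j\<in>S. w j) * cis (2 * pi * real k * of_int ((\<Sum>j\<in>S. A i j) - b i) / real M))"
    unfolding psum_def sum_distrib_left
    by (subst sum.swap, intro sum.cong refl summand) (use assms(1) finite_subset in blast)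
  also have "\<dots> = (\<Sum>S | ?P S. if (\<Sum>j\<in>S. A i j) = b i then of_nat M * (\<Prod>j\<in>S. w j) else 0)"
  proof (intro sum.cong refl)
    fix S assume "S \<in> {S. ?P S}"
    then have S: "S \<subseteq> U" by simp
    have "\<bar>\<Sum>j\<in>S. A i j\<bar> \<le> (\<Sum>j\<in>S. \<bar>A i j\<bar>)" by (rule sum_abs)
    also have "\<dots> \<le> (\<Sum>j\<in>U. \<bar>A i j\<bar>)" using S assms(1) by (intro sum_mono2) auto
    finally have "\<bar>(\<Sum>j\<in>S. A i j) - b i\<bar> < int M" using assms(4) by linarith
    from sum_cis_root[OF assms(3) this]
    show "(\<Sum>k<M. (\<Prod>j\<in>S. w j) * cis (2 * pi * real k * of_int ((\<Sum>j\<in>S. A i j) - b i) / real M)) = 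
      (if (\<Sum>j\<in>S. A i j) = b i then of_nat M * (\<Prod>j\<in>S. w j) else 0)"
      by (simp add: sum_distrib_left[symmetric])
  qed
  also have "\<dots> = (\<Sum>S\<in>{S \<in> {S. ?P S}. (\<Sum>j\<in>S. A i j) = b i}. of_nat M * (\<Prod>j\<in>S. w j))"
    by (subst sum.inter_filter[OF fin]) simp
  also have "{S \<in> {S. ?P S}. (\<Sum>j\<in>S. A i j) = b i} = {S. S \<subseteq> U \<and> (\<forall>i\<in>insert i F. (\<Sum>j\<in>S. A i j) = b i)}"
    by auto
  finally show ?thesis by (simp add: psum_def sum_distrib_left)
qed

text \<open>The tangents from the origin to the disc of radius \<open>sin \<alpha>\<close> around 1
  make the angle \<open>\<alpha>\<close> with the positive axis.\<close>

lemma abs_Im_Ln_le: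
  assumes "cmod y \<le> sin \<alpha>" "0 \<le> \<alpha>" "\<alpha> < pi/2"
  shows "1 + y \<noteq> 0" "\<bar>Im (Ln (1 + y))\<bar> \<le> \<alpha>"
proof -
  have lt: "sin \<alpha> < 1"
    using sin_monotone_2pi[of \<alpha> "pi/2"] assms by simp
  have re: "Re (1 + y) > 0" using assms(1) lt abs_Re_le_cmod[of y] by simp
  show nz: "1 + y \<noteq> 0" using re by force
  let ?t = "Im (Ln (1 + y))"
  have t: "\<bar>?t\<bar> < pi/2" using re Re_Ln_pos_lt[OF nz] by blast
  let ?R = "cmod (1 + y)"
  have eq: "1 + y = of_real ?R * cis ?t"
    by (metis Arg_eq_Im_Ln nz rcis_cmod_Arg rcis_def)
  have R: "Re y = ?R * cos ?t - 1" "Im y = ?R * sin ?t"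
    using arg_cong[OF eq, of Re] arg_cong[OF eq, of Im] by simp_all
  \<comment> \<open>The law of cosines with the square completed: \<open>\<bar>sin ?t\<bar>\<close>
    is the distance from 1 to the line of argument \<open>?t\<close>.\<close>
  have "(cmod y)\<^sup>2 = (?R - cos ?t)\<^sup>2 + (sin ?t)\<^sup>2"
  proof -
    have "(cmod y)\<^sup>2 = (?R * cos ?t - 1)\<^sup>2 + (?R * sin ?t)\<^sup>2"
      by (simp add: cmod_power2 flip: R)
    also have "\<dots> = ?R\<^sup>2 * ((cos ?t)\<^sup>2 + (sin ?t)\<^sup>2) - 2 * ?R * cos ?t + 1"
      by (simp only: power2_eq_square) algebra
    also have "(cos ?t)\<^sup>2 + (sin ?t)\<^sup>2 = 1" by simp
    also have "?R\<^sup>2 * 1 - 2 * ?R * cos ?t + 1 = (?R - cos ?t)\<^sup>2 + (1 - (cos ?t)\<^sup>2)"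
      by (simp only: power2_eq_square) algebra
    finally show ?thesis by (simp add: sin_squared_eq)
  qed
  then have "\<bar>sin ?t\<bar> \<le> cmod y"
    by (metis abs_norm_cancel abs_le_square_iff le_add_same_cancel2 zero_le_power2)
  then have "sin \<bar>?t\<bar> \<le> sin \<alpha>"
    using assms(1) by (smt (verit) sin_minus)
  then show "\<bar>?t\<bar> \<le> \<alpha>"
    using sin_mono_le_eq[of "\<bar>?t\<bar>" \<alpha>] t assms by simp
qed

text \<open>Adding the columns of \<open>V\<close> one by one multiplies the sum by factors 1 + y
  with \<open>cmod y \<le> sin \<alpha>\<close>, each turning the argument by at most
  \<open>\<alpha>\<close>. The form \<open>exp L\<close> records the accumulated turn without a
  choice of branch.\<close>

lemma psum_ratio:
  fixes w :: "nat \<Rightarrow> complex"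
  assumes "finite V" "finite X" "V \<inter> X = {}" "X \<union> V \<subseteq> U0"
    and \<alpha>: "0 \<le> \<alpha>" "\<alpha> < pi/2"
    and step: "\<And>Y j. Y \<subseteq> U0 \<Longrightarrow> j \<in> U0 \<Longrightarrow>
      cmod (w j * psum A F Y (\<lambda>i. - A i j) w) \<le> sin \<alpha> * cmod (psum A F Y (\<lambda>_. 0) w)"
    and nz: "\<And>Y. Y \<subseteq> U0 \<Longrightarrow> psum A F Y (\<lambda>_. 0) w \<noteq> 0"
  shows "\<exists>L. psum A F (X \<union> V) (\<lambda>_. 0) w = psum A F X (\<lambda>_. 0) w * exp L \<and> \<bar>Im L\<bar> \<le> real (card V) * \<alpha>"
  using assms(1-4)
proof (induction V rule: finite_induct)
  case empty
  then show ?case by (intro exI[of _ 0]) simp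
next
  case (insert j V)
  then obtain L where L: "psum A F (X \<union> V) (\<lambda>_. 0) w = psum A F X (\<lambda>_. 0) w * exp L"
    "\<bar>Im L\<bar> \<le> real (card V) * \<alpha>" by auto
  let ?Z = "psum A F (X \<union> V) (\<lambda>_. 0) w"
  define y where "y = w j * psum A F (X \<union> V) (\<lambda>i. - A i j) w / ?Z"
  have Z: "?Z \<noteq> 0" using insert.prems by (intro nz) auto
  have "cmod y \<le> sin \<alpha>"
    using step[of "X \<union> V" j] insert.prems Z by (simp add: y_def norm_divide norm_mult divide_le_eq)
  note y = abs_Im_Ln_le[OF this \<alpha>]
  have "psum A F (X \<union> insert j V) (\<lambda>_. 0) w = ?Z + w j * psum A F (X \<union> V) (\<lambda>i. - A i j) w"
    using psum_insert[of "X \<union> V" j A F "\<lambda>_. 0" w] insert by simp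
  also have "\<dots> = ?Z * (1 + y)" using Z by (simp add: y_def field_simps)
  also have "\<dots> = psum A F X (\<lambda>_. 0) w * exp (L + Ln (1 + y))"
    using L(1) y(1) by (simp add: exp_add)
  finally have 1: "psum A F (X \<union> insert j V) (\<lambda>_. 0) w = psum A F X (\<lambda>_. 0) w * exp (L + Ln (1 + y))" .
  have "\<bar>Im (L + Ln (1 + y))\<bar> \<le> real (card (insert j V)) * \<alpha>"
    using L(2) y(2) insert.hyps by (simp add: algebra_simps)
  with 1 show ?case by blast
qed

text \<open>Induction on the number of imposed rows. \<open>R\<close> collects the rows where the
  right-hand side may differ from 0, and each costs a factor \<open>cos \<phi>\<close>.
  \<open>U\<close> and \<open>w\<close> vary in the induction because averaging trades a row for
  unimodular factors of the weights; the ambient \<open>U0\<close> and \<open>F0\<close> keep the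
  sparsity bounds fixed.\<close>

lemma psum_zero_free:
  fixes A :: "nat \<Rightarrow> nat \<Rightarrow> int" and \<delta> \<phi> :: real
  assumes fin: "finite U0" "finite F0"
    and row: "\<And>i. i \<in> F0 \<Longrightarrow> card {j\<in>U0. A i j \<noteq> 0} \<le> r"
    and col: "\<And>j. j \<in> U0 \<Longrightarrow> card {i\<in>F0. A i j \<noteq> 0} \<le> c"
    and \<phi>: "0 < \<phi>" "\<phi> < pi/2" "0 < r" "\<delta> \<le> sin (\<phi> / r) * cos \<phi> ^ c"
    and "F \<subseteq> F0" "U \<subseteq> U0" "\<And>j. j \<in> U0 \<Longrightarrow> cmod (w j) \<le> \<delta>"
  shows "psum A F U (\<lambda>_. 0) w \<noteq> 0 \<and>
    (\<forall>R b. R \<subseteq> F \<longrightarrow> (\<forall>i\<in>F-R. b i = 0) \<longrightarrow>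
       cos \<phi> ^ card R * cmod (psum A F U b w) \<le> cmod (psum A F U (\<lambda>_. 0) w))"
  using assms(9-11)
proof (induction "card F" arbitrary: F U w)
  have cos: "0 < cos \<phi>" "cos \<phi> \<le> 1" using \<phi> cos_gt_zero by auto
  have "\<phi> / r \<le> \<phi> / 1" using \<phi> by (intro divide_left_mono) auto
  then have sr: "0 < \<phi> / r" "\<phi> / r < pi / 2"
    using \<phi>(1-3) by (simp, linarith)
  then have "0 \<le> \<phi> / r" "\<phi> / r \<le> pi" by linarith+
  then have sin_nonneg: "0 \<le> sin (\<phi> / r)" by (rule sin_ge_zero)
  have sin1: "sin (\<phi> / r) < 1" using sr sin_monotone_2pi[of "\<phi>/r" "pi/2"] by simp
  {
    case 0
    then have F: "F = {}" using fin(2) finite_subset by fastforce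
    have U: "finite U" using 0 fin finite_subset by blast
    have "\<delta> < 1"
    proof -
      have "sin (\<phi> / r) * cos \<phi> ^ c \<le> sin (\<phi> / r) * 1"
        using cos sin_nonneg by (intro mult_left_mono power_le_one) auto
      then show ?thesis using \<phi>(4) sin1 by linarith
    qed
    then have "1 + w j \<noteq> 0" if "j \<in> U" for j
      using 0(4)[of j] that 0(3) by (metis add_eq_0_iff norm_minus_cancel norm_one not_less order.strict_trans1 subsetD)
    then show ?case using U F by (simp add: psum_no_rows subset_empty)
  next
    case (Suc k)
    then have finF: "finite F" "finite U"
      using fin by (auto intro: finite_subset)
    \<comment> \<open>One row \<open>i\<close> is split off, and the hypothesis is used for the
      remaining rows \<open>G\<close>. For a nonempty \<open>R\<close> this row is taken from
      \<open>R\<close>, which pays for its factor \<open>cos \<phi>\<close>.\<close>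
    have key: "psum A F U (\<lambda>_. 0) w \<noteq> 0 \<and>
       (\<forall>R b. i \<in> R \<longrightarrow> R \<subseteq> F \<longrightarrow> (\<forall>i\<in>F-R. b i = 0) \<longrightarrow>
       cos \<phi> ^ card R * cmod (psum A F U b w) \<le> cmod (psum A F U (\<lambda>_. 0) w))" if i: "i \<in> F" for i
    proof -
      define G where "G = F - {i}"
      have G: "F = insert i G" "i \<notin> G" "k = card G" "G \<subseteq> F0"
        using i Suc finF by (auto simp: G_def)
      \<comment> \<open>For right-hand side 0 the averaged terms lie in a cone of half-angle
        \<open>\<phi>\<close>, so after division by \<open>z0\<close> their real parts add
        up.\<close>
      have lower: "real M * cmod (psum A F U (\<lambda>_. 0) w) \<ge>
          cos \<phi> * (\<Sum>k<M. cmod (psum A G U (\<lambda>_. 0) (\<lambda>j. w j * cis (2 * pi * real k * of_int (A i j) / real M))))"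
        if M: "0 < M" "(\<Sum>j\<in>U. \<bar>A i j\<bar>) < int M" for M
      proof -
        define V where "V = {j\<in>U. A i j \<noteq> 0}"
        define X where "X = U - V"
        define v where "v = (\<lambda>k j. w j * cis (2 * pi * real k * of_int (A i j) / real M))"
        have v: "cmod (v k j) \<le> \<delta>" if "j \<in> U0" for k j
          using Suc.prems that by (simp add: v_def norm_mult)
        \<comment> \<open>Columns that vanish in row \<open>i\<close> are untouched by the
          characters, so \<open>z0\<close> is the same for all \<open>k\<close> and gives the common
          direction.\<close>
        define z0 where "z0 = psum A G X (\<lambda>_. 0) w"
        have z0: "z0 = psum A G X (\<lambda>_. 0) (v k)" for k
          unfolding z0_def by (rule psum_cong) (auto simp: X_def V_def v_def)
        have nz: "z0 \<noteq> 0"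
          unfolding z0_def using Suc.hyps(1)[OF G(3,4), of X w] Suc.prems by (auto simp: X_def)
        have VX: "V \<union> X = U" "V \<inter> X = {}" "finite V" "finite X" "U = X \<union> V"
          using finF by (auto simp: X_def V_def)
        have "card V \<le> card {j\<in>U0. A i j \<noteq> 0}"
          using Suc.prems fin by (intro card_mono) (auto simp: V_def)
        then have cV: "card V \<le> r" using row[of i] i Suc.prems by force
        have cone: "\<exists>L. psum A G U (\<lambda>_. 0) (v k) = z0 * exp L \<and> \<bar>Im L\<bar> \<le> \<phi>" for k
        proof -
          have "cmod (v k j * psum A G Y (\<lambda>i. - A i j) (v k)) \<le> sin (\<phi>/r) * cmod (psum A G Y (\<lambda>_. 0) (v k))" 
            if "Y \<subseteq> U0" "j \<in> U0" for Y j
          proof -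
            \<comment> \<open>The right-hand side belonging to column \<open>j\<close> is nonzero in
              at most \<open>c\<close> rows, so the comparison loses at most
              \<open>cos \<phi> ^ c\<close>, which the bound on \<open>\<delta>\<close> makes up
              for.\<close>
            let ?R = "{i\<in>G. A i j \<noteq> 0}"
            have "card ?R \<le> card {i\<in>F0. A i j \<noteq> 0}" using G fin by (intro card_mono) auto
            then have c: "card ?R \<le> c" using col[OF that(2)] by linarith
            have "cos \<phi> ^ c * cmod (psum A G Y (\<lambda>i. - A i j) (v k)) \<le> 
              cos \<phi> ^ card ?R * cmod (psum A G Y (\<lambda>i. - A i j) (v k))"
              using c cos by (intro mult_right_mono power_decreasing) auto
            also have "\<dots> \<le> cmod (psum A G Y (\<lambda>_. 0) (v k))"
              using Suc.hyps(1)[OF G(3,4) that(1) v] by auto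
            finally have D: "cos \<phi> ^ c * cmod (psum A G Y (\<lambda>i. - A i j) (v k)) \<le> cmod (psum A G Y (\<lambda>_. 0) (v k))" .
            have "cmod (v k j * psum A G Y (\<lambda>i. - A i j) (v k)) \<le> 
              (sin (\<phi>/r) * cos \<phi> ^ c) * cmod (psum A G Y (\<lambda>i. - A i j) (v k))"
              unfolding norm_mult using v[OF that(2)] \<phi>(4) by (intro mult_right_mono) (auto intro: order_trans)
            also have "\<dots> \<le> sin (\<phi>/r) * cmod (psum A G Y (\<lambda>_. 0) (v k))"
              unfolding mult.assoc using sin_nonneg by (intro mult_left_mono[OF D])
            finally show ?thesis .
          qed
          moreover have "psum A G Y (\<lambda>_. 0) (v k) \<noteq> 0" if "Y \<subseteq> U0" for Y
            using Suc.hyps(1)[OF G(3,4) that v] by auto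
          ultimately obtain L where L: "psum A G (X \<union> V) (\<lambda>_. 0) (v k) = psum A G X (\<lambda>_. 0) (v k) * exp L" 
            "\<bar>Im L\<bar> \<le> real (card V) * (\<phi> / r)"
            using psum_ratio[OF VX(3,4,2), of U0 "\<phi>/r" "v k" A G] sr Suc.prems VX by auto
          have "real (card V) * (\<phi> / r) \<le> r * (\<phi> / r)" using cV sr by (intro mult_right_mono) auto
          also have "\<dots> = \<phi>" using \<phi> by simp
          finally show ?thesis using L z0 VX by auto
        qed
        have re: "Re (psum A G U (\<lambda>_. 0) (v k) / z0) \<ge> cos \<phi> * cmod (psum A G U (\<lambda>_. 0) (v k) / z0)" for k
        proof -
          from cone[of k] obtain L where L: "psum A G U (\<lambda>_. 0) (v k) = z0 * exp L" "\<bar>Im L\<bar> \<le> \<phi>" by blast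
          have "cos \<phi> \<le> cos \<bar>Im L\<bar>" using L(2) \<phi> by (intro cos_monotone_0_pi_le) auto
          then have "cos \<phi> \<le> cos (Im L)" by simp
          then show ?thesis using L(1) nz by (simp add: Re_exp)
        qed
        have "of_nat M * psum A F U (\<lambda>_. 0) w = (\<Sum>k<M. psum A G U (\<lambda>_. 0) (v k))"
          using psum_average[of U i G M A "\<lambda>_. 0" w] finF(2) G M by (simp add: v_def)
        then have eq: "of_nat M * psum A F U (\<lambda>_. 0) w / z0 = (\<Sum>k<M. psum A G U (\<lambda>_. 0) (v k) / z0)"
          by (simp add: sum_divide_distrib)
        have "cos \<phi> * (\<Sum>k<M. cmod (psum A G U (\<lambda>_. 0) (v k) / z0)) \<le> (\<Sum>k<M. Re (psum A G U (\<lambda>_. 0) (v k) / z0))"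
          unfolding sum_distrib_left by (intro sum_mono re)
        also have "\<dots> = Re (of_nat M * psum A F U (\<lambda>_. 0) w / z0)" by (simp add: eq)
        also have "\<dots> \<le> cmod (of_nat M * psum A F U (\<lambda>_. 0) w / z0)" by (rule complex_Re_le_cmod)
        finally have "cos \<phi> * (\<Sum>k<M. cmod (psum A G U (\<lambda>_. 0) (v k))) / cmod z0 \<le> real M * cmod (psum A F U (\<lambda>_. 0) w) / cmod z0"
          by (simp add: norm_divide norm_mult flip: sum_divide_distrib)
        then show ?thesis using nz by (simp add: divide_le_cancel v_def)
      qed
      have v: "cmod (w j * cis x) \<le> \<delta>" if "j \<in> U0" for x j
          using Suc.prems that by (simp add: norm_mult)
      have bound: "cos \<phi> ^ card R * cmod (psum A F U b w) \<le> cmod (psum A F U (\<lambda>_. 0) w)"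
        if R: "i \<in> R" "R \<subseteq> F" "\<forall>i\<in>F-R. b i = 0" for R b
      proof -
        define M where "M = nat ((\<Sum>j\<in>U. \<bar>A i j\<bar>) + \<bar>b i\<bar> + 1)"
        have "0 \<le> (\<Sum>j\<in>U. \<bar>A i j\<bar>)" by (simp add: sum_nonneg)
        then have M: "0 < M" "(\<Sum>j\<in>U. \<bar>A i j\<bar>) + \<bar>b i\<bar> < int M" "(\<Sum>j\<in>U. \<bar>A i j\<bar>) < int M"
          by (auto simp: M_def)
        define v where "v = (\<lambda>k j. w j * cis (2 * pi * real k * of_int (A i j) / real M))"
        have card: "card R = Suc (card (R - {i}))" 
          using R finF by (metis card.remove finite_subset)
        \<comment> \<open>For a general right-hand side the characters only contribute unimodular
          factors, so the triangle inequality is enough; \<open>lower\<close> then costs the one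
          additional \<open>cos \<phi>\<close>.\<close>
        have "real M * cmod (psum A F U b w) = cmod (of_nat M * psum A F U b w)"
          by (simp add: norm_mult)
        also have "\<dots> = cmod (\<Sum>k<M. cis (- 2 * pi * real k * of_int (b i) / real M) * psum A G U b (v k))"
          using psum_average[of U i G M A b w] finF(2) G M(1,2) by (simp add: v_def)
        also have "\<dots> \<le> (\<Sum>k<M. cmod (psum A G U b (v k)))"
          by (rule order_trans[OF norm_sum]) (simp add: norm_mult)
        finally have "cos \<phi> ^ card R * (real M * cmod (psum A F U b w)) \<le> 
           cos \<phi> ^ card R * (\<Sum>k<M. cmod (psum A G U b (v k)))"
          using cos by (intro mult_left_mono) auto
        also have "\<dots> = cos \<phi> * (\<Sum>k<M. cos \<phi> ^ card (R-{i}) * cmod (psum A G U b (v k)))"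
          by (simp add: card sum_distrib_left mult.assoc)
        also have "\<dots> \<le> cos \<phi> * (\<Sum>k<M. cmod (psum A G U (\<lambda>_. 0) (v k)))"
        proof (intro mult_left_mono sum_mono)
          fix k
          have "R - {i} \<subseteq> G" "\<forall>i\<in>G-(R-{i}). b i = 0" using R G by auto
          then show "cos \<phi> ^ card (R-{i}) * cmod (psum A G U b (v k)) \<le> cmod (psum A G U (\<lambda>_. 0) (v k))"
            using Suc.hyps(1)[OF G(3,4) Suc.prems(2), of "v k"] v by (auto simp: v_def)
        qed (use cos in auto)
        also have "\<dots> \<le> real M * cmod (psum A F U (\<lambda>_. 0) w)"
          using lower[OF M(1,3)] by (simp add: v_def)
        finally show ?thesis using M(1) by simp
      qed
      have "psum A F U (\<lambda>_. 0) w \<noteq> 0"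
      proof
        assume z: "psum A F U (\<lambda>_. 0) w = 0"
        define M where "M = nat ((\<Sum>j\<in>U. \<bar>A i j\<bar>) + 1)"
        have "0 \<le> (\<Sum>j\<in>U. \<bar>A i j\<bar>)" by (simp add: sum_nonneg)
        then have M: "0 < M" "(\<Sum>j\<in>U. \<bar>A i j\<bar>) < int M" by (auto simp: M_def)
        define v where "v = (\<lambda>k j. w j * cis (2 * pi * real k * of_int (A i j) / real M))"
        have "psum A G U (\<lambda>_. 0) (v k) \<noteq> 0" for k
          using Suc.hyps(1)[OF G(3,4) Suc.prems(2), of "v k"] v by (auto simp: v_def)
        then have "0 < cos \<phi> * (\<Sum>k<M. cmod (psum A G U (\<lambda>_. 0) (v k)))"
          using M(1) cos by (intro mult_pos_pos sum_pos) auto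
        then show False using lower[OF M] z by (simp add: v_def)
      qed
      with bound show ?thesis by blast
    qed
    have "F \<noteq> {}" using Suc.hyps(2) by auto
    then have nz: "psum A F U (\<lambda>_. 0) w \<noteq> 0" using key by blast
    have "cos \<phi> ^ card R * cmod (psum A F U b w) \<le> cmod (psum A F U (\<lambda>_. 0) w)"
      if R: "R \<subseteq> F" "\<forall>i\<in>F-R. b i = 0" for R b
    proof (cases "R = {}")
      case True
      then have "psum A F U b w = psum A F U (\<lambda>_. 0) w" using R by (intro psum_cong) auto
      then show ?thesis using True by simp
    next
      case False
      then obtain i where "i \<in> R" by blast
      then show ?thesis using key[of i] R by blast
    qed
    with nz show ?case by blast
  }
qed

text \<open>For p = 0.8 / sqrt c the estimate cos x \<ge> 1 - x^2 / 2 gives \<open>cos p ^ c\<close>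
  \<ge> 1 - 0.64 / 2 = 17/25, and since p / r \<le> 2/5 it gives sin (p / r) \<ge> (23/25) (p / r).
  The product 0.8 * 23/25 * 17/25 exceeds 0.46.\<close>

lemma angle_exists:
  fixes r c :: nat
  assumes "2 \<le> r" "1 \<le> c"
  obtains \<phi> where "0 < \<phi>" "\<phi> \<le> (0.8::real)" "0.46 / (real r * sqrt c) \<le> sin (\<phi> / r) * cos \<phi> ^ c"
proof -
  define p :: real where "p = 4/5 / sqrt c"
  have sq: "sqrt (real c) \<ge> 1" using assms by simp
  then have p: "0 < p" "p \<le> 4/5" by (auto simp: p_def divide_le_eq)
  have cos_ge: "1 - x\<^sup>2 / 2 \<le> cos x" for x :: real
  proof -
    have "cos x = 1 - 2 * (sin (x/2))\<^sup>2" using cos_double_sin[of "x/2"] by simp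
    moreover have "\<bar>sin (x/2)\<bar> \<le> \<bar>x/2\<bar>" by (rule abs_sin_x_le_abs_x)
    then have "(sin (x/2))\<^sup>2 \<le> (x/2)\<^sup>2" by (simp only: abs_le_square_iff)
    ultimately show ?thesis by (simp add: power_divide)
  qed
  have p2: "p\<^sup>2 = 16/25 / c" using assms by (simp add: p_def power_divide power2_eq_square)
  have p1: "p\<^sup>2 \<le> 1" unfolding p2 using assms by simp
  \<comment> \<open>Bernoulli makes the bound on \<open>cos p ^ c\<close> independent of \<open>c\<close>.\<close>
  have "1 + real c * (- p\<^sup>2 / 2) \<le> (1 + (- p\<^sup>2 / 2)) ^ c"
    using p1 by (intro Bernoulli_inequality) auto
  also have "\<dots> \<le> cos p ^ c"
    using p1 cos_ge[of p] by (intro power_mono) auto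
  finally have cosc: "17/25 \<le> cos p ^ c" using p2 assms by simp
  let ?x = "p / r"
  have "?x \<le> p / 2" using p assms(1) by (intro divide_left_mono) auto
  then have x: "0 < ?x" "?x \<le> 2/5" using assms p by (auto intro: order_trans)
  have "?x\<^sup>2 \<le> (2/5)\<^sup>2" using x by (intro power_mono) auto
  then have x2: "?x\<^sup>2 \<le> 4/25" by (simp add: power2_eq_square)
  obtain z where z: "0 < z" "z < ?x" "sin ?x = ?x * cos z"
    using MVT2[of 0 ?x sin cos] x(1) by auto
  have "z\<^sup>2 \<le> ?x\<^sup>2" using z by (intro power_mono) auto
  then have "23/25 \<le> cos z" using cos_ge[of z] x2 by linarith
  then have "?x * (23/25) \<le> sin ?x" unfolding z(3) using x(1) by (simp only: mult.assoc times_divide_eq_right[symmetric] mult_le_cancel_left_pos)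
  have "0.46 / (real r * sqrt c) \<le> ?x * (23/25) * (17/25)"
    using sq assms by (simp add: p_def field_simps)
  also have "\<dots> \<le> sin ?x * cos p ^ c"
    using cosc x \<open>?x * (23/25) \<le> sin ?x\<close> by (intro mult_mono) auto
  finally show thesis using that[of p] p by simp
qed

section \<open>Generating functions and the Taylor series of the logarithm\<close>

lemma weight_solutions:
  "weight n w (solutions m n A) = psum A {..<m} {..<n} (\<lambda>_. 0) w"
  unfolding weight_def psum_def
proof (rule sum.reindex_bij_witness)
  let ?to = "\<lambda>x::nat \<Rightarrow> nat. {j. j < n \<and> x j = 1}"
  let ?of = "\<lambda>S. \<lambda>j\<in>{..<n}. if j \<in> S then 1 else 0 :: nat"
  have val: "x j = (if j \<in> ?to x then 1 else 0)" if "x \<in> solutions m n A" "j < n" for x j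
    using that by (auto simp: solutions_def PiE_def Pi_def)
  fix x assume x: "x \<in> solutions m n A"
  show "?of (?to x) = x"
  proof
    fix j show "?of (?to x) j = x j"
      using x val[OF x, of j] by (cases "j < n") (auto simp: solutions_def PiE_def extensional_def)
  qed
  have "(\<Sum>j\<in>?to x. A i j) = (\<Sum>j<n. A i j * int (x j))" for i
  proof -
    have "(\<Sum>j<n. A i j * int (x j)) = (\<Sum>j\<in>{..<n}. if x j = 1 then A i j else 0)"
    proof (intro sum.cong refl)
      fix j assume "j \<in> {..<n}"
      then show "A i j * int (x j) = (if x j = 1 then A i j else 0)"
        using val[OF x, of j] by (simp split: if_splits)
    qed
    also have "\<dots> = (\<Sum>j\<in>{j\<in>{..<n}. x j = 1}. A i j)" by (subst sum.inter_filter) auto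
    finally show ?thesis by simp
  qed
  then show "?to x \<in> {S. S \<subseteq> {..<n} \<and> (\<forall>i\<in>{..<m}. (\<Sum>j\<in>S. A i j) = 0)}"
    using x by (auto simp: solutions_def)
  have "(\<Prod>j<n. w j ^ x j) = (\<Prod>j\<in>{..<n}. if x j = 1 then w j else 1)"
  proof (intro prod.cong refl)
    fix j assume "j \<in> {..<n}"
    then show "w j ^ x j = (if x j = 1 then w j else 1)"
      using val[OF x, of j] by (simp split: if_splits)
  qed
  also have "\<dots> = (\<Prod>j\<in>{j\<in>{..<n}. x j = 1}. w j)" by (subst prod.inter_filter) auto
  finally show "(\<Prod>j\<in>?to x. w j) = (\<Prod>j<n. w j ^ x j)" by simp
next
  let ?to = "\<lambda>x::nat \<Rightarrow> nat. {j. j < n \<and> x j = 1}"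
  let ?of = "\<lambda>S. \<lambda>j\<in>{..<n}. if j \<in> S then 1 else 0 :: nat"
  fix S assume S: "S \<in> {S. S \<subseteq> {..<n} \<and> (\<forall>i\<in>{..<m}. (\<Sum>j\<in>S. A i j) = 0)}"
  then show "?to (?of S) = S" by auto
  have "(\<Sum>j<n. A i j * int (?of S j)) = (\<Sum>j\<in>S. A i j)" for i
  proof -
    have "(\<Sum>j<n. A i j * int (?of S j)) = (\<Sum>j\<in>{..<n}. if j \<in> S then A i j else 0)"
      by (intro sum.cong) auto
    also have "\<dots> = (\<Sum>j\<in>{j\<in>{..<n}. j \<in> S}. A i j)" by (subst sum.inter_filter) auto
    also have "{j\<in>{..<n}. j \<in> S} = S" using S by auto
    finally show ?thesis .
  qed
  then show "?of S \<in> solutions m n A" using S by (auto simp: solutions_def)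
qed

text \<open>The columns in \<open>C\<close> count as already taken, so the others have to sum to the
  negative.\<close>

definition rhs :: "(nat \<Rightarrow> nat \<Rightarrow> int) \<Rightarrow> nat set \<Rightarrow> nat \<Rightarrow> int" where
  "rhs A C i = - (\<Sum>j\<in>C. A i j)"

lemma rhs_singleton: "rhs A {j} i = - A i j" by (simp add: rhs_def)

lemma rhs_insert: "finite C \<Longrightarrow> k \<notin> C \<Longrightarrow> rhs A (insert k C) i = rhs A C i - A i k"
  by (simp add: rhs_def)

locale weighted_system =
  fixes m n :: nat and A :: "nat \<Rightarrow> nat \<Rightarrow> int" and w :: "nat \<Rightarrow> complex"
begin

text \<open>Since \<open>psum\<close> is polymorphic in the semiring, weights w_j X turn it into the
  generating polynomial whose value at z belongs to the weights z w_j.\<close>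

definition Z :: "nat set \<Rightarrow> (nat \<Rightarrow> int) \<Rightarrow> complex fps" where
  "Z U b = psum A {..<m} U b (\<lambda>j. fps_const (w j) * fps_X)"

text \<open>The denominator has constant term 1, hence is invertible as a formal series whatever the
  weights are.\<close>

definition Q :: "nat set \<Rightarrow> (nat \<Rightarrow> int) \<Rightarrow> complex fps" where
  "Q U b = Z U b * inverse (Z U (\<lambda>_. 0))"

lemma Z_nth_0: "finite U \<Longrightarrow> Z U (\<lambda>_. 0) $ 0 = 1"
proof (induction U rule: finite_induct)
  case (insert j U)
  then show ?case by (simp add: Z_def psum_insert fps_mult_nth)
next
  case empty
  have "{S. S \<subseteq> {} \<and> (\<forall>i\<in>{..<m}. (\<Sum>j\<in>S. A i j) = 0)} = {{}}" by auto
  then show ?case unfolding Z_def psum_def by simp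
qed

lemma Z_eq: "finite U \<Longrightarrow> Z U b = Q U b * Z U (\<lambda>_. 0)"
  using Z_nth_0[of U] by (simp add: Q_def mult.assoc inverse_mult_eq_1)

lemma Q_trivial_rhs: "finite U \<Longrightarrow> (\<And>i. i < m \<Longrightarrow> b i = 0) \<Longrightarrow> Q U b = 1"
proof -
  assume *: "finite U" "\<And>i. i < m \<Longrightarrow> b i = 0"
  have "Z U b = Z U (\<lambda>_. 0)" unfolding Z_def by (rule psum_cong) (use * in auto)
  then show "Q U b = 1" using Z_nth_0[OF *(1)] by (simp add: Q_def inverse_mult_eq_1')
qed

lemma Q_unreachable: "i < m \<Longrightarrow> b i \<noteq> 0 \<Longrightarrow> (\<And>j. j \<in> U \<Longrightarrow> A i j = 0) \<Longrightarrow> Q U b = 0"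
  unfolding Q_def Z_def by (subst psum_eq_0[of i]) auto

text \<open>Divide the splitting of \<open>Z U b\<close> at column \<open>k\<close> by that for
  right-hand side 0 and clear the denominator. Leaving \<open>Q U b\<close> on the right is
  harmless: it stands behind a factor X, so the expansion up to a fixed degree still ends, and no
  division remains.\<close>

lemma Q_split:
  assumes "finite U" "k \<in> U"
  shows "Q U b = Q (U - {k}) b + fps_const (w k) * fps_X *
           (Q (U - {k}) (\<lambda>i. b i - A i k) - Q U b * Q (U - {k}) (\<lambda>i. - A i k))"
proof -
  let ?U = "U - {k}" and ?x = "fps_const (w k) * fps_X"
  have U: "U = insert k ?U" using assms(2) by auto
  have fin: "finite ?U" "finite U" using assms(1) by auto
  have split: "Z U b = Z ?U b + ?x * Z ?U (\<lambda>i. b i - A i k)" for b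
    using psum_insert[of ?U k A "{..<m}" b "\<lambda>j. fps_const (w j) * fps_X"] fin U by (simp add: Z_def)
  have nz: "Z ?U (\<lambda>_. 0) \<noteq> 0" using Z_nth_0[OF fin(1)] by auto
  have "Q U b * (1 + ?x * Q ?U (\<lambda>i. - A i k)) * Z ?U (\<lambda>_. 0) =
     Q U b * (Z ?U (\<lambda>_. 0) + ?x * Z ?U (\<lambda>i. - A i k))"
    using Z_eq[OF fin(1), of "\<lambda>i. - A i k"] by (simp add: algebra_simps)
  also have "\<dots> = Q U b * Z U (\<lambda>_. 0)" using split[of "\<lambda>_. 0"] by simp
  also have "\<dots> = Z U b" by (rule Z_eq[OF fin(2), symmetric])
  also have "\<dots> = (Q ?U b + ?x * Q ?U (\<lambda>i. b i - A i k)) * Z ?U (\<lambda>_. 0)"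
    unfolding split[of b] using Z_eq[OF fin(1)] by (metis (no_types, lifting) distrib_right mult.assoc)
  finally have "Q U b * (1 + ?x * Q ?U (\<lambda>i. - A i k)) = Q ?U b + ?x * Q ?U (\<lambda>i. b i - A i k)"
    using nz by simp
  then show ?thesis by (simp add: algebra_simps eq_diff_eq)
qed

text \<open>Logarithm of the quotient of the sums over the first j + 1 and the first j columns; the
  product of these quotients telescopes to the weight.\<close>

definition log_ratio :: "nat \<Rightarrow> complex fps" where
  "log_ratio j = fps_compose (fps_ln 1) (fps_const (w j) * fps_X * Q {..<j} (rhs A {j}))"

definition taylor_value :: "nat \<Rightarrow> complex" where
  "taylor_value N = (\<Sum>j<n. \<Sum>l\<le>N. log_ratio j $ l)"

text \<open>In ln (1 + u) = sum of - (- u)^k / k the power u^k already carries X^k. The power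
  \<open>Suc k\<close> therefore needs the coefficients of Q up to degree N - (k + 1) only, which
  are the \<open>i < N - k\<close>.\<close>

lemma sum_log_ratio:
  "(\<Sum>l\<le>N. log_ratio j $ l) =
   (\<Sum>k<N. (- ((- w j) ^ Suc k)) / of_nat (Suc k) * (\<Sum>i<N - k. (Q {..<j} (rhs A {j}) ^ Suc k) $ i))"
proof -
  define q where "q = Q {..<j} (rhs A {j})"
  have pow: "(fps_const (w j) * fps_X * q) ^ k = fps_const (w j ^ k) * (fps_X ^ k * q ^ k)" for k
    by (simp add: power_mult_distrib fps_const_power mult.assoc)
  have nth: "log_ratio j $ l = (\<Sum>k\<le>N. if 0 < k \<and> k \<le> l then (- ((- w j) ^ k)) / of_nat k * (q ^ k) $ (l - k) else 0)"
    if "l \<le> N" for l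
  proof -
    have "log_ratio j $ l = (\<Sum>k=0..l. fps_ln 1 $ k * (w j ^ k * (if l < k then 0 else (q ^ k) $ (l - k))))"
      unfolding log_ratio_def fps_compose_nth q_def[symmetric] pow
      by (simp add: fps_X_power_mult_nth)
    also have "\<dots> = (\<Sum>k=0..l. if 0 < k \<and> k \<le> l then (- ((- w j) ^ k)) / of_nat k * (q ^ k) $ (l - k) else 0)"
    proof (intro sum.cong refl)
      fix k assume "k \<in> {0..l}"
      moreover have "(- w j) ^ k = - ((- 1) ^ (k - 1) * w j ^ k)" if "0 < k"
        using that by (cases k) (simp_all add: power_minus[of "w j"])
      ultimately show "fps_ln 1 $ k * (w j ^ k * (if l < k then 0 else (q ^ k) $ (l - k))) =
        (if 0 < k \<and> k \<le> l then (- ((- w j) ^ k)) / of_nat k * (q ^ k) $ (l - k) else 0)"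
        by (simp add: fps_ln_nth)
    qed
    also have "\<dots> = (\<Sum>k\<le>N. if 0 < k \<and> k \<le> l then (- ((- w j) ^ k)) / of_nat k * (q ^ k) $ (l - k) else 0)"
      using that by (intro sum.mono_neutral_left) auto
    finally show ?thesis .
  qed
  have "(\<Sum>l\<le>N. log_ratio j $ l) =
      (\<Sum>k\<le>N. \<Sum>l\<le>N. if 0 < k \<and> k \<le> l then (- ((- w j) ^ k)) / of_nat k * (q ^ k) $ (l - k) else 0)"
    by (subst sum.swap) (intro sum.cong refl nth, simp)
  also have "\<dots> = (\<Sum>k\<in>Suc ` {..<N}. \<Sum>l\<le>N. if 0 < k \<and> k \<le> l then (- ((- w j) ^ k)) / of_nat k * (q ^ k) $ (l - k) else 0)"
  proof (rule sum.mono_neutral_right)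
    show "Suc ` {..<N} \<subseteq> {..N}" by auto
    show "\<forall>k\<in>{..N} - Suc ` {..<N}. (\<Sum>l\<le>N. if 0 < k \<and> k \<le> l then (- ((- w j) ^ k)) / of_nat k * (q ^ k) $ (l - k) else 0) = 0"
    proof (intro ballI)
      fix k assume "k \<in> {..N} - Suc ` {..<N}"
      then have k0: "k = 0" by (cases k) auto
      show "(\<Sum>l\<le>N. if 0 < k \<and> k \<le> l then (- ((- w j) ^ k)) / of_nat k * (q ^ k) $ (l - k) else 0) = 0"
        unfolding k0 by simp
    qed
  qed auto
  also have "\<dots> = (\<Sum>k<N. \<Sum>l\<le>N. if Suc k \<le> l then (- ((- w j) ^ Suc k)) / of_nat (Suc k) * (q ^ Suc k) $ (l - Suc k) else 0)"
    by (subst sum.reindex) (auto simp: o_def)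
  also have "\<dots> = (\<Sum>k<N. \<Sum>i<N - k. (- ((- w j) ^ Suc k)) / of_nat (Suc k) * (q ^ Suc k) $ i)"
  proof (rule sum.cong[OF refl])
    fix k assume k: "k \<in> {..<N}"
    have "(\<Sum>l\<le>N. if Suc k \<le> l then (- ((- w j) ^ Suc k)) / of_nat (Suc k) * (q ^ Suc k) $ (l - Suc k) else 0)
      = (\<Sum>l\<in>{Suc k..N}. (- ((- w j) ^ Suc k)) / of_nat (Suc k) * (q ^ Suc k) $ (l - Suc k))"
      by (rule sum.mono_neutral_cong_right) auto
    also have "\<dots> = (\<Sum>i<N - k. (- ((- w j) ^ Suc k)) / of_nat (Suc k) * (q ^ Suc k) $ i)"
      using k by (intro sum.reindex_bij_witness[of _ "\<lambda>i. i + Suc k" "\<lambda>l. l - Suc k"]) auto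
    finally show "(\<Sum>l\<le>N. if Suc k \<le> l then (- ((- w j) ^ Suc k)) / of_nat (Suc k) * (q ^ Suc k) $ (l - Suc k) else 0) =
      (\<Sum>i<N - k. (- ((- w j) ^ Suc k)) / of_nat (Suc k) * (q ^ Suc k) $ i)" .
  qed
  finally show ?thesis by (simp add: sum_distrib_left q_def)
qed

end

section \<open>From formal series to analytic functions: the truncation error\<close>

lemma has_fps_expansion_Ln_1_plus:
  "(\<lambda>z::complex. Ln (1 + z)) has_fps_expansion fps_ln 1"
  unfolding has_fps_expansion_def
proof
  have "eventually (\<lambda>z::complex. z \<in> ball 0 1) (nhds 0)" by (intro eventually_nhds_in_open) auto
  then show "eventually (\<lambda>z::complex. eval_fps (fps_ln 1) z = Ln (1 + z)) (nhds 0)"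
  proof eventually_elim
    fix z :: complex assume "z \<in> ball 0 1"
    then have "(\<lambda>n. (-1) ^ Suc n / of_nat n * z ^ n) sums Ln (1 + z)" by (intro Ln_series) simp
    moreover have "(\<lambda>n. (-1) ^ Suc n / of_nat n * z ^ n) = (\<lambda>n. fps_ln 1 $ n * z ^ n)"
    proof
      fix n show "(-1) ^ Suc n / of_nat n * z ^ n = fps_ln 1 $ n * z ^ n"
        by (cases n) (simp_all add: fps_ln_nth)
    qed
    ultimately show "eval_fps (fps_ln 1) z = Ln (1 + z)" by (simp add: eval_fps_def sums_iff)
  qed
qed (simp add: fps_conv_radius_ln)

lemma has_fps_expansion_psum:
  fixes w :: "nat \<Rightarrow> complex"
  assumes "finite U"
  shows "(\<lambda>z. psum A F U b (\<lambda>j. w j * z)) has_fps_expansion psum A F U b (\<lambda>j. fps_const (w j) * fps_X)"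
  unfolding psum_def
  by (intro has_fps_expansion_sum has_fps_expansion_prod has_fps_expansion_mult
        has_fps_expansion_const has_fps_expansion_fps_X)

text \<open>Cauchy's estimate on the circle of radius \<open>\<rho>\<close> bounds the coefficient
  of degree \<open>l\<close> by \<open>inverse \<rho> ^ l\<close>; the bound is the geometric tail
  beyond degree \<open>N\<close>.\<close>

lemma taylor_tail:
  assumes hol: "f holomorphic_on ball 0 \<rho>" and cont: "continuous_on (cball 0 \<rho>) f"
    and bound: "\<And>z. cmod z = \<rho> \<Longrightarrow> cmod (f z) \<le> 1"
    and \<rho>: "\<rho> > 1" and F: "f has_fps_expansion F"
  shows "cmod (f 1 - (\<Sum>l\<le>N. F $ l)) \<le> inverse \<rho> ^ N / (\<rho> - 1)"
proof -
  have nth: "F $ l = (deriv ^^ l) f 0 / fact l" for l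
    using fps_nth_fps_expansion[OF F] .
  have le: "cmod (F $ l) \<le> inverse \<rho> ^ l" for l
  proof -
    have "cmod ((deriv ^^ l) f 0) \<le> fact l * 1 / \<rho> ^ l"
      using hol cont bound \<rho> by (intro Cauchy_inequality) auto
    then show ?thesis unfolding nth by (simp add: norm_divide divide_le_eq power_inverse field_simps)
  qed
  have "(\<lambda>l. (deriv ^^ l) f 0 / fact l * (1 - 0) ^ l) sums f 1"
    using \<rho> by (intro holomorphic_power_series[OF hol]) auto
  then have F1: "(\<lambda>l. F $ l) sums f 1" by (simp add: nth)
  then have tail: "(\<lambda>l. F $ (l + Suc N)) sums (f 1 - (\<Sum>l<Suc N. F $ l))"
    by (subst sums_iff_shift) simp
  have inv: "inverse \<rho> < 1" "0 < inverse \<rho>" using \<rho> by (auto simp: field_simps)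
  have geo: "(\<lambda>l. inverse \<rho> ^ (l + Suc N)) sums (inverse \<rho> ^ Suc N * (1 / (1 - inverse \<rho>)))"
    using sums_mult[OF geometric_sums[of "inverse \<rho>"], of "inverse \<rho> ^ Suc N"] inv
    by (simp add: power_add mult_ac)
  have "cmod (f 1 - (\<Sum>l<Suc N. F $ l)) \<le> (\<Sum>l. inverse \<rho> ^ (l + Suc N))"
    using tail geo le by (metis norm_suminf_le sums_iff)
  also have "\<dots> = inverse \<rho> ^ N / (\<rho> - 1)"
  proof -
    have "1 / (1 - inverse \<rho>) = \<rho> / (\<rho> - 1)" using \<rho> by (simp add: field_simps)
    then have "inverse \<rho> ^ Suc N * (1 / (1 - inverse \<rho>)) = inverse \<rho> ^ N / (\<rho> - 1)" using \<rho> by simp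
    then show ?thesis using sums_unique[OF geo] by simp
  qed
  finally show ?thesis by (simp add: lessThan_Suc_atMost)
qed

text \<open>Zero-freeness is used for the weights \<open>w j * z\<close> with
  \<open>cmod z \<le> \<rho>\<close>, and the tail bound for the logarithm of each successive
  quotient, whence the factor \<open>n\<close>.\<close>

theorem (in weighted_system) taylor_value_approximates:
  fixes r c :: nat
  assumes r: "2 \<le> r" "1 \<le> c" and sparse: "sparse_matrix m n r c A"
    and \<rho>: "\<rho> > 1"
    and w: "\<And>j. j < n \<Longrightarrow> cmod (w j) * \<rho> \<le> 0.46 / (real r * sqrt c)"
  obtains L where "exp L = weight n w (solutions m n A)"
    "cmod (L - taylor_value N) \<le> real n * (inverse \<rho> ^ N / (\<rho> - 1))"
proof -
  obtain \<phi> where \<phi>: "0 < \<phi>" "\<phi> \<le> 0.8" "0.46 / (real r * sqrt c) \<le> sin (\<phi> / r) * cos \<phi> ^ c"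
    using angle_exists[OF r] by blast
  have pi2: "\<phi> < pi/2" using \<phi>(2) pi_gt3 by simp
  have col: "card {i\<in>{..<m}. A i j \<noteq> 0} \<le> c" if "j < n" for j
  proof -
    have "{i\<in>{..<m}. A i j \<noteq> 0} = {i. i < m \<and> A i j \<noteq> 0}" by auto
    then show ?thesis using sparse that by (simp add: sparse_matrix_def)
  qed
  have row: "card {j\<in>{..<n}. A i j \<noteq> 0} \<le> r" if "i < m" for i
  proof -
    have "{j\<in>{..<n}. A i j \<noteq> 0} = {j. j < n \<and> A i j \<noteq> 0}" by auto
    then show ?thesis using sparse that by (simp add: sparse_matrix_def)
  qed
  define P where "P = (\<lambda>U b z. psum A {..<m} U b (\<lambda>j. w j * z))"
  have main: "P U (\<lambda>_. 0) z \<noteq> 0 \<and> (\<forall>R b. R \<subseteq> {..<m} \<longrightarrow> (\<forall>i\<in>{..<m}-R. b i = 0) \<longrightarrow>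
       cos \<phi> ^ card R * cmod (P U b z) \<le> cmod (P U (\<lambda>_. 0) z))"
    if "cmod z \<le> \<rho>" "U \<subseteq> {..<n}" for z U
    unfolding P_def
  proof (rule psum_zero_free[OF _ _ row col \<phi>(1) pi2 _ \<phi>(3) subset_refl that(2)])
    fix j assume "j \<in> {..<n}"
    have "cmod (w j * z) \<le> cmod (w j) * \<rho>" unfolding norm_mult using that by (intro mult_left_mono) auto
    then show "cmod (w j * z) \<le> 0.46 / (real r * sqrt c)" using w[of j] \<open>j \<in> {..<n}\<close> by simp
  qed (use r in auto)
  have nz: "P U (\<lambda>_. 0) z \<noteq> 0" if "cmod z \<le> \<rho>" "U \<subseteq> {..<n}" for z U
    using main that by blast
  have cos: "0 < cos \<phi>" "cos \<phi> \<le> 1" using \<phi> pi2 cos_gt_zero by auto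
  define y where "y = (\<lambda>j z. w j * z * (P {..<j} (rhs A {j}) z / P {..<j} (\<lambda>_. 0) z))"
  \<comment> \<open>The constant comes from sin (\<phi> / r) \<le> \<phi> / r \<le> 0.8 / 2.\<close>
  have y: "cmod (y j z) \<le> 2/5" if "j < n" "cmod z \<le> \<rho>" for j z
  proof -
    let ?R = "{i\<in>{..<m}. A i j \<noteq> 0}" and ?b = "P {..<j} (rhs A {j}) z" and ?o = "P {..<j} (\<lambda>_. 0) z"
    have j: "{..<j} \<subseteq> {..<n}" using that by auto
    have "cos \<phi> ^ c * cmod ?b \<le> cos \<phi> ^ card ?R * cmod ?b"
      using col[OF that(1)] cos by (intro mult_right_mono power_decreasing) auto
    also have "\<dots> \<le> cmod ?o"
    proof -
      have "?R \<subseteq> {..<m}" "\<forall>i\<in>{..<m} - ?R. rhs A {j} i = 0" by (auto simp: rhs_singleton)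
      then show ?thesis using main[OF that(2) j] by blast
    qed
    finally have le: "cos \<phi> ^ c * cmod ?b \<le> cmod ?o" .
    have r0: "0 \<le> \<phi> / r" "\<phi> / r \<le> 2/5"
    proof -
      have "\<phi> / r \<le> \<phi> / 2" using \<phi> r by (intro divide_left_mono) auto
      then show "\<phi> / r \<le> 2/5" using \<phi>(2) by simp
    qed (use \<phi> in auto)
    have sin: "0 \<le> sin (\<phi> / r)" "sin (\<phi> / r) \<le> 2/5"
    proof -
      show "0 \<le> sin (\<phi> / r)" using r0 pi_gt3 by (intro sin_ge_zero) linarith+
      show "sin (\<phi> / r) \<le> 2/5" using r0 sin_x_le_x[of "\<phi>/r"] by linarith
    qed
    have "cmod (w j * z) \<le> cmod (w j) * \<rho>" unfolding norm_mult using that by (intro mult_left_mono) auto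
    then have "cmod (w j * z) * cmod ?b \<le> (sin (\<phi> / r) * cos \<phi> ^ c) * cmod ?b"
      using w[OF that(1)] \<phi>(3) by (intro mult_right_mono) auto
    also have "\<dots> \<le> sin (\<phi> / r) * cmod ?o"
      unfolding mult.assoc using sin by (intro mult_left_mono[OF le])
    also have "\<dots> \<le> 2/5 * cmod ?o" using sin by (intro mult_right_mono) auto
    finally show ?thesis using nz[OF that(2) j] by (simp add: y_def norm_mult norm_divide divide_le_eq)
  qed
  have y1: "Re (1 + y j z) > 0" if "j < n" "cmod z \<le> \<rho>" for j z
    using y[OF that] abs_Re_le_cmod[of "y j z"] by simp
  define f where "f = (\<lambda>j z. Ln (1 + y j z))"
  have hol_P: "(\<lambda>z. P U b z) holomorphic_on S" for U b S
    unfolding P_def psum_def by (intro holomorphic_intros)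
  have hol: "f j holomorphic_on cball 0 \<rho>" if j: "j < n" for j
  proof -
    have "y j holomorphic_on cball 0 \<rho>"
      unfolding y_def using j nz by (intro holomorphic_intros hol_P) auto
    then show ?thesis unfolding f_def using y1[OF j]
      by (intro holomorphic_intros) (force simp: complex_nonpos_Reals_iff)+
  qed
  \<comment> \<open>For such small \<open>y\<close> the logarithm of 1 + y is at most twice
    \<open>cmod y\<close>, here 4/5.\<close>
  have small: "cmod (f j z) \<le> 1" if "j < n" "cmod z \<le> \<rho>" for j z
    using norm_Ln_le[of "y j z"] y[OF that] by (simp add: f_def)
  have expansion_P: "(\<lambda>z. P U b z) has_fps_expansion Z U b" if "finite U" for U b
    unfolding P_def Z_def by (rule has_fps_expansion_psum[OF that])
  have expansion: "f j has_fps_expansion log_ratio j" if j: "j < n" for j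
  proof -
    have "(\<lambda>z. w j * z * (P {..<j} (rhs A {j}) z * inverse (P {..<j} (\<lambda>_. 0) z))) has_fps_expansion
       fps_const (w j) * fps_X * (Z {..<j} (rhs A {j}) * inverse (Z {..<j} (\<lambda>_. 0)))"
      using Z_nth_0[of "{..<j}"]
      by (intro has_fps_expansion_mult has_fps_expansion_inverse has_fps_expansion_const has_fps_expansion_fps_X
            expansion_P) auto
    then have "y j has_fps_expansion fps_const (w j) * fps_X * Q {..<j} (rhs A {j})"
      by (simp add: y_def[abs_def] Q_def divide_inverse)
    then have "((\<lambda>z. Ln (1 + z)) \<circ> y j) has_fps_expansion log_ratio j"
      unfolding log_ratio_def by (intro has_fps_expansion_compose has_fps_expansion_Ln_1_plus) auto
    then show ?thesis by (simp add: f_def o_def)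
  qed
  have tail: "cmod (f j 1 - (\<Sum>l\<le>N. log_ratio j $ l)) \<le> inverse \<rho> ^ N / (\<rho> - 1)" if j: "j < n" for j
    using hol[OF j] small[OF j]
    by (intro taylor_tail[OF _ _ _ \<rho> expansion[OF j]])
       (auto intro: holomorphic_on_imp_continuous_on holomorphic_on_subset)
  show thesis
  proof (rule that)
    \<comment> \<open>Each factor \<open>1 + y k 1\<close> adds column \<open>k\<close>, so the
      product telescopes.\<close>
    have "exp (\<Sum>j<k. f j 1) = P {..<k} (\<lambda>_. 0) 1" if "k \<le> n" for k
      using that
    proof (induction k)
      case 0
      have "{S. S \<subseteq> {} \<and> (\<forall>i\<in>{..<m}. (\<Sum>j\<in>S. A i j) = 0)} = {{}}" by auto
      then show ?case unfolding P_def psum_def by simp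
    next
      case (Suc k)
      have k: "k < n" "{..<k} \<subseteq> {..<n}" using Suc.prems by auto
      have "1 + y k 1 \<noteq> 0" using y1[OF k(1), of 1] \<rho> by force
      then have "exp (\<Sum>j<Suc k. f j 1) = P {..<k} (\<lambda>_. 0) 1 * (1 + y k 1)"
        using Suc by (simp add: exp_add f_def)
      also have "\<dots> = P {..<k} (\<lambda>_. 0) 1 + w k * P {..<k} (rhs A {k}) 1"
        using nz[of 1, OF _ k(2)] \<rho> by (simp add: y_def field_simps)
      also have "P {..<k} (rhs A {k}) 1 = P {..<k} (\<lambda>i. 0 - A i k) 1"
        unfolding P_def by (rule psum_cong) (auto simp: rhs_singleton)
      also have "P {..<k} (\<lambda>_. 0) 1 + w k * \<dots> = P {..<Suc k} (\<lambda>_. 0) 1"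
        using psum_insert[of "{..<k}" k A "{..<m}" "\<lambda>_. 0" "\<lambda>j. w j * 1"] by (simp add: P_def lessThan_Suc)
      finally show ?case .
    qed
    then show "exp (\<Sum>j<n. f j 1) = weight n w (solutions m n A)"
      by (simp add: weight_solutions P_def)
    have "cmod ((\<Sum>j<n. f j 1) - taylor_value N) \<le> (\<Sum>j<n. inverse \<rho> ^ N / (\<rho> - 1))"
      unfolding taylor_value_def sum_subtractf[symmetric]
      by (rule sum_norm_le) (use tail in simp)
    then show "cmod ((\<Sum>j<n. f j 1) - taylor_value N) \<le> real n * (inverse \<rho> ^ N / (\<rho> - 1))" by simp
  qed
qed

section \<open>Expanding the Taylor coefficients as a sum over a tree\<close>

type_synonym status = "nat \<Rightarrow> nat"
type_synonym item = "complex \<times> nat \<times> status list"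

context weighted_system
begin

text \<open>
  A status encodes a factor \<^term>\<open>Q U (rhs A C)\<close>: columns of status 0 form \<open>U\<close>, those of status above 1
  form \<open>C\<close>. An item \<open>(c, e, sts)\<close> stands for \<open>c\<close> times the sum of the first \<open>e\<close> coefficients of the
  product of the factors.
\<close>

definition alive :: "status \<Rightarrow> nat set" where "alive st = {l. l < n \<and> st l = 0}"
definition chosen :: "status \<Rightarrow> nat set" where "chosen st = {l. l < n \<and> 2 \<le> st l}"
definition factor :: "status \<Rightarrow> complex fps" where "factor st = Q (alive st) (rhs A (chosen st))"

definition item_value :: "item \<Rightarrow> complex" where
  "item_value = (\<lambda>(c, e, sts). c * (\<Sum>i<e. prod_list (map factor sts) $ i))"

definition row_sum :: "status \<Rightarrow> nat \<Rightarrow> int" where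
  "row_sum st i = (\<Sum>l\<in>chosen st. A i l)"

text \<open>The inserted \<open>m\<close> serves as a sentinel: it is the value exactly when all
  rows balance.\<close>

definition bad_row :: "status \<Rightarrow> nat" where
  "bad_row st = Min (insert m {i. i < m \<and> row_sum st i \<noteq> 0})"

text \<open>The search runs downwards and returns the largest available column of row
  \<open>i\<close>; \<open>n\<close>, which is no column, signals that there is none.\<close>

primrec pick :: "status \<Rightarrow> nat \<Rightarrow> nat \<Rightarrow> nat" where
  "pick st i 0 = n"
| "pick st i (Suc l) = (if st l = 0 \<and> A i l \<noteq> 0 then l else pick st i l)"

text \<open>Represents Q(U - k, - a_k): only \<open>k\<close> is charged to the right-hand side, and
  columns formerly removed or charged become merely removed.\<close>

definition fresh :: "status \<Rightarrow> nat \<Rightarrow> status" where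
  "fresh st k = (\<lambda>l. if l = k then 2 else if st l = 0 then 0 else 1)"

text \<open>One step of the depth-first summation. A balanced factor is 1 and is dropped, a factor
  without a usable column is 0 and kills its item, and otherwise \<open>Q_split\<close> yields three
  children, those with fewer coefficients on top.\<close>

fun advance :: "complex \<times> item list \<Rightarrow> complex \<times> item list" where
  "advance (acc, []) = (acc, [])"
| "advance (acc, (c, 0, sts) # its) = (acc, its)"
| "advance (acc, (c, Suc e, []) # its) = (acc + c, its)"
| "advance (acc, (c, Suc e, st # sts) # its) =
    (if bad_row st = m then (acc, (c, Suc e, sts) # its)
     else let k = pick st (bad_row st) n in
       if k = n then (acc, its)
       else (acc, (- (c * w k), e, fresh st k # st # sts) # (c * w k, e, st(k := 2) # sts)
                  # (c, Suc e, st(k := 1) # sts) # its))"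

lemma finite_alive [simp]: "finite (alive st)" and finite_chosen [simp]: "finite (chosen st)"
  by (simp_all add: alive_def chosen_def)

lemma bad_row_less: "bad_row st \<noteq> m \<Longrightarrow> bad_row st < m \<and> row_sum st (bad_row st) \<noteq> 0"
  using Min_in[of "insert m {i. i < m \<and> row_sum st i \<noteq> 0}"] unfolding bad_row_def[symmetric] by auto

lemma bad_row_eq_m: "bad_row st = m \<Longrightarrow> i < m \<Longrightarrow> row_sum st i = 0"
  using Min_le[of "insert m {i. i < m \<and> row_sum st i \<noteq> 0}" i] unfolding bad_row_def[symmetric] by force

lemma pick_cases:
  "pick st i k = n \<and> (\<forall>l<k. st l = 0 \<longrightarrow> A i l = 0) \<or> pick st i k < k \<and> st (pick st i k) = 0 \<and> A i (pick st i k) \<noteq> 0"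
  by (induction k) (auto simp: less_Suc_eq)

lemma bad_row_cong: "(\<And>l. l < n \<Longrightarrow> 2 \<le> st l \<longleftrightarrow> 2 \<le> st' l) \<Longrightarrow> bad_row st = bad_row st'"
proof -
  assume "\<And>l. l < n \<Longrightarrow> 2 \<le> st l \<longleftrightarrow> 2 \<le> st' l"
  then have "chosen st = chosen st'" by (auto simp: chosen_def)
  then show ?thesis by (simp add: bad_row_def row_sum_def)
qed

lemma factor_complete: "bad_row st = m \<Longrightarrow> factor st = 1"
  unfolding factor_def by (rule Q_trivial_rhs) (simp_all add: bad_row_eq_m rhs_def flip: row_sum_def)

lemma factor_stuck:
  assumes "bad_row st \<noteq> m" "pick st (bad_row st) n = n"
  shows "factor st = 0"
  unfolding factor_def
proof (rule Q_unreachable)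
  show "bad_row st < m" "rhs A (chosen st) (bad_row st) \<noteq> 0"
    using bad_row_less[OF assms(1)] by (simp_all add: rhs_def row_sum_def)
  show "A (bad_row st) j = 0" if "j \<in> alive st" for j
    using pick_cases[of st "bad_row st" n] assms(2) that by (auto simp: alive_def)
qed

lemma factor_split:
  assumes k: "k < n" "st k = 0"
  shows "factor st = factor (st(k := 1)) + fps_const (w k) * fps_X *
           (factor (st(k := 2)) - factor (fresh st k) * factor st)"
proof -
  have sets: "alive (st(k := 1)) = alive st - {k}" "chosen (st(k := 1)) = chosen st"
    "alive (st(k := 2)) = alive st - {k}" "chosen (st(k := 2)) = insert k (chosen st)"
    "alive (fresh st k) = alive st - {k}" "chosen (fresh st k) = {k}" "k \<in> alive st" "k \<notin> chosen st"
    using k by (auto simp: alive_def chosen_def fresh_def split: if_splits)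
  show ?thesis
    using Q_split[OF finite_alive sets(7), of "rhs A (chosen st)"]
    unfolding factor_def sets rhs_insert[OF finite_chosen sets(8), abs_def] rhs_singleton[abs_def]
    by (simp add: mult.commute)
qed

text \<open>The factor X in two of the three terms shifts the coefficients by one, so their items
  carry \<open>e\<close> instead of \<open>Suc e\<close>.\<close>

lemma item_value_split:
  assumes "k < n" "st k = 0"
  shows "item_value (c, Suc e, st # sts) = item_value (c, Suc e, st(k := 1) # sts) +
    item_value (c * w k, e, st(k := 2) # sts) + item_value (- (c * w k), e, fresh st k # st # sts)"
proof -
  let ?p = "prod_list (map factor sts)"
  have eq: "factor st * ?p = factor (st(k := 1)) * ?p + fps_X * (fps_const (w k) *
      (factor (st(k := 2)) * ?p - factor (fresh st k) * (factor st * ?p)))"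
    by (subst factor_split[of k st, OF assms]) (simp add: algebra_simps)
  have "(factor st * ?p) $ i = (factor (st(k := 1)) * ?p) $ i +
      (if i = 0 then 0 else w k * ((factor (st(k := 2)) * ?p) $ (i - 1) -
        (factor (fresh st k) * (factor st * ?p)) $ (i - 1)))" for i
    by (subst eq) simp
  then have "(\<Sum>i<Suc e. (factor st * ?p) $ i) = (\<Sum>i<Suc e. (factor (st(k := 1)) * ?p) $ i) +
     (\<Sum>i<Suc e. if i = 0 then 0 else w k * ((factor (st(k := 2)) * ?p) $ (i - 1) -
        (factor (fresh st k) * (factor st * ?p)) $ (i - 1)))"
    by (simp only: sum.distrib)
  also have "(\<Sum>i<Suc e. if i = 0 then 0 else w k * ((factor (st(k := 2)) * ?p) $ (i - 1) -
        (factor (fresh st k) * (factor st * ?p)) $ (i - 1))) =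
      w k * ((\<Sum>i<e. (factor (st(k := 2)) * ?p) $ i) - (\<Sum>i<e. (factor (fresh st k) * (factor st * ?p)) $ i))"
    by (subst sum.lessThan_Suc_shift) (simp add: sum_distrib_left sum_subtractf right_diff_distrib)
  finally show ?thesis unfolding item_value_def split_conv list.map prod_list.Cons by algebra
qed

lemma advance_value:
  "fst (advance s) + (\<Sum>it\<leftarrow>snd (advance s). item_value it) = fst s + (\<Sum>it\<leftarrow>snd s. item_value it)"
proof (cases s rule: advance.cases)
  case (4 acc c e st sts its)
  show ?thesis
  proof (cases "bad_row st = m \<or> pick st (bad_row st) n = n")
    case True
    then show ?thesis using 4 factor_complete[of st] factor_stuck[of st]
      by (auto simp: item_value_def)
  next
    case False
    then have "pick st (bad_row st) n < n" "st (pick st (bad_row st) n) = 0"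
      using pick_cases[of st "bad_row st" n] by auto
    from item_value_split[of "pick st (bad_row st) n" st c e sts, OF this] show ?thesis using False 4 by (simp add: Let_def)
  qed
qed (auto simp: item_value_def sum.lessThan_Suc_shift)

text \<open>Counts the removals still possible in the bad row, plus one for the step that drops the
  factor or finds it to be 0. Removals leave the bad row itself unchanged, since only charged
  columns enter it.\<close>

definition status_size :: "status \<Rightarrow> nat" where
  "status_size st = (if bad_row st = m then 1 else Suc (card {l \<in> alive st. A (bad_row st) l \<noteq> 0}))"

end

text \<open>
  \<open>tree_bound R e S\<close> bounds the nodes below an item with \<open>e\<close> coefficients to go and total status size
  \<open>S\<close>: marking a column as removed decreases \<open>S\<close>, the other two children decrease \<open>e\<close> but may bring in
  a row with \<open>R\<close> new columns.
\<close>

fun tree_bound :: "nat \<Rightarrow> nat \<Rightarrow> nat \<Rightarrow> nat" where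
  "tree_bound R 0 S = 1"
| "tree_bound R (Suc e) 0 = 1"
| "tree_bound R (Suc e) (Suc S) = 1 + tree_bound R (Suc e) S + 2 * tree_bound R e (S + R + 2)"

lemma tree_bound_pos: "0 < tree_bound R e S"
  by (induction R e S rule: tree_bound.induct) auto

lemma tree_bound_mono_Suc: "tree_bound R e S \<le> tree_bound R e (Suc S)"
  by (cases e) auto

lemma tree_bound_mono: "S \<le> S' \<Longrightarrow> tree_bound R e S \<le> tree_bound R e S'"
  by (rule lift_Suc_mono_le[of "tree_bound R e"]) (rule tree_bound_mono_Suc)

lemma power_one_plus_inverse_le: "(1 + 1 / real (Suc R)) ^ Suc R \<le> 3"
proof -
  have "(1 + 1 / real (Suc R)) ^ Suc R \<le> exp (1 / real (Suc R)) ^ Suc R"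
    by (intro power_mono exp_ge_add_one_self) auto
  also have "\<dots> = exp 1" using exp_of_nat_mult[of "Suc R" "1 / real (Suc R)"] by (simp del: of_nat_Suc)
  also have "\<dots> \<le> 3" by (rule exp_le)
  finally show ?thesis .
qed

text \<open>With a = 1 + 1/(R + 1), passing from S to S + 1 raises the bound by 13 units of (13 (R +
  1))^e a^S. They pay for the node itself and for two subtrees of at most 6 units each, as a^(R + 2)
  \<le> 3 * 2.\<close>

lemma tree_bound_le:
  "real (tree_bound R e S) \<le> (13 * real (Suc R)) ^ e * (1 + 1 / real (Suc R)) ^ S"
proof (induction R e S rule: tree_bound.induct)
  case (1 R S)
  then show ?case by (simp add: one_le_power)
next
  case (2 R e)
  then show ?case using one_le_power[of "13 * real (Suc R)" "Suc e"] by simp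
next
  case (3 R e S)
  let ?a = "1 + 1 / real (Suc R)" and ?B = "13 * real (Suc R)"
  have ge1: "1 \<le> ?B ^ e * ?a ^ S" using mult_mono[of 1 "?B ^ e" 1 "?a ^ S"] by (simp add: one_le_power)
  have "?a ^ (R + 2) = ?a ^ Suc R * ?a" by simp
  also have "\<dots> \<le> 3 * 2"
    by (intro mult_mono power_one_plus_inverse_le) auto
  finally have a: "?a ^ (R + 2) \<le> 6" by simp
  have "?B ^ e * ?a ^ (S + R + 2) = ?B ^ e * ?a ^ S * ?a ^ (R + 2)" by (simp add: power_add)
  also have "\<dots> \<le> ?B ^ e * ?a ^ S * 6" by (intro mult_left_mono[OF a]) auto
  finally have "real (tree_bound R e (S + R + 2)) \<le> 6 * (?B ^ e * ?a ^ S)" using 3(2) by linarith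
  then have "real (tree_bound R (Suc e) (Suc S)) \<le> ?B ^ Suc e * ?a ^ S + 13 * (?B ^ e * ?a ^ S)"
    using 3(1) ge1 by simp
  also have "\<dots> = ?B ^ Suc e * ?a ^ S + ?B ^ e * ?a ^ S * (?B * (1 / real (Suc R)))"
  proof -
    have "?B * (1 / real (Suc R)) = 13" by (simp del: of_nat_Suc)
    then show ?thesis by (simp only: mult.commute)
  qed
  also have "\<dots> = ?B ^ Suc e * ?a ^ Suc S" by (simp only: power_Suc) algebra
  finally show ?case .
qed

context weighted_system
begin

definition item_size :: "item \<Rightarrow> nat" where
  "item_size = (\<lambda>(c, e, sts). \<Sum>st\<leftarrow>sts. status_size st)"

definition potential :: "nat \<Rightarrow> item list \<Rightarrow> nat" where
  "potential R its = (\<Sum>it\<leftarrow>its. tree_bound R (fst (snd it)) (item_size it))"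

text \<open>A lost coefficient is worth \<open>R + 2\<close>, one more than the largest size of a
  new status, so every child has smaller depth.\<close>

definition depth :: "nat \<Rightarrow> item \<Rightarrow> nat" where
  "depth R it = item_size it + fst (snd it) * (R + 2)"

text \<open>
  An item is replaced by at most three items of smaller depth, so that twice the depth pays for the
  growth of the stack.
\<close>

fun height_ok :: "nat \<Rightarrow> nat \<Rightarrow> item list \<Rightarrow> bool" where
  "height_ok R M [] = True"
| "height_ok R M (it # its) \<longleftrightarrow> length its + 2 * depth R it \<le> M \<and> height_ok R M its"

text \<open>A factor is added only at the expense of a coefficient, so the sum never grows; it
  determines the slot size of the stack.\<close>

definition lengths_ok :: "nat \<Rightarrow> item list \<Rightarrow> bool" where
  "lengths_ok M its \<longleftrightarrow> (\<forall>(c, e, sts)\<in>set its. e + length sts \<le> M)"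

lemma status_size_le:
  assumes "\<And>i. i < m \<Longrightarrow> card {l. l < n \<and> A i l \<noteq> 0} \<le> R"
  shows "status_size st \<le> Suc R"
proof (cases "bad_row st = m")
  case False
  then have i: "bad_row st < m" using bad_row_less by blast
  have "card {l \<in> alive st. A (bad_row st) l \<noteq> 0} \<le> card {l. l < n \<and> A (bad_row st) l \<noteq> 0}"
    by (intro card_mono) (auto simp: alive_def)
  then show ?thesis using assms[OF i] by (simp add: status_size_def)
qed (simp add: status_size_def)

lemma status_size_remove:
  assumes "bad_row st \<noteq> m" "pick st (bad_row st) n \<noteq> n"
  shows "Suc (status_size (st(pick st (bad_row st) n := 1))) = status_size st"
proof -
  let ?i = "bad_row st" and ?k = "pick st (bad_row st) n"
  have k: "?k < n" "st ?k = 0" "A ?i ?k \<noteq> 0" using pick_cases[of st ?i n] assms(2) by auto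
  have row: "bad_row (st(?k := 1)) = ?i" by (rule bad_row_cong) (use k in auto)
  have eq: "{l \<in> alive st. A ?i l \<noteq> 0} = insert ?k {l \<in> alive (st(?k := 1)). A ?i l \<noteq> 0}"
    using k by (auto simp: alive_def)
  have "?k \<notin> {l \<in> alive (st(?k := 1)). A ?i l \<noteq> 0}" by (auto simp: alive_def)
  then have "card {l \<in> alive st. A ?i l \<noteq> 0} = Suc (card {l \<in> alive (st(?k := 1)). A ?i l \<noteq> 0})"
    unfolding eq by (subst card_insert_disjoint) auto
  then show ?thesis using assms(1) by (simp only: status_size_def row if_False)
qed

text \<open>These control the number of steps, the height of the stack and the length of its
  entries. The first two rest on a size of at most \<open>R + 1\<close> for a newly charged status
  and a decrease by one at each removal.\<close>

lemma advance_invariants: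
  assumes R: "\<And>i. i < m \<Longrightarrow> card {l. l < n \<and> A i l \<noteq> 0} \<le> R" and "its \<noteq> []"
  shows "potential R (snd (advance (acc, its))) < potential R its"
    and "height_ok R M its \<Longrightarrow> height_ok R M (snd (advance (acc, its)))"
    and "lengths_ok M its \<Longrightarrow> lengths_ok M (snd (advance (acc, its)))"
proof -
  have "potential R (snd (advance (acc, its))) < potential R its \<and>
    (height_ok R M its \<longrightarrow> height_ok R M (snd (advance (acc, its)))) \<and>
    (lengths_ok M its \<longrightarrow> lengths_ok M (snd (advance (acc, its))))"
  proof (cases "(acc, its)" rule: advance.cases)
    case (4 acc' c e st sts its')
    have its: "its = (c, Suc e, st # sts) # its'" using 4 by simp
    let ?i = "bad_row st" let ?k = "pick st ?i n"
    define S where "S = (\<Sum>st\<leftarrow>sts. status_size st)"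
    show ?thesis
    proof (cases "?i = m")
      case True
      then have sz: "status_size st = 1" by (simp add: status_size_def)
      then show ?thesis using True tree_bound_pos[of R e "S + R + 2"]
        by (auto simp: its potential_def item_size_def lengths_ok_def depth_def S_def)
    next
      case i: False
      show ?thesis
      proof (cases "?k = n")
        case True
        then show ?thesis using i tree_bound_pos[of R "Suc e"]
          by (auto simp: its Let_def potential_def lengths_ok_def)
      next
        case False
        obtain a where a: "status_size st = Suc a" "status_size (st(?k := 1)) = a"
          using status_size_remove[OF i False] by metis
        have le: "status_size (st(?k := 2)) \<le> Suc R" "status_size (fresh st ?k) \<le> Suc R"
          by (intro status_size_le R; assumption)+
        have "tree_bound R e (status_size (st(?k := 2)) + S) \<le> tree_bound R e ((a + S) + R + 2)"
          "tree_bound R e (status_size (fresh st ?k) + (Suc a + S)) \<le> tree_bound R e ((a + S) + R + 2)"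
          using le by (auto intro!: tree_bound_mono)
        then show ?thesis using i False le
          by (simp add: its Let_def potential_def item_size_def lengths_ok_def depth_def a(1) a(2)[unfolded One_nat_def] S_def[symmetric] del: fun_upd_apply)
      qed
    qed
  next
    case (2 acc' c sts its')
    then show ?thesis using tree_bound_pos by (auto simp: potential_def lengths_ok_def)
  next
    case (3 acc' c e its')
    then show ?thesis using tree_bound_pos by (auto simp: potential_def lengths_ok_def)
  qed (use assms(2) in auto)
  then show "potential R (snd (advance (acc, its))) < potential R its"
    "height_ok R M its \<Longrightarrow> height_ok R M (snd (advance (acc, its)))"
    "lengths_ok M its \<Longrightarrow> lengths_ok M (snd (advance (acc, its)))" by blast+
qed

definition initial_status :: "nat \<Rightarrow> status" where
  "initial_status j = (\<lambda>l. if l < j then 0 else if j < l then 1 else 2)"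

text \<open>The summand of index \<open>k\<close> in \<open>sum_log_ratio\<close>, its power of Q
  written as \<open>Suc k\<close> equal factors.\<close>

definition initial_item :: "nat \<Rightarrow> nat \<Rightarrow> nat \<Rightarrow> item" where
  "initial_item N j k = (- ((- w j) ^ Suc k) / of_nat (Suc k), N - k, replicate (Suc k) (initial_status j))"

lemma taylor_value_items: "taylor_value N = (\<Sum>j<n. \<Sum>k<N. item_value (initial_item N j k))"
  unfolding taylor_value_def
proof (rule sum.cong[OF refl])
  fix j assume "j \<in> {..<n}"
  then have "alive (initial_status j) = {..<j}" "chosen (initial_status j) = {j}"
    by (auto simp: alive_def chosen_def initial_status_def split: if_splits)
  then have "factor (initial_status j) = Q {..<j} (rhs A {j})" by (simp add: factor_def)
  then show "(\<Sum>l\<le>N. log_ratio j $ l) = (\<Sum>k<N. item_value (initial_item N j k))"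
    unfolding sum_log_ratio by (simp add: item_value_def initial_item_def map_replicate prod_list_replicate)
qed

lemma initial_item_size:
  assumes "\<And>i. i < m \<Longrightarrow> card {l. l < n \<and> A i l \<noteq> 0} \<le> R"
  shows "item_size (initial_item N j k) \<le> Suc k * Suc R"
  using status_size_le[OF assms, of "initial_status j"] mult_le_mono2[of "status_size (initial_status j)" "Suc R" "Suc k"]
  by (simp add: item_size_def initial_item_def map_replicate sum_list_replicate)

text \<open>Each of the k + 1 equal factors contributes at most (1 + 1/(R + 1))^(R + 1) \<le> 3
  \<le> 13 (R + 1), so \<open>k\<close> drops out: (N - k) + (k + 1) = N + 1.\<close>

lemma initial_potential:
  assumes "\<And>i. i < m \<Longrightarrow> card {l. l < n \<and> A i l \<noteq> 0} \<le> R" "k < N"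
  shows "real (potential R [initial_item N j k]) \<le> (13 * real (Suc R)) ^ Suc N"
proof -
  let ?a = "1 + 1 / real (Suc R)" and ?B = "13 * real (Suc R)"
  have "real (potential R [initial_item N j k]) = real (tree_bound R (N - k) (item_size (initial_item N j k)))"
    by (simp add: potential_def initial_item_def)
  also have "\<dots> \<le> real (tree_bound R (N - k) (Suc k * Suc R))"
    by (intro of_nat_mono tree_bound_mono initial_item_size assms)
  also have "\<dots> \<le> ?B ^ (N - k) * ?a ^ (Suc k * Suc R)" by (rule tree_bound_le)
  also have "?a ^ (Suc k * Suc R) = (?a ^ Suc R) ^ Suc k" by (simp only: power_mult[symmetric] mult.commute)
  also have "?B ^ (N - k) * (?a ^ Suc R) ^ Suc k \<le> ?B ^ (N - k) * ?B ^ Suc k"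
    using power_one_plus_inverse_le[of R] by (intro mult_left_mono power_mono) auto
  also have "\<dots> = ?B ^ Suc N" using assms(2) by (simp flip: power_add power_Suc)
  finally show ?thesis .
qed

lemma initial_invariants:
  assumes "\<And>i. i < m \<Longrightarrow> card {l. l < n \<and> A i l \<noteq> 0} \<le> R" "k < N"
  shows "height_ok R (2 * (N + 1) * (R + 2)) [initial_item N j k]" "lengths_ok (Suc N) [initial_item N j k]"
proof -
  have "depth R (initial_item N j k) \<le> Suc k * Suc R + (N - k) * (R + 2)"
    using initial_item_size[OF assms(1)] by (simp add: depth_def initial_item_def)
  also have "\<dots> \<le> Suc k * (R + 2) + (N - k) * (R + 2)" by (intro add_mono mult_le_mono) auto
  also have "\<dots> = (N + 1) * (R + 2)" using assms(2) by (simp flip: add_mult_distrib)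
  finally show "height_ok R (2 * (N + 1) * (R + 2)) [initial_item N j k]" by simp
  show "lengths_ok (Suc N) [initial_item N j k]"
    using assms(2) by (simp add: lengths_ok_def initial_item_def)
qed

end

section \<open>Structured programs\<close>

text \<open>
  Structured programs keep their variables in the first 32 cells of both memories (\<open>r\<close> and \<open>x\<close> below)
  and address the remaining cells (\<open>h\<close> and \<open>g\<close>) only indirectly, so that the two parts never alias.
\<close>

type_synonym regs = "nat \<Rightarrow> nat"
type_synonym nregs = "nat \<Rightarrow> complex"
type_synonym store = "regs \<times> regs \<times> nregs \<times> nregs"

definition joined :: "(nat \<Rightarrow> 'a) \<Rightarrow> (nat \<Rightarrow> 'a) \<Rightarrow> nat \<Rightarrow> 'a" where
  "joined f f' a = (if a < 32 then f a else f' a)"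

fun ram_of :: "nat \<Rightarrow> store \<Rightarrow> ram_state" where
  "ram_of p (r, h, x, g) = \<lparr>pc = p, wmem = joined r h, nmem = joined x g\<rparr>"

section \<open>Structured commands and their compilation\<close>

datatype test = WZero nat | WLess nat nat | NZero nat | NLess nat nat

primrec holds :: "test \<Rightarrow> regs \<Rightarrow> nregs \<Rightarrow> bool" where
  "holds (WZero a) r x \<longleftrightarrow> r a = 0"
| "holds (WLess a b) r x \<longleftrightarrow> r a < r b"
| "holds (NZero a) r x \<longleftrightarrow> x a = 0"
| "holds (NLess a b) r x \<longleftrightarrow> Re (x a) < Re (x b)"

primrec jump :: "test \<Rightarrow> nat \<Rightarrow> instr" where
  "jump (WZero a) = JumpIfZero a"
| "jump (WLess a b) = JumpIfLess a b"
| "jump (NZero a) = NJumpIfZero a"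
| "jump (NLess a b) = NJumpIfLess a b"

primrec test_ok :: "test \<Rightarrow> bool" where
  "test_ok (WZero a) \<longleftrightarrow> a < 32"
| "test_ok (WLess a b) \<longleftrightarrow> a < 32 \<and> b < 32"
| "test_ok (NZero a) \<longleftrightarrow> a < 32"
| "test_ok (NLess a b) \<longleftrightarrow> a < 32 \<and> b < 32"

datatype com = Skip | Do instr | Seq com com (infixr ";;" 60) | If test com com | While test com

text \<open>Jump targets are absolute, so the address of the fragment is an argument. The machine
  jumps when a test holds; hence the false branch of \<open>If\<close> is laid out first, and
  \<open>While\<close> starts with a jump into the body followed by a jump to the exit.\<close>

primrec compile :: "nat \<Rightarrow> com \<Rightarrow> instr list" where
  "compile p Skip = []"
| "compile p (Do i) = [i]"
| "compile p (C ;; D) = compile p C @ compile (p + length (compile p C)) D"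
| "compile p (If T C D) =
    (let d = compile (Suc p) D; q = p + length d + 2; e = compile q C
     in jump T q # d @ Jump (q + length e) # e)"
| "compile p (While T C) =
    (let d = compile (p + 2) C in jump T (p + 2) # Jump (p + 3 + length d) # d @ [Jump p])"

text \<open>Direct operands are registers, indirect addresses lie beyond them, and new words stay
  below \<open>B\<close>; differences, quotients and remainders cannot exceed their first operand.
  Jumps are rejected because only \<open>compile\<close> may introduce them.\<close>

fun instr_ok :: "problem \<Rightarrow> nat \<Rightarrow> instr \<Rightarrow> regs \<Rightarrow> bool" where
  "instr_ok P B (WConst a k) r \<longleftrightarrow> a < 32 \<and> k < B"
| "instr_ok P B (WCopy a b) r \<longleftrightarrow> a < 32 \<and> b < 32"
| "instr_ok P B (WLoad a b) r \<longleftrightarrow> a < 32 \<and> b < 32 \<and> 32 \<le> r b"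
| "instr_ok P B (WStore a b) r \<longleftrightarrow> a < 32 \<and> b < 32 \<and> 32 \<le> r a"
| "instr_ok P B (WAdd a b d) r \<longleftrightarrow> a < 32 \<and> b < 32 \<and> d < 32 \<and> r b + r d < B"
| "instr_ok P B (WSub a b d) r \<longleftrightarrow> a < 32 \<and> b < 32 \<and> d < 32"
| "instr_ok P B (WMult a b d) r \<longleftrightarrow> a < 32 \<and> b < 32 \<and> d < 32 \<and> r b * r d < B"
| "instr_ok P B (WDiv a b d) r \<longleftrightarrow> a < 32 \<and> b < 32 \<and> d < 32"
| "instr_ok P B (WMod a b d) r \<longleftrightarrow> a < 32 \<and> b < 32 \<and> d < 32"
| "instr_ok P B (NConst a k) r \<longleftrightarrow> a < 32"
| "instr_ok P B (NOfWord a b) r \<longleftrightarrow> a < 32 \<and> b < 32"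
| "instr_ok P B (NCopy a b) r \<longleftrightarrow> a < 32 \<and> b < 32"
| "instr_ok P B (NLoad a b) r \<longleftrightarrow> a < 32 \<and> b < 32 \<and> 32 \<le> r b"
| "instr_ok P B (NStore a b) r \<longleftrightarrow> a < 32 \<and> b < 32 \<and> 32 \<le> r a"
| "instr_ok P B (NAdd a b d) r \<longleftrightarrow> a < 32 \<and> b < 32 \<and> d < 32"
| "instr_ok P B (NSub a b d) r \<longleftrightarrow> a < 32 \<and> b < 32 \<and> d < 32"
| "instr_ok P B (NMult a b d) r \<longleftrightarrow> a < 32 \<and> b < 32 \<and> d < 32"
| "instr_ok P B (NDiv a b d) r \<longleftrightarrow> a < 32 \<and> b < 32 \<and> d < 32"
| "instr_ok P B (GetEntry a b d) r \<longleftrightarrow> a < 32 \<and> b < 32 \<and> d < 32"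
| "instr_ok P B (GetWeight a b) r \<longleftrightarrow> a < 32 \<and> b < 32"
| "instr_ok P B (GetColumn a b) r \<longleftrightarrow> a < 32 \<and> b < 32 \<and> 32 \<le> r a \<and> rows P \<le> B \<and>
     r a + length (column_support P (r b)) < B"
| "instr_ok P B _ r \<longleftrightarrow> False"

fun effect :: "problem \<Rightarrow> instr \<Rightarrow> store \<Rightarrow> store" where
  "effect P (WConst a k) (r, h, x, g) = (r(a := k), h, x, g)"
| "effect P (WCopy a b) (r, h, x, g) = (r(a := r b), h, x, g)"
| "effect P (WLoad a b) (r, h, x, g) = (r(a := h (r b)), h, x, g)"
| "effect P (WStore a b) (r, h, x, g) = (r, h(r a := r b), x, g)"
| "effect P (WAdd a b d) (r, h, x, g) = (r(a := r b + r d), h, x, g)"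
| "effect P (WSub a b d) (r, h, x, g) = (r(a := r b - r d), h, x, g)"
| "effect P (WMult a b d) (r, h, x, g) = (r(a := r b * r d), h, x, g)"
| "effect P (WDiv a b d) (r, h, x, g) = (r(a := r b div r d), h, x, g)"
| "effect P (WMod a b d) (r, h, x, g) = (r(a := r b mod r d), h, x, g)"
| "effect P (NConst a k) (r, h, x, g) = (r, h, x(a := of_int k), g)"
| "effect P (NOfWord a b) (r, h, x, g) = (r, h, x(a := of_nat (r b)), g)"
| "effect P (NCopy a b) (r, h, x, g) = (r, h, x(a := x b), g)"
| "effect P (NLoad a b) (r, h, x, g) = (r, h, x(a := g (r b)), g)"
| "effect P (NStore a b) (r, h, x, g) = (r, h, x, g(r a := x b))"
| "effect P (NAdd a b d) (r, h, x, g) = (r, h, x(a := x b + x d), g)"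
| "effect P (NSub a b d) (r, h, x, g) = (r, h, x(a := x b - x d), g)"
| "effect P (NMult a b d) (r, h, x, g) = (r, h, x(a := x b * x d), g)"
| "effect P (NDiv a b d) (r, h, x, g) = (r, h, x(a := x b / x d), g)"
| "effect P (GetEntry a b d) (r, h, x, g) =
     (r, h, x(a := if r b < rows P \<and> r d < cols P then of_int (entry P (r b) (r d)) else 0), g)"
| "effect P (GetWeight a b) (r, h, x, g) = (r, h, x(a := if r b < cols P then wt P (r b) else 0), g)"
| "effect P (GetColumn a b) (r, h, x, g) =
     (let xs = column_support P (r b) in (r, write_list (r a) (length xs # xs) h, x, g))"
| "effect P _ s = s"

lemma column_support_less: "i \<in> set (column_support P j) \<Longrightarrow> i < rows P"
  unfolding column_support_def by (subst (asm) set_sorted_list_of_set) auto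

lemma fits_word_length_joined:
  "fits_word_length b (ram_of p (r, h, x, g)) \<longleftrightarrow>
     (\<forall>a<32. r a < 2 ^ b \<and> (2 ^ b \<le> a \<longrightarrow> r a = 0 \<and> x a = 0)) \<and>
     (\<forall>a\<ge>32. h a < 2 ^ b \<and> (2 ^ b \<le> a \<longrightarrow> h a = 0 \<and> g a = 0))"
  unfolding fits_word_length_def by (auto simp: joined_def not_less)

lemma joined_upd:
  "a < 32 \<Longrightarrow> (joined f f')(a := v) = joined (f(a := v)) f'"
  "32 \<le> a \<Longrightarrow> (joined f f')(a := v) = joined f (f'(a := v))"
  by (auto simp: joined_def fun_eq_iff)

lemma joined_at:
  "a < 32 \<Longrightarrow> joined f f' a = f a"
  "32 \<le> a \<Longrightarrow> joined f f' a = f' a"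
  by (auto simp: joined_def)

lemma joined_write_list: "32 \<le> a \<Longrightarrow> write_list a xs (joined f f') = joined f (write_list a xs f')"
  by (auto simp: joined_def write_list_def fun_eq_iff)

lemma ram_step_effect:
  assumes "32 \<le> (2::nat) ^ b" "fits_word_length b (ram_of p (r, h, x, g))" "instr_ok P (2 ^ b) i r"
  shows "ram_step P i (ram_of p (r, h, x, g)) = ram_of (Suc p) (effect P i (r, h, x, g))"
    "fits_word_length b (ram_of p' (effect P i (r, h, x, g)))"
proof -
  show "ram_step P i (ram_of p (r, h, x, g)) = ram_of (Suc p) (effect P i (r, h, x, g))"
    using assms(3)
    by (cases i) (auto simp: wput_def nput_def joined_upd joined_write_list Let_def joined_at)
  have reg: "r a < 2 ^ b" if "a < 32" for a
    using assms(2) that unfolding fits_word_length_joined by blast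
  have heap: "h a < 2 ^ b" if "32 \<le> a" for a
    using assms(2) that unfolding fits_word_length_joined by blast
  have small: "\<not> 2 ^ b \<le> r a" if "a < 32" for a
    using reg[OF that] by simp
  have div: "r a div k < 2 ^ b" "r a mod k < 2 ^ b" "r a - k < 2 ^ b" if "a < 32" for a k
    using reg[OF that] by (meson div_le_dividend mod_less_eq_dividend diff_le_self le_less_trans)+
  show "fits_word_length b (ram_of p' (effect P i (r, h, x, g)))"
  proof (cases "\<exists>a j. i = GetColumn a j")
    case True
    then obtain a j where i: "i = GetColumn a j" by blast
    let ?xs = "column_support P (r j)"
    have "(length ?xs # ?xs) ! l < 2 ^ b" if "l < Suc (length ?xs)" for l
    proof (cases l)
      case (Suc l')
      then have "?xs ! l' < rows P" using that by (intro column_support_less[of _ _ "r j"] nth_mem) simp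
      then show ?thesis using Suc assms(3) i by simp
    qed (use assms(3) i in simp)
    then show ?thesis using assms unfolding i
      by (auto simp: fits_word_length_joined Let_def write_list_def simp del: ram_of.simps)
  next
    case False
    then show ?thesis using assms reg heap div small
      by (cases i) (auto simp: fits_word_length_joined simp del: ram_of.simps)
  qed
qed

text \<open>The times are those of the compiled code: a false \<open>If\<close> also pays for
  skipping the other branch, a loop round pays for the test and the jump back, the exit for the test
  and the jump out. A derivation contains the \<open>instr_ok\<close> conditions, which keep all
  words short.\<close>

inductive run :: "problem \<Rightarrow> nat \<Rightarrow> nat \<Rightarrow> com \<Rightarrow> store \<Rightarrow> nat \<Rightarrow> store \<Rightarrow> bool"
  for P :: problem and c B :: nat where
  skip: "run P c B Skip s 0 s"
| "do": "instr_ok P B i r \<Longrightarrow> run P c B (Do i) (r, h, x, g) (instr_cost c i) (effect P i (r, h, x, g))"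
| seq: "\<lbrakk>run P c B C s t s'; run P c B D s' t' s''\<rbrakk> \<Longrightarrow> run P c B (C ;; D) s (t + t') s''"
| if_true: "\<lbrakk>test_ok T; holds T r x; run P c B C (r, h, x, g) t s'\<rbrakk>
    \<Longrightarrow> run P c B (If T C D) (r, h, x, g) (Suc t) s'"
| if_false: "\<lbrakk>test_ok T; \<not> holds T r x; run P c B D (r, h, x, g) t s'\<rbrakk>
    \<Longrightarrow> run P c B (If T C D) (r, h, x, g) (Suc (Suc t)) s'"
| while_false: "\<lbrakk>test_ok T; \<not> holds T r x\<rbrakk> \<Longrightarrow> run P c B (While T C) (r, h, x, g) 2 (r, h, x, g)"
| while_true: "\<lbrakk>test_ok T; holds T r x; run P c B C (r, h, x, g) t s'; run P c B (While T C) s' t' s''\<rbrakk>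
    \<Longrightarrow> run P c B (While T C) (r, h, x, g) (t + t' + 2) s''"

lemma fits_pc: "fits_word_length b (ram_of p s) \<longleftrightarrow> fits_word_length b (ram_of p' s)"
  by (cases s) (simp add: fits_word_length_joined del: ram_of.simps)

lemma pc_ram_of [simp]: "pc (ram_of p s) = p" by (cases s) simp

lemma step_jump:
  "test_ok T \<Longrightarrow> ram_step P (jump T l) (ram_of p (r, h, x, g)) = ram_of (if holds T r x then l else Suc p) (r, h, x, g)"
  by (cases T) (auto simp: branch_def joined_def)

lemma cost_jump [simp]: "instr_cost c (jump T l) = 1" "instr_cost c (Jump l) = 1"
  by (cases T) (auto simp: instr_cost_def)

lemma step_Jump [simp]: "ram_step P (Jump l) (ram_of p s) = ram_of l s"
  by (cases s) (simp add: branch_def)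

lemma ram_exec_cons:
  assumes "fits_word_length b (ram_of p s)" "pre = p" "P = xs @ i # ys" "length xs = p"
    "ram_exec P Q c b (ram_step Q i (ram_of p s)) t s'"
  shows "ram_exec P Q c b (ram_of p s) (instr_cost c i + t) s'"
  using ram_exec.running[of b "ram_of p s" P Q c t s'] assms by (simp add: nth_append)

text \<open>Formulated with a continuation: an execution from the end of the fragment extends to one
  from its start. Fragments thus compose although \<open>ram_exec\<close> describes only runs up to
  a halt.\<close>

lemma compile_correct:
  assumes "run Q c (2 ^ b) C s t s'" "32 \<le> (2::nat) ^ b" "fits_word_length b (ram_of p s)"
    "P = xs @ compile p C @ ys" "length xs = p"
  shows "fits_word_length b (ram_of p' s') \<and>
    (\<forall>u s''. ram_exec P Q c b (ram_of (p + length (compile p C)) s') u s'' \<longrightarrow>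
             ram_exec P Q c b (ram_of p s) (t + u) s'')"
  using assms(1,3-5)
proof (induction arbitrary: p p' xs ys rule: run.induct)
  case (skip s)
  then have "fits_word_length b (ram_of p' s)" using fits_pc by blast
  then show ?case by (simp del: ram_of.simps)
next
  case ("do" i r h x g)
  note step = ram_step_effect[OF assms(2) "do"(2,1)]
  show ?case
  proof (intro conjI allI impI)
    fix u s'' assume "ram_exec P Q c b (ram_of (p + length (compile p (Do i))) (effect Q i (r, h, x, g))) u s''"
    then have "ram_exec P Q c b (ram_step Q i (ram_of p (r, h, x, g))) u s''"
      using step(1) by (simp del: ram_of.simps)
    then show "ram_exec P Q c b (ram_of p (r, h, x, g)) (instr_cost c i + u) s''"
      using "do" by (intro ram_exec_cons[where xs=xs and ys=ys]) (auto simp del: ram_of.simps)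
  qed (rule step(2))
next
  case (seq C s t s' D t' s'')
  let ?q = "p + length (compile p C)"
  note ih1 = seq.IH(1)[OF seq.prems(1), of xs "compile ?q D @ ys" ?q]
  note ih2 = seq.IH(2)[of ?q "xs @ compile p C" ys p']
  show ?case using ih1 ih2 seq.prems(2,3) by (simp add: add.assoc)
next
  case (if_true T r x C h g t s' D)
  let ?d = "compile (Suc p) D"
  let ?q = "p + length ?d + 2"
  let ?e = "compile ?q C"
  note P = if_true.prems(2)[unfolded compile.simps Let_def]
  have "P = (xs @ jump T ?q # ?d @ [Jump (?q + length ?e)]) @ compile ?q C @ ys" using P by simp
  note ih = if_true.IH[OF _ this, of p']
  have fits: "fits_word_length b (ram_of ?q (r, h, x, g))" using if_true.prems(1) fits_pc by blast
  have addr: "p + length (compile p (If T C D)) = ?q + length ?e" by (simp add: Let_def)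
  show ?case
  proof (intro conjI allI impI)
    show "fits_word_length b (ram_of p' s')" using ih[OF fits] if_true.prems(3) by simp
    fix u s'' assume "ram_exec P Q c b (ram_of (p + length (compile p (If T C D))) s') u s''"
    then have "ram_exec P Q c b (ram_of ?q (r, h, x, g)) (t + u) s''"
      using ih[OF fits] if_true.prems(3) unfolding addr by (simp del: ram_of.simps)
    then have "ram_exec P Q c b (ram_of p (r, h, x, g)) (instr_cost c (jump T ?q) + (t + u)) s''"
      using if_true.hyps if_true.prems(1,3) P
      by (intro ram_exec_cons) (auto simp: step_jump simp del: ram_of.simps)
    then show "ram_exec P Q c b (ram_of p (r, h, x, g)) (Suc t + u) s''" by (simp del: ram_of.simps)
  qed
next
  case (if_false T r x D h g t s' C)
  let ?d = "compile (Suc p) D"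
  let ?q = "p + length ?d + 2"
  let ?e = "compile ?q C"
  note P = if_false.prems(2)[unfolded compile.simps Let_def]
  have "P = (xs @ [jump T ?q]) @ compile (Suc p) D @ (Jump (?q + length ?e) # ?e @ ys)" using P by simp
  note ih = if_false.IH[OF _ this]
  have fits: "fits_word_length b (ram_of (Suc p) (r, h, x, g))" using if_false.prems(1) fits_pc by blast
  have fits': "fits_word_length b (ram_of p' s')" for p' using ih[OF fits] if_false.prems(3) by simp
  show ?case
  proof (intro conjI allI impI fits')
    fix u s'' assume "ram_exec P Q c b (ram_of (p + length (compile p (If T C D))) s') u s''"
    then have "ram_exec P Q c b (ram_step Q (Jump (?q + length ?e)) (ram_of (Suc p + length ?d) s')) u s''"
      by (simp add: Let_def add_ac del: ram_step.simps ram_of.simps)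
    from ram_exec_cons[OF fits' refl _ _ this, of "xs @ jump T ?q # ?d"]
    have "ram_exec P Q c b (ram_of (Suc p + length ?d) s') (Suc u) s''"
      using P if_false.prems(3) by (simp del: ram_of.simps)
    moreover have "length (xs @ [jump T ?q]) = Suc p" using if_false.prems(3) by simp
    ultimately have "ram_exec P Q c b (ram_of (Suc p) (r, h, x, g)) (t + Suc u) s''"
      using ih[OF fits] by blast
    then have "ram_exec P Q c b (ram_of p (r, h, x, g)) (instr_cost c (jump T ?q) + (t + Suc u)) s''"
      using if_false.hyps if_false.prems(1,3) P
      by (intro ram_exec_cons) (auto simp: step_jump simp del: ram_of.simps)
    then show "ram_exec P Q c b (ram_of p (r, h, x, g)) (Suc (Suc t) + u) s''" by (simp del: ram_of.simps)
  qed
next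
  case (while_false T r x C h g)
  let ?d = "compile (p + 2) C"
  note P = while_false.prems(2)[unfolded compile.simps Let_def]
  have fits': "fits_word_length b (ram_of p' (r, h, x, g))" for p' using while_false.prems(1) fits_pc by blast
  show ?case
  proof (intro conjI allI impI fits')
    fix u s'' assume "ram_exec P Q c b (ram_of (p + length (compile p (While T C))) (r, h, x, g)) u s''"
    then have "ram_exec P Q c b (ram_step Q (Jump (p + 3 + length ?d)) (ram_of (Suc p) (r, h, x, g))) u s''"
      by (simp add: Let_def add_ac numeral_3_eq_3 del: ram_step.simps ram_of.simps)
    from ram_exec_cons[OF fits' refl _ _ this, of "xs @ [jump T (p + 2)]"]
    have "ram_exec P Q c b (ram_of (Suc p) (r, h, x, g)) (Suc u) s''"
      using P while_false.prems(3) by (simp del: ram_of.simps)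
    then have "ram_exec P Q c b (ram_of p (r, h, x, g)) (instr_cost c (jump T (p + 2)) + Suc u) s''"
      using while_false.hyps while_false.prems(1,3) P
      by (intro ram_exec_cons) (auto simp: step_jump simp del: ram_of.simps)
    then show "ram_exec P Q c b (ram_of p (r, h, x, g)) (2 + u) s''" by (simp del: ram_of.simps)
  qed
next
  case (while_true T r x C h g t s' t' s'')
  let ?d = "compile (p + 2) C"
  note P = while_true.prems(2)[unfolded compile.simps Let_def]
  have "P = (xs @ [jump T (p + 2), Jump (p + 3 + length ?d)]) @ compile (p + 2) C @ (Jump p # ys)" using P by simp
  note ih1 = while_true.IH(1)[OF _ this]
  have fits: "fits_word_length b (ram_of (p + 2) (r, h, x, g))" using while_true.prems(1) fits_pc by blast
  have fits': "fits_word_length b (ram_of q s')" for q using ih1[OF fits] while_true.prems(3) by simp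
  note ih2 = while_true.IH(2)[OF fits' while_true.prems(2,3), of p']
  show ?case
  proof (intro conjI allI impI)
    show "fits_word_length b (ram_of p' s'')" using ih2 by simp
    fix u z assume "ram_exec P Q c b (ram_of (p + length (compile p (While T C))) s'') u z"
    then have "ram_exec P Q c b (ram_step Q (Jump p) (ram_of (p + 2 + length ?d) s')) (t' + u) z"
      using ih2 by (simp del: ram_step.simps ram_of.simps)
    from ram_exec_cons[OF fits' refl _ _ this, of "xs @ jump T (p + 2) # Jump (p + 3 + length ?d) # ?d"]
    have "ram_exec P Q c b (ram_of (p + 2 + length ?d) s') (Suc (t' + u)) z"
      using P while_true.prems(3) by simp
    moreover have "length (xs @ [jump T (p + 2), Jump (p + 3 + length ?d)]) = p + 2" using while_true.prems(3) by simp
    ultimately have "ram_exec P Q c b (ram_of (p + 2) (r, h, x, g)) (t + Suc (t' + u)) z"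
      using ih1[OF fits] by blast
    then have "ram_exec P Q c b (ram_of p (r, h, x, g)) (instr_cost c (jump T (p + 2)) + (t + Suc (t' + u))) z"
      using while_true.hyps while_true.prems(1,3) P
      by (intro ram_exec_cons) (auto simp: step_jump simp del: ram_of.simps)
    then show "ram_exec P Q c b (ram_of p (r, h, x, g)) (t + t' + 2 + u) z" by (simp add: add_ac del: ram_of.simps)
  qed
qed

section \<open>Weakest preconditions with running time\<close>

type_synonym post = "regs \<Rightarrow> regs \<Rightarrow> nregs \<Rightarrow> nregs \<Rightarrow> nat \<Rightarrow> bool"

text \<open>Total correctness. The argument \<open>t\<close> is the time elapsed before the command,
  so postconditions see absolute times and bounds add up along a sequence.\<close>

definition wp :: "problem \<Rightarrow> nat \<Rightarrow> nat \<Rightarrow> com \<Rightarrow> post \<Rightarrow> post" where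
  "wp P c B C \<Phi> r h x g t \<longleftrightarrow>
     (\<exists>u r' h' x' g'. run P c B C (r, h, x, g) u (r', h', x', g') \<and> \<Phi> r' h' x' g' (t + u))"

lemma wpI:
  "run P c B C (r, h, x, g) u (r', h', x', g') \<Longrightarrow> \<Phi> r' h' x' g' (t + u) \<Longrightarrow> wp P c B C \<Phi> r h x g t"
  unfolding wp_def by blast

lemma wp_mono:
  assumes "wp P c B C \<Phi> r h x g t" "\<And>r h x g t. \<Phi> r h x g t \<Longrightarrow> \<Psi> r h x g t"
  shows "wp P c B C \<Psi> r h x g t"
  using assms unfolding wp_def by blast

lemma wp_Skip [simp]: "wp P c B Skip \<Phi> r h x g t \<longleftrightarrow> \<Phi> r h x g t"
  unfolding wp_def by (auto elim: run.cases intro: run.skip) (metis add.right_neutral run.skip)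

lemma wp_DoI:
  assumes "instr_ok P B i r" "effect P i (r, h, x, g) = (r', h', x', g')" "\<Phi> r' h' x' g' (t + instr_cost c i)"
  shows "wp P c B (Do i) \<Phi> r h x g t"
  using run.do[OF assms(1), of c h x g] assms(2,3) unfolding wp_def by metis

lemma wp_Seq: "wp P c B C (wp P c B D \<Phi>) r h x g t \<Longrightarrow> wp P c B (C ;; D) \<Phi> r h x g t"
  unfolding wp_def by (metis (no_types, lifting) add.assoc run.seq)

lemma wp_If:
  assumes "test_ok T" "holds T r x \<Longrightarrow> wp P c B C \<Phi> r h x g (Suc t)"
    "\<not> holds T r x \<Longrightarrow> wp P c B D \<Phi> r h x g (Suc (Suc t))"
  shows "wp P c B (If T C D) \<Phi> r h x g t"
proof (cases "holds T r x")
  case True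
  from assms(2)[OF True] obtain u r' h' x' g' where
    *: "run P c B C (r, h, x, g) u (r', h', x', g')" "\<Phi> r' h' x' g' (Suc t + u)" unfolding wp_def by blast
  show ?thesis unfolding wp_def using run.if_true[OF assms(1) True *(1), of D] *(2) by force
next
  case False
  from assms(3)[OF False] obtain u r' h' x' g' where
    *: "run P c B D (r, h, x, g) u (r', h', x', g')" "\<Phi> r' h' x' g' (Suc (Suc t) + u)" unfolding wp_def by blast
  show ?thesis unfolding wp_def using run.if_false[OF assms(1) False *(1), of C] *(2) by force
qed

text \<open>As equivalences, this rule and its analogues for sequences and branches let the
  simplifier execute loop-free code symbolically.\<close>

lemma wp_Do_iff:
  "wp P c B (Do i) \<Phi> r h x g t \<longleftrightarrow> instr_ok P B i r \<and>
     (case effect P i (r, h, x, g) of (r', h', x', g') \<Rightarrow> \<Phi> r' h' x' g' (t + instr_cost c i))"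
proof
  assume "wp P c B (Do i) \<Phi> r h x g t"
  then obtain u r' h' x' g' where "run P c B (Do i) (r, h, x, g) u (r', h', x', g')" "\<Phi> r' h' x' g' (t + u)"
    unfolding wp_def by blast
  then show "instr_ok P B i r \<and> (case effect P i (r, h, x, g) of (r', h', x', g') \<Rightarrow> \<Phi> r' h' x' g' (t + instr_cost c i))"
    by (cases rule: run.cases) auto
qed (auto intro: wp_DoI split: prod.splits)

lemma wp_Seq_iff: "wp P c B (C ;; D) \<Phi> r h x g t \<longleftrightarrow> wp P c B C (wp P c B D \<Phi>) r h x g t"
proof
  assume "wp P c B (C ;; D) \<Phi> r h x g t"
  then obtain u r' h' x' g' where "run P c B (C ;; D) (r, h, x, g) u (r', h', x', g')" "\<Phi> r' h' x' g' (t + u)"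
    unfolding wp_def by blast
  then show "wp P c B C (wp P c B D \<Phi>) r h x g t"
  proof (cases rule: run.cases)
    case (seq t1 s1 t2)
    obtain r1 h1 x1 g1 where s1: "s1 = (r1, h1, x1, g1)" by (cases s1) auto
    have "\<Phi> r' h' x' g' (t + t1 + t2)" using seq(1) \<open>\<Phi> _ _ _ _ _\<close> by (simp add: add.assoc)
    then have "wp P c B D \<Phi> r1 h1 x1 g1 (t + t1)" by (rule wpI[OF seq(3)[unfolded s1]])
    then show ?thesis by (rule wpI[OF seq(2)[unfolded s1]])
  qed
qed (rule wp_Seq)

lemma wp_If_iff:
  "wp P c B (If T C D) \<Phi> r h x g t \<longleftrightarrow> test_ok T \<and>
     (if holds T r x then wp P c B C \<Phi> r h x g (Suc t) else wp P c B D \<Phi> r h x g (Suc (Suc t)))"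
proof
  assume "wp P c B (If T C D) \<Phi> r h x g t"
  then obtain u r' h' x' g' where "run P c B (If T C D) (r, h, x, g) u (r', h', x', g')" "\<Phi> r' h' x' g' (t + u)"
    unfolding wp_def by blast
  then show "test_ok T \<and>
     (if holds T r x then wp P c B C \<Phi> r h x g (Suc t) else wp P c B D \<Phi> r h x g (Suc (Suc t)))"
  proof (cases rule: run.cases)
    case (if_true t1)
    then show ?thesis using wpI[OF if_true(4), of \<Phi> "Suc t"] \<open>\<Phi> _ _ _ _ _\<close> by simp
  next
    case (if_false t1)
    then show ?thesis using wpI[OF if_false(4), of \<Phi> "Suc (Suc t)"] \<open>\<Phi> _ _ _ _ _\<close> by simp
  qed
qed (auto intro: wp_If split: if_splits)

lemmas wp_simps = wp_Do_iff wp_Seq_iff wp_If_iff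

text \<open>The index of the invariant is the termination measure.\<close>

lemma wp_While:
  fixes I :: "nat \<Rightarrow> post"
  assumes T: "test_ok T" and "I k r h x g t"
    and body: "\<And>k r h x g t. I k r h x g t \<Longrightarrow> holds T r x \<Longrightarrow>
      wp P c B C (\<lambda>r h x g t. \<exists>k'<k. I k' r h x g (Suc t)) r h x g (Suc t)"
    and exit: "\<And>k r h x g t. I k r h x g t \<Longrightarrow> \<not> holds T r x \<Longrightarrow> \<Phi> r h x g (t + 2)"
  shows "wp P c B (While T C) \<Phi> r h x g t"
  using assms(2)
proof (induction k arbitrary: r h x g t rule: less_induct)
  case (less k)
  show ?case
  proof (cases "holds T r x")
    case False
    show ?thesis unfolding wp_def using run.while_false[OF T False] exit[OF less.prems False] by blast
  next
    case True
    from body[OF less.prems True] obtain u r' h' x' g' k' where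
      1: "run P c B C (r, h, x, g) u (r', h', x', g')" "k' < k" "I k' r' h' x' g' (Suc (Suc t + u))"
      unfolding wp_def by blast
    from less.IH[OF 1(2,3)] obtain u' r'' h'' x'' g'' where
      2: "run P c B (While T C) (r', h', x', g') u' (r'', h'', x'', g'')" "\<Phi> r'' h'' x'' g'' (Suc (Suc t + u) + u')"
      unfolding wp_def by blast
    have "Suc (Suc t + u) + u' = t + (u + u' + 2)" by simp
    then show ?thesis unfolding wp_def using run.while_true[OF T True 1(1) 2(1)] 2(2) by metis
  qed
qed

text \<open>Register 2 holds the constant 1.\<close>

definition For :: "nat \<Rightarrow> nat \<Rightarrow> com \<Rightarrow> com" where
  "For v u C = Do (WConst v 0) ;; While (WLess v u) (C ;; Do (WAdd v v 2))"

lemma instr_cost_simps [simp]: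
  "instr_cost c (WConst a k) = 1" "instr_cost c (WCopy a b) = 1" "instr_cost c (WLoad a b) = 1"
  "instr_cost c (WStore a b) = 1" "instr_cost c (WAdd a b d) = 1" "instr_cost c (WSub a b d) = 1"
  "instr_cost c (WMult a b d) = 1" "instr_cost c (WDiv a b d) = 1" "instr_cost c (WMod a b d) = 1"
  "instr_cost c (NConst a i) = 1" "instr_cost c (NOfWord a b) = 1" "instr_cost c (NCopy a b) = 1"
  "instr_cost c (NLoad a b) = 1" "instr_cost c (NStore a b) = 1" "instr_cost c (NAdd a b d) = 1"
  "instr_cost c (NSub a b d) = 1" "instr_cost c (NMult a b d) = 1" "instr_cost c (NDiv a b d) = 1"
  "instr_cost c (GetEntry a b d) = 1" "instr_cost c (GetWeight a b) = 1" "instr_cost c (GetColumn a b) = c"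
  by (simp_all add: instr_cost_def)

text \<open>Each round adds 3 to the time of the body: increment, test and jump back. The other 3
  are the initialisation and the two jumps of the exit.\<close>

lemma wp_For:
  fixes I :: "nat \<Rightarrow> regs \<Rightarrow> regs \<Rightarrow> nregs \<Rightarrow> nregs \<Rightarrow> bool"
  assumes vars: "v < 32" "u < 32" "v \<noteq> u" "v \<noteq> 2" "u \<noteq> 2" and r: "r 2 = 1" "r u = K" "K < B"
    and init: "I 0 (r(v := 0)) h x g"
    and body: "\<And>i r h x g t. i < K \<Longrightarrow> I i r h x g \<Longrightarrow> r v = i \<Longrightarrow> r u = K \<Longrightarrow> r 2 = 1 \<Longrightarrow>
      wp P c B C (\<lambda>r' h' x' g' t'. t' \<le> t + T \<and> r' v = i \<and> r' u = K \<and> r' 2 = 1 \<and> I (Suc i) (r'(v := Suc i)) h' x' g') r h x g t"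
    and post: "\<And>r h x g t'. I K r h x g \<Longrightarrow> r v = K \<Longrightarrow> r u = K \<Longrightarrow> r 2 = 1 \<Longrightarrow> t' \<le> t + 3 + K * (T + 3) \<Longrightarrow> \<Phi> r h x g t'"
  shows "wp P c B (For v u C) \<Phi> r h x g t"
  unfolding For_def
proof (rule wp_Seq, rule wp_DoI[OF _ effect.simps(1)])
  let ?I = "\<lambda>k r h x g s. I (K - k) r h x g \<and> k \<le> K \<and> r v = K - k \<and> r u = K \<and> r 2 = 1 \<and> s \<le> t + 1 + (K - k) * (T + 3)"
  show "wp P c B (While (WLess v u) (C ;; Do (WAdd v v 2))) \<Phi> (r(v := 0)) h x g (t + instr_cost c (WConst v 0))"
  proof (rule wp_While[where I = ?I and k = K])
    fix k r h x g s assume inv: "?I k r h x g s" and "holds (WLess v u) r x"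
    then have k: "0 < k" by auto
    show "wp P c B (C ;; Do (WAdd v v 2)) (\<lambda>r h x g t. \<exists>k'<k. ?I k' r h x g (Suc t)) r h x g (Suc s)"
    proof (rule wp_Seq, rule wp_mono[OF body[of "K - k"]])
      fix r' h' x' g' s'
      assume *: "s' \<le> Suc s + T \<and> r' v = K - k \<and> r' u = K \<and> r' 2 = 1 \<and> I (Suc (K - k)) (r'(v := Suc (K - k))) h' x' g'"
      have Sk: "Suc (K - k) = K - (k - 1)" using inv k by auto
      have "(K - (k - 1)) * (T + 3) = (K - k) * (T + 3) + (T + 3)" unfolding Sk[symmetric] by simp
      then have "Suc (Suc s') \<le> t + 1 + (K - (k - 1)) * (T + 3)" using * inv by simp
      then have "?I (k - 1) (r'(v := Suc (K - k))) h' x' g' (Suc (Suc s'))"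
        using * inv k vars Sk by auto
      then show "wp P c B (Do (WAdd v v 2)) (\<lambda>r h x g t. \<exists>k'<k. ?I k' r h x g (Suc t)) r' h' x' g' s'"
        using vars * k r(3) inv by (intro wp_DoI[OF _ effect.simps(5)]) (auto intro!: exI[of _ "k - 1"])
    qed (use inv k in auto)
  next
    fix k r h x g s assume inv: "?I k r h x g s" and "\<not> holds (WLess v u) r x"
    then have k: "k = 0" by auto
    then show "\<Phi> r h x g (s + 2)" using inv by (intro post) auto
  qed (use vars r init in auto)
qed (use vars r in auto)

section \<open>The program\<close>

text \<open>
  Word registers: 0 \<open>m\<close>, 1 \<open>n\<close>, 2 the constant 1, 4 \<open>N\<close>, 5 the slot size \<open>S\<close>, 6 the bottom of the
  stack, 7 the address 32 of the column read last, 8 \<open>j\<close>, 9 \<open>k\<close>, 10 the end of the stack, 11 its top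
  slot, 12 and 13 the number \<open>e\<close> and the length of the statuses of the top item, 14 the address of its
  first status, 15 the bad row, 16 the picked column. Number registers: 0 the accumulator, 4 the
  coefficient of the top item, 7 the power \<open>- (- w\<^sub>j) ^ k\<close>, 8 \<open>- w\<^sub>j\<close>.
\<close>

declare One_nat_def [simp del]

text \<open>The cells from 32 on buffer the column read last: its length and at most
  \<open>m\<close> row numbers. Everything from 33 + m on is free for the stack.\<close>

locale machine = weighted_system m n A w for m n A w +
  fixes c B S :: nat and \<epsilon> :: real
  assumes column_le: "j < n \<Longrightarrow> card {i. i < m \<and> A i j \<noteq> 0} \<le> c"
    and base_le: "33 + m \<le> B" and n_less: "n < B"
begin

definition input :: problem where
  "input = \<lparr>rows = m, cols = n, entry = A, wt = w, err = \<epsilon>\<rparr>"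

lemma input_simps [simp]:
  "rows input = m" "cols input = n" "entry input = A" "wt input = w" "err input = \<epsilon>"
  by (simp_all add: input_def)

definition status_at :: "regs \<Rightarrow> nat \<Rightarrow> status \<Rightarrow> bool" where
  "status_at h a st \<longleftrightarrow> (\<forall>l<n. h (a + l) = st l)"

lemma set_column_support: "j < n \<Longrightarrow> set (column_support input j) = {i. i < m \<and> A i j \<noteq> 0}"
  by (simp add: column_support_def)

lemma length_column_support:
  assumes "j < n"
  shows "length (column_support input j) \<le> c" "length (column_support input j) \<le> m"
proof -
  have "length (column_support input j) = card {i. i < m \<and> A i j \<noteq> 0}"
    using assms by (simp add: column_support_def)
  moreover have "card {i. i < m \<and> A i j \<noteq> 0} \<le> card {..<m}" by (intro card_mono) auto
  ultimately show "length (column_support input j) \<le> c" "length (column_support input j) \<le> m"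
    using column_le[OF assms] by auto
qed

end

text \<open>The sum stays a number, which can only be tested for zero. Truncated subtraction of 1
  from a status vanishes exactly for the columns that are not charged.\<close>

definition row_sum_code :: com where
  "row_sum_code = Do (NConst 2 0) ;; For 20 1
     (Do (WAdd 24 14 20) ;; Do (WLoad 24 24) ;; Do (WSub 24 24 2) ;;
      If (WZero 24) Skip (Do (GetEntry 3 23 20) ;; Do (NAdd 2 2 3)))"

text \<open>Only rows met by a charged column can be unbalanced. Visiting them through
  \<open>GetColumn\<close> replaces a loop over all rows and keeps \<open>m\<close> out of the
  running time.\<close>

definition bad_row_code :: com where
  "bad_row_code = Do (WCopy 15 0) ;; For 17 1
     (Do (WAdd 22 14 17) ;; Do (WLoad 22 22) ;; Do (WSub 22 22 2) ;;
      If (WZero 22) Skip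
        (Do (GetColumn 7 17) ;; Do (WLoad 18 7) ;; For 19 18
          (Do (WAdd 23 7 19) ;; Do (WAdd 23 23 2) ;; Do (WLoad 23 23) ;; row_sum_code ;;
           If (NZero 2) Skip (If (WLess 23 15) (Do (WCopy 15 23)) Skip))))"

text \<open>Scanning upwards and overwriting leaves the largest candidate, in agreement with
  \<open>pick\<close>.\<close>

definition pick_code :: com where
  "pick_code = Do (WCopy 16 1) ;; For 17 1
     (Do (WAdd 22 14 17) ;; Do (WLoad 22 22) ;;
      If (WZero 22) (Do (GetEntry 3 15 17) ;; If (NZero 3) Skip (Do (WCopy 16 17))) Skip)"

context machine
begin

lemma wp_row_sum_code:
  assumes r: "r 2 = 1" "r 1 = n" "r 14 = a" "r 23 = i" and "32 \<le> a" "a + n < B" "i < m" "status_at h a st"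
    and post: "\<And>r' x' t'. \<forall>b. b \<notin> {20, 24} \<longrightarrow> r' b = r b \<Longrightarrow> \<forall>b. b \<notin> {2, 3} \<longrightarrow> x' b = x b \<Longrightarrow>
      x' 2 = of_int (row_sum st i) \<Longrightarrow> t' \<le> t + 4 + n * 10 \<Longrightarrow> \<Phi> r' h x' g t'"
  shows "wp input c B row_sum_code \<Phi> r h x g t"
proof -
  define s where "s = (\<lambda>l. \<Sum>l\<in>{l'. l' < l \<and> 2 \<le> st l'}. A i l)"
  let ?I = "\<lambda>l r' h' x' g'. h' = h \<and> g' = g \<and> (\<forall>b. b \<notin> {20, 24} \<longrightarrow> r' b = r b) \<and>
     (\<forall>b. b \<notin> {2, 3} \<longrightarrow> x' b = x b) \<and> x' 2 = of_int (s l)"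
  have s_Suc: "s (Suc l) = (if 2 \<le> st l then s l + A i l else s l)" for l
  proof -
    have "{l'. l' < Suc l \<and> 2 \<le> st l'} =
        (if 2 \<le> st l then insert l {l'. l' < l \<and> 2 \<le> st l'} else {l'. l' < l \<and> 2 \<le> st l'})"
      by (auto simp: less_Suc_eq)
    then show ?thesis by (simp add: s_def)
  qed
  show ?thesis unfolding row_sum_code_def wp_simps
  proof (simp, rule wp_For[where I = ?I and K = n and T = 7])
    fix l r' h' x' g' t'
    assume "l < n" "?I l r' h' x' g'" "r' 20 = l" "r' 1 = n" "r' 2 = 1"
    moreover then have "h (a + l) = st l" using assms(8) by (simp add: status_at_def)
    ultimately show "wp input c B (Do (WAdd 24 14 20) ;; Do (WLoad 24 24) ;; Do (WSub 24 24 2) ;;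
        If (WZero 24) Skip (Do (GetEntry 3 23 20) ;; Do (NAdd 2 2 3)))
       (\<lambda>r'' h'' x'' g'' t''. t'' \<le> t' + 7 \<and> r'' 20 = l \<and> r'' 1 = n \<and> r'' 2 = 1 \<and> ?I (Suc l) (r''(20 := Suc l)) h'' x'' g'') r' h' x' g' t'"
      using assms r by (auto simp: wp_simps s_Suc)
  next
    fix r' h' x' g' t'
    assume "?I n r' h' x' g'" "t' \<le> t + 1 + 3 + n * (7 + 3)"
    then show "\<Phi> r' h' x' g' t'"
      using post[of r' x' t'] by (simp add: row_sum_def chosen_def s_def)
  qed (use r assms in \<open>auto simp: s_def\<close>)
qed

lemma wp_bad_row_code:
  assumes r: "r 0 = m" "r 1 = n" "r 2 = 1" "r 7 = 32" "r 14 = a" and "33 + m \<le> a" "a + n < B" "status_at h a st"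
    and post: "\<And>r' h' x' t'. \<forall>b. b \<notin> {15, 17, 18, 19, 20, 22, 23, 24} \<longrightarrow> r' b = r b \<Longrightarrow>
      \<forall>b\<ge>33 + m. h' b = h b \<Longrightarrow> \<forall>b. b \<notin> {2, 3} \<longrightarrow> x' b = x b \<Longrightarrow>
      r' 15 = bad_row st \<Longrightarrow> t' \<le> t + 4 + n * (12 + c * (15 + 10 * n)) \<Longrightarrow> \<Phi> r' h' x' g t'"
  shows "wp input c B bad_row_code \<Phi> r h x g t"
proof -
  \<comment> \<open>The running minimum over the rows seen so far, again with \<open>m\<close> for
    none.\<close>
  define best where "best = (\<lambda>X. Min (insert m {i \<in> X. row_sum st i \<noteq> 0}))"
  have best_insert: "best (insert i X) = (if row_sum st i \<noteq> 0 \<and> i < best X then i else best X)" if "finite X" for i X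
  proof (cases "row_sum st i = 0")
    case False
    then have "insert m {i' \<in> insert i X. row_sum st i' \<noteq> 0} = insert i (insert m {i \<in> X. row_sum st i \<noteq> 0})" by auto
    then have "best (insert i X) = min i (best X)" unfolding best_def using that by (subst Min_insert[symmetric]) auto
    then show ?thesis using False by auto
  next
    case True
    then have "{i' \<in> insert i X. row_sum st i' \<noteq> 0} = {i' \<in> X. row_sum st i' \<noteq> 0}" by auto
    then show ?thesis using True by (simp add: best_def)
  qed
  \<comment> \<open>The rows met by charged columns among the first \<open>k\<close>; once
    \<open>k = n\<close>, all other rows are balanced.\<close>
  define V where "V = (\<lambda>k. {i. i < m \<and> (\<exists>l<k. 2 \<le> st l \<and> A i l \<noteq> 0)})"
  have V_Suc: "V (Suc k) = (if 2 \<le> st k then V k \<union> set (column_support input k) else V k)" if "k < n" for k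
    using that by (auto simp: V_def set_column_support less_Suc_eq)
  have finV: "finite (V k)" for k by (simp add: V_def)
  have best_V: "best (V n) = bad_row st"
  proof -
    have "row_sum st i = 0" if "\<not> (\<exists>l<n. 2 \<le> st l \<and> A i l \<noteq> 0)" for i
      unfolding row_sum_def using that by (intro sum.neutral) (auto simp: chosen_def)
    then have "{i \<in> V n. row_sum st i \<noteq> 0} = {i. i < m \<and> row_sum st i \<noteq> 0}" by (auto simp: V_def)
    then show ?thesis by (simp add: best_def bad_row_def)
  qed
  let ?F = "\<lambda>r' h' x' g'. (\<forall>b. b \<notin> {15, 17, 18, 19, 20, 22, 23, 24} \<longrightarrow> r' b = r b) \<and>
     (\<forall>b\<ge>33 + m. h' b = h b) \<and> (\<forall>b. b \<notin> {2, 3} \<longrightarrow> x' b = x b) \<and> g' = g"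
  let ?I = "\<lambda>k r' h' x' g'. ?F r' h' x' g' \<and> r' 15 = best (V k)"
  show ?thesis unfolding bad_row_code_def wp_Seq_iff[of _ _ _ "Do (WCopy 15 0)"] wp_Do_iff
  proof (simp, rule wp_For[where I = ?I and K = n and T = "9 + c * (15 + 10 * n)"])
    fix k r' h' x' g' t'
    assume k: "k < n" "?I k r' h' x' g'" "r' 17 = k" "r' 1 = n" "r' 2 = 1"
    have hk: "h' (a + k) = st k" using assms(6,8) k by (simp add: status_at_def)
    let ?\<Phi> = "\<lambda>r'' h'' x'' g'' t''. t'' \<le> t' + (9 + c * (15 + 10 * n)) \<and> r'' 17 = k \<and> r'' 1 = n \<and> r'' 2 = 1 \<and>
       ?I (Suc k) (r''(17 := Suc k)) h'' x'' g''"
    let ?xs = "column_support input k"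
    let ?h1 = "write_list 32 (length ?xs # ?xs) h'"
    have len: "length ?xs \<le> c" "length ?xs \<le> m" using length_column_support k by auto
    have h1: "?h1 32 = length ?xs" "\<And>u. u < length ?xs \<Longrightarrow> ?h1 (33 + u) = ?xs ! u" "\<forall>b\<ge>33 + m. ?h1 b = h' b"
      using len by (auto simp: write_list_def)
    define r1 where "r1 = r'(22 := st k - 1, 18 := length ?xs)"
    let ?J = "\<lambda>u r'' h'' x'' g''. h'' = ?h1 \<and> ?F r'' h'' x'' g'' \<and> r'' 17 = k \<and> r'' 15 = best (V k \<union> set (take u ?xs))"
    have inner: "wp input c B (For 19 18
          (Do (WAdd 23 7 19) ;; Do (WAdd 23 23 2) ;; Do (WLoad 23 23) ;; row_sum_code ;;
           If (NZero 2) Skip (If (WLess 23 15) (Do (WCopy 15 23)) Skip))) ?\<Phi> r1 ?h1 x' g' (Suc (Suc (t' + 1 + 1 + 1 + c + 1)))"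
      if chosen: "2 \<le> st k"
    proof (rule wp_For[where I = ?J and K = "length ?xs" and T = "11 + 10 * n"])
      fix u r'' h'' x'' g'' t''
      assume u: "u < length ?xs" "?J u r'' h'' x'' g''" "r'' 19 = u" "r'' 18 = length ?xs" "r'' 2 = 1"
      define i where "i = ?xs ! u"
      have i: "i < m" using column_support_less[of i input k] u(1) by (simp add: i_def)
      have take: "set (take (Suc u) ?xs) = insert i (set (take u ?xs))"
        using u(1) by (simp add: i_def take_Suc_conv_app_nth)
      have "?h1 b = h b" if "33 + m \<le> b" for b using u(2) that by blast
      then have at: "status_at ?h1 a st" using assms(6,8) by (simp add: status_at_def)
      have h1u: "?h1 (Suc (32 + u)) = i" using h1(2)[OF u(1)] by (simp add: i_def)
      show "wp input c B (Do (WAdd 23 7 19) ;; Do (WAdd 23 23 2) ;; Do (WLoad 23 23) ;; row_sum_code ;;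
           If (NZero 2) Skip (If (WLess 23 15) (Do (WCopy 15 23)) Skip))
          (\<lambda>r' h' x' g' t'. t' \<le> t'' + (11 + 10 * n) \<and> r' 19 = u \<and> r' 18 = length ?xs \<and> r' 2 = 1 \<and>
             ?J (Suc u) (r'(19 := Suc u)) h' x' g') r'' h'' x'' g'' t''"
        using u r h1u len base_le
      proof (simp add: wp_Seq_iff wp_Do_iff, intro wp_row_sum_code[where a = a and i = i and st = st], goal_cases)
        case (9 r2 x2 t2)
        have "finite (V k \<union> set (take u ?xs))" using finV by simp
        from best_insert[OF this, of i] show ?case
          using 9 u(2) by (auto simp: wp_simps take)
      qed (use at i assms(6,7) in \<open>auto\<close>)
    next
      fix r'' h'' x'' g'' t''
      assume J: "?J (length ?xs) r'' h'' x'' g''" "r'' 2 = 1" "t'' \<le> Suc (Suc (t' + 1 + 1 + 1 + c + 1)) + 3 + length ?xs * (11 + 10 * n + 3)"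
      have "length ?xs * (11 + 10 * n + 3) \<le> c * (11 + 10 * n + 3)" using len(1) by (rule mult_le_mono1)
      then have "t'' \<le> t' + (9 + c * (15 + 10 * n))" using J(3) by (simp add: algebra_simps)
      then show "?\<Phi> r'' h'' x'' g'' t''" using J k V_Suc[OF k(1)] chosen r by auto
    qed (use k r h1(3) len base_le in \<open>auto simp: r1_def\<close>)
    show "wp input c B
       (Do (WAdd 22 14 17) ;; Do (WLoad 22 22) ;; Do (WSub 22 22 2) ;;
        If (WZero 22) Skip
        (Do (GetColumn 7 17) ;; Do (WLoad 18 7) ;; For 19 18
          (Do (WAdd 23 7 19) ;; Do (WAdd 23 23 2) ;; Do (WLoad 23 23) ;; row_sum_code ;;
           If (NZero 2) Skip (If (WLess 23 15) (Do (WCopy 15 23)) Skip)))) ?\<Phi> r' h' x' g' t'"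
    proof (cases "2 \<le> st k")
      case False
      then show ?thesis using k hk r assms(6,7) V_Suc[OF k(1)] by (auto simp: wp_simps)
    next
      case True
      have "wp input c B (Do (WAdd 22 14 17) ;; Do (WLoad 22 22) ;; Do (WSub 22 22 2) ;;
        If (WZero 22) Skip
        (Do (GetColumn 7 17) ;; Do (WLoad 18 7) ;; C)) ?\<Phi> r' h' x' g' t' \<longleftrightarrow>
         wp input c B C ?\<Phi> r1 ?h1 x' g' (Suc (Suc (t' + 1 + 1 + 1 + c + 1)))" for C
        using True k hk r assms(6,7) h1(1) len base_le by (simp add: wp_simps r1_def Let_def fun_upd_twist)
      then show ?thesis using inner[OF True] by simp
    qed
  next
    fix r' h' x' g' t'
    assume "?I n r' h' x' g'" "t' \<le> t + 1 + 3 + n * (9 + c * (15 + 10 * n) + 3)"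
    then show "\<Phi> r' h' x' g' t'"
      using post[of r' h' x' t'] by (simp add: best_V algebra_simps)
  qed (use r assms(6-8) n_less in \<open>auto simp: best_def V_def\<close>)
qed

lemma wp_pick_code:
  assumes r: "r 1 = n" "r 2 = 1" "r 14 = a" "r 15 = i" and "32 \<le> a" "a + n < B" "i < m" "status_at h a st"
    and post: "\<And>r' x' t'. \<forall>b. b \<notin> {16, 17, 22} \<longrightarrow> r' b = r b \<Longrightarrow> \<forall>b. b \<noteq> 3 \<longrightarrow> x' b = x b \<Longrightarrow>
      r' 16 = pick st i n \<Longrightarrow> t' \<le> t + 4 + n * 10 \<Longrightarrow> \<Phi> r' h x' g t'"
  shows "wp input c B pick_code \<Phi> r h x g t"
proof -
  let ?I = "\<lambda>l r' h' x' g'. h' = h \<and> g' = g \<and> (\<forall>b. b \<notin> {16, 17, 22} \<longrightarrow> r' b = r b) \<and>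
     (\<forall>b. b \<noteq> 3 \<longrightarrow> x' b = x b) \<and> r' 16 = pick st i l"
  show ?thesis unfolding pick_code_def wp_simps
  proof (simp, rule wp_For[where I = ?I and K = n and T = 7])
    fix l r' h' x' g' t'
    assume "l < n" "?I l r' h' x' g'" "r' 17 = l" "r' 1 = n" "r' 2 = 1"
    moreover then have "h (a + l) = st l" using assms(8) by (simp add: status_at_def)
    ultimately show "wp input c B (Do (WAdd 22 14 17) ;; Do (WLoad 22 22) ;;
      If (WZero 22) (Do (GetEntry 3 15 17) ;; If (NZero 3) Skip (Do (WCopy 16 17))) Skip)
       (\<lambda>r'' h'' x'' g'' t''. t'' \<le> t' + 7 \<and> r'' 17 = l \<and> r'' 1 = n \<and> r'' 2 = 1 \<and> ?I (Suc l) (r''(17 := Suc l)) h'' x'' g'') r' h' x' g' t'"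
      using assms r by (auto simp: wp_simps)
  next
    fix r' h' x' g' t'
    assume "?I n r' h' x' g'" "t' \<le> t + 1 + 3 + n * (7 + 3)"
    then show "\<Phi> r' h' x' g' t'" using post[of r' x' t'] by simp
  qed (use r assms in auto)
qed

end

text \<open>The top slot is copied twice and edited in place: the picked column is marked removed in
  the original and charged in the first copy, and the second copy gets the new status appended.
  Subtracting twice from 1 turns a status \<open>s\<close> into \<open>min s 1\<close>, as
  \<open>fresh\<close> requires.\<close>

definition expand_code :: com where
  "expand_code =
     Do (WAdd 25 10 5) ;;
     For 17 5 (Do (WAdd 22 11 17) ;; Do (WLoad 22 22) ;; Do (WAdd 23 10 17) ;; Do (WStore 23 22) ;;
       Do (WAdd 23 25 17) ;; Do (WStore 23 22)) ;;
     Do (WAdd 22 14 16) ;; Do (WStore 22 2) ;;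
     Do (WSub 12 12 2) ;; Do (WStore 10 12) ;; Do (WStore 25 12) ;;
     Do (WConst 26 2) ;; Do (WAdd 22 22 5) ;; Do (WStore 22 26) ;;
     Do (GetWeight 5 16) ;; Do (NMult 5 4 5) ;; Do (NStore 10 5) ;;
     Do (NConst 6 0) ;; Do (NSub 6 6 5) ;; Do (NStore 25 6) ;;
     Do (WAdd 13 13 1) ;; Do (WAdd 22 25 2) ;; Do (WStore 22 13) ;;
     Do (WAdd 27 14 5) ;; Do (WAdd 27 27 5) ;; Do (WAdd 27 27 1) ;;
     For 17 1 (Do (WAdd 22 14 17) ;; Do (WLoad 22 22) ;; Do (WSub 22 2 22) ;; Do (WSub 22 2 22) ;;
       Do (WAdd 23 27 17) ;; Do (WStore 23 22)) ;;
     Do (WAdd 22 27 16) ;; Do (WStore 22 26) ;;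
     Do (WAdd 10 25 5)"

text \<open>Follows the equations of \<open>advance\<close>. Dropping an item moves the end of the
  stack, dropping a factor only shortens the stored length.\<close>

definition step_code :: com where
  "step_code =
     Do (WSub 11 10 5) ;; Do (WLoad 12 11) ;;
     If (WZero 12) (Do (WCopy 10 11))
      (Do (WAdd 21 11 2) ;; Do (WLoad 13 21) ;; Do (NLoad 4 11) ;;
       If (WZero 13) (Do (NAdd 0 0 4) ;; Do (WCopy 10 11))
        (Do (WAdd 14 21 13) ;; Do (WAdd 14 14 2) ;; Do (WSub 14 14 1) ;; bad_row_code ;;
         If (WLess 15 0)
           (pick_code ;; If (WLess 16 1) expand_code (Do (WCopy 10 11)))
           (Do (WSub 13 13 1) ;; Do (WStore 21 13))))"

text \<open>By \<open>lengths_ok\<close> an item has at most N + 1 statuses of \<open>n\<close>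
  words; two more words hold \<open>e\<close> and their total length.\<close>

locale sized_machine = machine m n A w c B S \<epsilon> for m n A w c B S \<epsilon> +
  fixes N :: nat
  assumes S_eq: "S = (N + 1) * n + 2" and n_pos: "0 < n"
begin

text \<open>
  The stack consists of slots of \<open>S\<close> words: \<open>e\<close>, the length of the statuses, then the statuses, the
  first one last so that factors are added and dropped at the end. The coefficient is the number
  stored at the address of the slot.
\<close>

fun statuses_at :: "regs \<Rightarrow> nat \<Rightarrow> status list \<Rightarrow> bool" where
  "statuses_at h a [] \<longleftrightarrow> True"
| "statuses_at h a (st # sts) \<longleftrightarrow> status_at h (a + length sts * n) st \<and> statuses_at h a sts"

definition item_at :: "regs \<Rightarrow> nregs \<Rightarrow> nat \<Rightarrow> item \<Rightarrow> bool" where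
  "item_at h g q = (\<lambda>(c, e, sts). g q = c \<and> h q = e \<and> h (q + 1) = length sts * n \<and> statuses_at h (q + 2) sts)"

abbreviation base :: nat where "base \<equiv> 33 + m"

fun stack_at :: "regs \<Rightarrow> nregs \<Rightarrow> item list \<Rightarrow> bool" where
  "stack_at h g [] \<longleftrightarrow> True"
| "stack_at h g (it # its) \<longleftrightarrow> item_at h g (base + length its * S) it \<and> stack_at h g its"

text \<open>The shift \<open>d\<close> is 0 for a slot that stays in place and \<open>S\<close> or
  \<open>2 * S\<close> for its two copies.\<close>

lemma statuses_at_shift:
  assumes "statuses_at h a sts" "\<And>b. a \<le> b \<Longrightarrow> b < a + length sts * n \<Longrightarrow> h' (b + d) = h b"
  shows "statuses_at h' (a + d) sts"
  using assms
proof (induction sts)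
  case (Cons st sts)
  have "h' (a + d + length sts * n + l) = st l" if "l < n" for l
  proof -
    have "h (a + length sts * n + l) = st l" using Cons.prems(1) that by (simp add: status_at_def)
    moreover have "h' (a + length sts * n + l + d) = h (a + length sts * n + l)"
      using that by (intro Cons.prems(2)) auto
    ultimately show ?thesis by (simp add: add_ac)
  qed
  then show ?case using Cons by (simp add: status_at_def)
qed simp

lemma statuses_fit: "length sts \<le> N + 1 \<Longrightarrow> length sts * n + 2 \<le> S"
  using mult_le_mono1[of "length sts" "N + 1" n] by (simp add: S_eq)

lemma stack_at_cong:
  assumes "stack_at h g its" "lengths_ok (N + 1) its"
    "\<And>b. base \<le> b \<Longrightarrow> b < base + length its * S \<Longrightarrow> h' b = h b \<and> g' b = g b"
  shows "stack_at h' g' its"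
  using assms
proof (induction its)
  case (Cons it its)
  obtain c e sts where it: "it = (c, e, sts)" by (cases it)
  let ?q = "base + length its * S"
  have fit: "length sts * n + 2 \<le> S"
    using Cons.prems(2) by (intro statuses_fit) (auto simp: lengths_ok_def it)
  have eq: "h' b = h b \<and> g' b = g b" if "?q \<le> b" "b < ?q + S" for b
    using Cons.prems(3)[of b] that by simp
  have "statuses_at h' (?q + 2 + 0) sts"
    by (rule statuses_at_shift[of h]) (use Cons.prems(1) fit eq in \<open>auto simp: it item_at_def\<close>)
  moreover have "g' ?q = g ?q" "h' ?q = h ?q" "h' (?q + 1) = h (?q + 1)"
    using eq[of ?q] eq[of "?q + 1"] fit by auto
  moreover have "stack_at h' g' its"
    using Cons.prems by (intro Cons.IH) (auto simp: lengths_ok_def)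
  ultimately show ?case using Cons.prems(1) by (simp add: it item_at_def)
qed simp

text \<open>The words that \<open>expand_code\<close> leaves: \<open>h1\<close> after copying,
  \<open>h2\<close> after the single edits, \<open>h3\<close> with the status of the new factor, in
  which column \<open>k\<close> is charged last.\<close>

definition expanded :: "regs \<Rightarrow> nat \<Rightarrow> nat \<Rightarrow> nat \<Rightarrow> nat \<Rightarrow> nat \<Rightarrow> regs" where
  "expanded h q a k e len =
    (let p = q + S; d = a + S + S + n;
         h1 = (\<lambda>b. if p \<le> b \<and> b < p + S then h (b - S) else if p + S \<le> b \<and> b < p + 2 * S then h (b - 2 * S) else h b);
         h2 = h1(a + k := 1, p := e, p + S := e, a + k + S := 2, p + S + 1 := len + n);
         h3 = (\<lambda>b. if d \<le> b \<and> b < d + n then (if h2 (a + (b - d)) = 0 then 0 else 1) else h2 b)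
     in h3(d + k := 2))"

lemma wp_copy_loop:
  assumes r: "r 2 = 1" "r 5 = S" "r 10 = q + S" "r 11 = q" "r 25 = q + S + S" "32 \<le> q" "q + 3 * S < B"
    and post: "\<And>r' t'. \<forall>b. b \<notin> {17, 22, 23} \<longrightarrow> r' b = r b \<Longrightarrow> t' \<le> t + 3 + S * 9 \<Longrightarrow>
      \<Phi> r' (\<lambda>b. if q + S \<le> b \<and> b < q + S + S then h (b - S) else if q + S + S \<le> b \<and> b < q + S + 2 * S then h (b - 2 * S) else h b) x g t'"
  shows "wp input c B (For 17 5 (Do (WAdd 22 11 17) ;; Do (WLoad 22 22) ;; Do (WAdd 23 10 17) ;; Do (WStore 23 22) ;;
       Do (WAdd 23 25 17) ;; Do (WStore 23 22))) \<Phi> r h x g t"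
proof -
  define H where "H = (\<lambda>u b. if q + S \<le> b \<and> b < q + S + u then h (b - S)
    else if q + S + S \<le> b \<and> b < q + S + S + u then h (b - 2 * S) else h b)"
  have H_Suc: "(H u)(q + S + u := h (q + u), q + S + S + u := h (q + u)) = H (Suc u)" if "u < S" for u
  proof
    fix b show "((H u)(q + S + u := h (q + u), q + S + S + u := h (q + u))) b = H (Suc u) b"
      using that by (auto simp: H_def less_Suc_eq)
  qed
  have H_at: "H u (q + u) = h (q + u)" if "u < S" for u using that by (simp add: H_def)
  have H_0: "H 0 = h" and H_S: "H S = (\<lambda>b. if q + S \<le> b \<and> b < q + S + S then h (b - S) else if q + S + S \<le> b \<and> b < q + S + 2 * S then h (b - 2 * S) else h b)"
    by (simp_all add: H_def fun_eq_iff add.assoc mult_2)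
  let ?I = "\<lambda>u r' h' x' g'. h' = H u \<and> g' = g \<and> x' = x \<and> (\<forall>b. b \<notin> {17, 22, 23} \<longrightarrow> r' b = r b)"
  show ?thesis
  proof (rule wp_For[where I = ?I and K = S and T = 6])
    fix u r' h' x' g' t'
    assume "u < S" "?I u r' h' x' g'" "r' 17 = u" "r' 5 = S" "r' 2 = 1"
    then show "wp input c B (Do (WAdd 22 11 17) ;; Do (WLoad 22 22) ;; Do (WAdd 23 10 17) ;; Do (WStore 23 22) ;;
       Do (WAdd 23 25 17) ;; Do (WStore 23 22))
       (\<lambda>r'' h'' x'' g'' t''. t'' \<le> t' + 6 \<and> r'' 17 = u \<and> r'' 5 = S \<and> r'' 2 = 1 \<and> ?I (Suc u) (r''(17 := Suc u)) h'' x'' g'') r' h' x' g' t'"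
      using r by (auto simp: wp_simps H_at H_Suc)
  next
    fix r' h' x' g' t'
    assume "?I S r' h' x' g'" "t' \<le> t + 3 + S * (6 + 3)"
    then show "\<Phi> r' h' x' g' t'" using post[of r' t'] by (simp add: H_S)
  qed (use r in \<open>auto simp: H_0\<close>)
qed

lemma wp_fresh_loop:
  assumes r: "r 1 = n" "r 2 = 1" "r 14 = a" "r 27 = d" "32 \<le> a" "a + n \<le> d" "d + n < B"
    and post: "\<And>r' t'. \<forall>b. b \<notin> {17, 22, 23} \<longrightarrow> r' b = r b \<Longrightarrow> t' \<le> t + 3 + n * 9 \<Longrightarrow>
      \<Phi> r' (\<lambda>b. if d \<le> b \<and> b < d + n then (if h (a + (b - d)) = 0 then 0 else 1) else h b) x g t'"
  shows "wp input c B (For 17 1 (Do (WAdd 22 14 17) ;; Do (WLoad 22 22) ;; Do (WSub 22 2 22) ;; Do (WSub 22 2 22) ;;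
       Do (WAdd 23 27 17) ;; Do (WStore 23 22))) \<Phi> r h x g t"
proof -
  define H where "H = (\<lambda>u b. if d \<le> b \<and> b < d + u then (if h (a + (b - d)) = 0 then 0 else 1) else h b)"
  have H_Suc: "(H u)(d + u := 1 - (1 - h (a + u))) = H (Suc u)" for u
  proof
    fix b show "((H u)(d + u := 1 - (1 - h (a + u)))) b = H (Suc u) b"
      by (auto simp: H_def less_Suc_eq)
  qed
  have H_at: "H u (a + u) = h (a + u)" if "u < n" for u using that r by (simp add: H_def)
  have H_0: "H 0 = h" by (simp add: H_def fun_eq_iff)
  let ?I = "\<lambda>u r' h' x' g'. h' = H u \<and> g' = g \<and> x' = x \<and> (\<forall>b. b \<notin> {17, 22, 23} \<longrightarrow> r' b = r b)"
  show ?thesis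
  proof (rule wp_For[where I = ?I and K = n and T = 6])
    fix u r' h' x' g' t'
    assume "u < n" "?I u r' h' x' g'" "r' 17 = u" "r' 1 = n" "r' 2 = 1"
    then show "wp input c B (Do (WAdd 22 14 17) ;; Do (WLoad 22 22) ;; Do (WSub 22 2 22) ;; Do (WSub 22 2 22) ;;
       Do (WAdd 23 27 17) ;; Do (WStore 23 22))
       (\<lambda>r'' h'' x'' g'' t''. t'' \<le> t' + 6 \<and> r'' 17 = u \<and> r'' 1 = n \<and> r'' 2 = 1 \<and> ?I (Suc u) (r''(17 := Suc u)) h'' x'' g'') r' h' x' g' t'"
      using r by (auto simp: wp_simps H_at H_Suc)
  next
    fix r' h' x' g' t'
    assume "?I n r' h' x' g'" "t' \<le> t + 3 + n * (6 + 3)"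
    then show "\<Phi> r' h' x' g' t'" using post[of r' t'] by (simp add: H_def)
  qed (use r in \<open>auto simp: H_0\<close>)
qed

lemma wp_expand_code:
  assumes r: "r 1 = n" "r 2 = 1" "r 5 = S" "r 10 = q + S" "r 11 = q" "r 12 = Suc e" "r 13 = len" "r 14 = a" "r 16 = k"
    and "32 \<le> q" "q + 3 * S < B" "q + 2 \<le> a" "a + 2 * n \<le> q + S" "k < n" "len + n < B" "2 < B"
    and post: "\<And>r' x' t'. \<forall>b. b \<notin> {10, 12, 13, 17, 22, 23, 25, 26, 27} \<longrightarrow> r' b = r b \<Longrightarrow>
      \<forall>b. b \<notin> {5, 6} \<longrightarrow> x' b = x b \<Longrightarrow> r' 10 = q + 3 * S \<Longrightarrow> t' \<le> t + 40 + S * 9 + n * 9 \<Longrightarrow>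
      \<Phi> r' (expanded h q a k e len) x' (g(q + S := x 4 * w k, q + S + S := - (x 4 * w k))) t'"
  shows "wp input c B expand_code \<Phi> r h x g t"
proof -
  define h1 where "h1 = (\<lambda>b. if q + S \<le> b \<and> b < q + S + S then h (b - S)
    else if q + S + S \<le> b \<and> b < q + S + 2 * S then h (b - 2 * S) else h b)"
  define h2 where "h2 = h1(a + k := 1, q + S := e, q + S + S := e, a + k + S := 2, q + S + S + 1 := len + n)"
  define d where "d = a + S + S + n"
  define h3 where "h3 = (\<lambda>b. if d \<le> b \<and> b < d + n then (if h2 (a + (b - d)) = 0 then 0 else 1) else h2 b)"
  have final: "h3(d + k := 2) = expanded h q a k e len"
    by (simp only: expanded_def Let_def h3_def h2_def h1_def d_def)
  have kB: "k < B" using assms(10-16) by linarith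
  show ?thesis unfolding expand_code_def wp_Seq_iff[of _ _ _ "Do (WAdd 25 10 5)"] wp_Do_iff
    using r assms(10-16)
  proof (simp, intro wp_Seq wp_copy_loop[where q = q], goal_cases)
    case (8 r1 t1)
    show ?case unfolding h1_def[symmetric] wp_simps using 8 r
    proof (simp add: h2_def[symmetric], intro wp_fresh_loop[where a = a and d = d], goal_cases)
      case (8 r2 t2)
      then show ?case unfolding h3_def[symmetric] wp_simps using final
        by (simp add: d_def) (rule post; auto)
    qed (auto simp: d_def)
  qed auto
qed


lemma expanded_at:
  assumes "q + 2 \<le> a" "a + 2 * n \<le> q + S" "k < n"
  shows "b < q + S \<Longrightarrow> expanded h q a k e len b = (if b = a + k then 1 else h b)"
    "q \<le> b \<Longrightarrow> b < q + S \<Longrightarrow> expanded h q a k e len (b + S) = (if b = q then e else if b = a + k then 2 else h b)"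
    "q \<le> b \<Longrightarrow> b < a + n \<Longrightarrow> expanded h q a k e len (b + 2 * S) = (if b = q then e else if b = q + 1 then len + n else h b)"
    "l < n \<Longrightarrow> expanded h q a k e len (a + 2 * S + n + l) = fresh (\<lambda>l. h (a + l)) k l"
  using assms by (auto simp: expanded_def Let_def fresh_def)

lemma expanded_items:
  assumes item: "item_at h g q (c1, Suc e, st # sts)" and a: "a = q + 2 + length sts * n" and k: "k < n"
    and fit: "(length sts + 2) * n + 2 \<le> S" and len: "len = length (st # sts) * n"
    and g': "g' q = g q" "g' (q + S) = c2" "g' (q + 2 * S) = c3"
  shows "item_at (expanded h q a k e len) g' q (c1, Suc e, st(k := 1) # sts)"
    "item_at (expanded h q a k e len) g' (q + S) (c2, e, st(k := 2) # sts)"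
    "item_at (expanded h q a k e len) g' (q + 2 * S) (c3, e, fresh st k # st # sts)"
proof -
  define L where "L = length sts * n"
  have fit': "L + 2 * n + 2 \<le> S" using fit by (simp add: L_def algebra_simps)
  have a': "a = q + 2 + L" using a by (simp add: L_def)
  have bounds: "q + 2 \<le> a" "a + 2 * n \<le> q + S" using fit' a' by auto
  note at = expanded_at[OF bounds k, where h = h and e = e and len = len]
  have st: "h (a + l) = st l" if "l < n" for l
    using item that by (simp add: item_at_def status_at_def a)
  have head: "g q = c1" "h q = Suc e" "h (q + 1) = n + L" and sts: "statuses_at h (q + 2) sts"
    using item by (simp_all add: item_at_def L_def)
  have S: "2 \<le> S" "L + 2 \<le> S" using fit' by auto
  let ?h = "expanded h q a k e len"
  have sts1: "statuses_at ?h (q + 2 + 0) sts"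
    by (rule statuses_at_shift[OF sts]) (use at(1) fit' a' L_def in auto)
  have sts2: "statuses_at ?h (q + 2 + S) sts"
    by (rule statuses_at_shift[OF sts]) (use at(2) fit' a' L_def in auto)
  have sts3: "statuses_at ?h (q + 2 + 2 * S) sts"
    by (rule statuses_at_shift[OF sts]) (use at(3) fit' a' L_def in auto)
  show "item_at ?h g' q (c1, Suc e, st(k := 1) # sts)"
    using at(1)[of q] at(1)[of "q + 1"] at(1)[of "a + l" for l] st head sts1 fit' a' bounds k g'
    by (auto simp: item_at_def status_at_def simp flip: L_def)
  have "status_at ?h (a + S) (st(k := 2))"
    unfolding status_at_def
  proof (intro allI impI)
    fix l assume l: "l < n"
    then show "?h (a + S + l) = (st(k := 2)) l"
      using at(2)[of "a + l"] st[OF l] bounds by (simp add: add_ac)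
  qed
  then show "item_at ?h g' (q + S) (c2, e, st(k := 2) # sts)"
    using at(2)[of q] at(2)[of "q + 1"] head sts2 S a' g'
    by (simp add: item_at_def add_ac flip: L_def)
  have "status_at ?h (a + 2 * S) st"
    unfolding status_at_def
  proof (intro allI impI)
    fix l assume l: "l < n"
    then show "?h (a + 2 * S + l) = st l"
      using at(3)[of "a + l"] st[OF l] bounds by (simp add: add_ac)
  qed
  moreover have "status_at ?h (a + 2 * S + n) (fresh st k)"
    unfolding status_at_def using at(4) st by (simp add: fresh_def)
  ultimately show "item_at ?h g' (q + 2 * S) (c3, e, fresh st k # st # sts)"
    using at(3)[of q] at(3)[of "q + 1"] head sts3 S a' g' len bounds
    by (simp add: item_at_def add_ac flip: L_def)
qed


definition step_time :: nat where
  "step_time = n * (12 + c * (15 + 10 * n)) + S * 9 + n * 19 + 70"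

text \<open>Simulation of \<open>advance\<close> on the stored stack. An expansion replaces the top
  slot by three, hence the demand for room for two further slots.\<close>

lemma wp_step_code:
  assumes r: "r 0 = m" "r 1 = n" "r 2 = 1" "r 5 = S" "r 7 = 32" "r 10 = base + length its * S"
    and "its \<noteq> []" and stack: "stack_at h g its" and len: "lengths_ok (N + 1) its"
    and space: "base + (length its + 2) * S < B"
    and post: "\<And>r' h' x' g' t'. \<forall>b<10. r' b = r b \<Longrightarrow> \<forall>b\<ge>7. x' b = x b \<Longrightarrow>
      (x' 0, its') = advance (x 0, its) \<Longrightarrow> r' 10 = base + length its' * S \<Longrightarrow> stack_at h' g' its' \<Longrightarrow>
      t' \<le> t + step_time \<Longrightarrow> \<Phi> r' h' x' g' t'"
    and its': "its' = snd (advance (x 0, its))"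
  shows "wp input c B step_code \<Phi> r h x g t"
proof -
  obtain c0 e sts rest where its: "its = (c0, e, sts) # rest"
    using assms(7) by (cases its) auto
  define q where "q = base + length rest * S"
  define p where "p = q + S"
  have p: "r 10 = p" "p = q + S" using r(6) by (simp_all add: its q_def p_def)
  have top: "item_at h g q (c0, e, sts)" and rest: "stack_at h g rest"
    using stack by (simp_all add: its q_def)
  have lens: "e + length sts \<le> N + 1" "lengths_ok (N + 1) rest"
    using len by (auto simp: its lengths_ok_def)
  have qB: "q + 3 * S < B" using space by (simp add: its q_def add_mult_distrib)
  have q: "base \<le> q" by (simp add: q_def)
  have S2: "2 \<le> S" "n + 2 \<le> S" by (simp_all add: S_eq)
  have head: "g q = c0" "h q = e" "h (q + 1) = length sts * n" "statuses_at h (q + 2) sts"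
    using top by (simp_all add: item_at_def)
  have rest_cong: "stack_at h' g' rest" if "\<And>b. base \<le> b \<Longrightarrow> b < q \<Longrightarrow> h' b = h b \<and> g' b = g b" for h' g'
    using rest lens(2) that by (rule stack_at_cong) (auto simp: q_def)
  show ?thesis
  proof (cases "e = 0")
    case True
    then have its'_eq: "its' = rest" "advance (x 0, its) = (x 0, rest)" using its' by (simp_all add: its)
    show ?thesis unfolding step_code_def
      using r(1-5) p qB S2 q head True
      by (simp add: wp_simps, intro post) (auto simp: its'_eq rest q_def step_time_def)
  next
    case False
    then obtain e' where e: "e = Suc e'" by (cases e) auto
    show ?thesis
    proof (cases sts)
      case Nil
      then have its'_eq: "its' = rest" "advance (x 0, its) = (x 0 + c0, rest)" using its' by (simp_all add: its e)
      show ?thesis unfolding step_code_def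
        using r(1-5) p qB S2 q head Nil e
        by (simp add: wp_simps, intro post) (auto simp: its'_eq rest q_def step_time_def)
    next
      case (Cons st sts')
      define L where "L = length sts' * n"
      define a where "a = q + 2 + L"
      have fit: "L + n + 2 \<le> S"
        using statuses_fit[of sts] lens(1) Cons by (simp add: L_def)
      have at: "status_at h a st" using head(4) Cons by (simp add: a_def L_def)
      have lenL: "h (q + 1) = n + L" using head(3) Cons by (simp add: L_def)
      have aB: "33 + m \<le> a" "a + n < B" "32 \<le> a" using q fit qB by (auto simp: a_def)
      let ?rest = "If (WLess 15 0)
           (pick_code ;; If (WLess 16 1) expand_code (Do (WCopy 10 11)))
           (Do (WSub 13 13 1) ;; Do (WStore 21 13))"
      \<comment> \<open>The code behind the search for the bad row comes first, since the rule for
        \<open>bad_row_code\<close> takes it as its postcondition.\<close>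
      have after: "wp input c B ?rest \<Phi> r1 h1 x1 g t1"
        if r1: "\<forall>b<10. r1 b = r b" "r1 10 = p" "r1 11 = q" "r1 12 = Suc e'" "r1 13 = n + L" "r1 14 = a" "r1 21 = q + 1"
          and r15: "r1 15 = bad_row st"
          and h1: "\<forall>b\<ge>base. h1 b = h b" and x1: "x1 4 = c0" "\<forall>b. b \<notin> {2, 3, 4} \<longrightarrow> x1 b = x b"
          and t1: "t1 \<le> t + 20 + n * (12 + c * (15 + 10 * n))"
        for r1 h1 x1 t1
      proof (cases "bad_row st = m")
        case True
        then have its'_eq: "its' = (c0, Suc e', sts') # rest" "advance (x 0, its) = (x 0, (c0, Suc e', sts') # rest)"
          using its' by (simp_all add: its e Cons)
        have "statuses_at (h1(q + 1 := L)) (q + 2 + 0) sts'"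
          by (rule statuses_at_shift[of h]) (use head(4) Cons h1 q in auto)
        then have new: "stack_at (h1(q + 1 := L)) g its'"
          using head h1 q rest_cong[of "h1(q + 1 := L)" g] e
          by (auto simp: its'_eq item_at_def q_def[symmetric] L_def)
        have p': "p = base + length its' * S" by (simp add: its'_eq p_def q_def)
        show ?thesis using r(1-5) r1 True r15 q
          by (simp add: wp_simps, intro post) (use new x1 t1 p' in \<open>auto simp: its'_eq step_time_def\<close>)
      next
        case False
        have bad: "bad_row st < m" using bad_row_less[OF False] by simp
        have at1: "status_at h1 a st" using at h1 aB by (simp add: status_at_def)
        have "wp input c B pick_code (wp input c B (If (WLess 16 1) expand_code (Do (WCopy 10 11))) \<Phi>) r1 h1 x1 g (Suc t1)"
        proof (rule wp_pick_code[where a = a and i = "bad_row st" and st = st], goal_cases)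
          case (9 r2 x2 t2)
          let ?k = "pick st (bad_row st) n"
          have r2: "\<forall>b<10. r2 b = r b" "r2 10 = p" "r2 11 = q" "r2 12 = Suc e'" "r2 13 = n + L" "r2 14 = a" "r2 16 = ?k"
            using 9(1,3) r1 by auto
          have x2: "x2 4 = c0" "\<forall>b. b \<notin> {2, 3, 4} \<longrightarrow> x2 b = x b" using 9(2) x1 by auto
          show ?case
          proof (cases "?k = n")
            case True
            then have its'_eq: "its' = rest" "advance (x 0, its) = (x 0, rest)"
              using its' False by (simp_all add: its e Cons Let_def)
            have "stack_at h1 g rest" using rest_cong[of h1 g] h1 by simp
            then show ?thesis using r(1-5) r2 True
              by (simp add: wp_simps, intro post) (use x2 t1 9(4) in \<open>auto simp: its'_eq q_def step_time_def\<close>)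
          next
            case k: False
            then have kn: "?k < n" using pick_cases[of st "bad_row st" n] by auto
            have its'_eq: "its' = (- (c0 * w ?k), e', fresh st ?k # st # sts') # (c0 * w ?k, e', st(?k := 2) # sts')
                  # (c0, Suc e', st(?k := 1) # sts') # rest"
              and adv: "advance (x 0, its) = (x 0, its')"
              using its' False k by (simp_all add: its e Cons Let_def)
            have fit2: "(length sts' + 2) * n + 2 \<le> S"
            proof -
              have "length sts' + 2 \<le> N + 1" using lens(1) by (simp add: e Cons)
              then show ?thesis using mult_le_mono1[of "length sts' + 2" "N + 1" n] by (simp add: S_eq)
            qed
            then have fit3: "L + 2 * n + 2 \<le> S" by (simp add: L_def algebra_simps)
            have top1: "item_at h1 g q (c0, Suc e', st # sts')"
            proof -
              have "statuses_at h1 (q + 2 + 0) (st # sts')"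
                by (rule statuses_at_shift[of h]) (use head(4) Cons h1 q in auto)
              then show ?thesis using head h1 q e Cons by (simp add: item_at_def)
            qed
            have "wp input c B expand_code \<Phi> r2 h1 x2 g (Suc t2)"
            proof (rule wp_expand_code[where q = q and e = e' and len = "n + L" and a = a and k = ?k], goal_cases)
              case (17 r3 x3 t3)
              let ?h = "expanded h1 q a ?k e' (n + L)"
              let ?g = "g(q + S := x2 4 * w ?k, q + S + S := - (x2 4 * w ?k))"
              have at: "a = q + 2 + length sts' * n" "n + L = length (st # sts') * n" by (simp_all add: a_def L_def)
              have g: "?g q = g q" "?g (q + S) = c0 * w ?k" "?g (q + 2 * S) = - (c0 * w ?k)"
                using S2 x2(1) by auto
              note items = expanded_items[OF top1 at(1) kn fit2 at(2) g]
              have "q + 2 \<le> a" "a + 2 * n \<le> q + S" using fit3 by (auto simp: a_def)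
              from expanded_at(1)[OF this kn, of _ h1 e' "n + L"]
              have same: "?h b = h b" if "base \<le> b" "b < q" for b
                using that h1 by (auto simp: a_def)
              have "stack_at ?h ?g rest" by (rule rest_cong) (use same in auto)
              then have new: "stack_at ?h ?g its'"
              proof -
                have "base + length (i1 # rest) * S = q + S" "base + length (i2 # i1 # rest) * S = q + 2 * S" for i1 i2 :: item
                  by (simp_all add: q_def)
                then show ?thesis
                  using items \<open>stack_at ?h ?g rest\<close> unfolding its'_eq stack_at.simps q_def[symmetric] by (simp only: simp_thms)
              qed
              have "r3 10 = base + length its' * S" using 17(3) by (simp add: its'_eq q_def algebra_simps)
              moreover have "t3 \<le> t + step_time" using 17(4) 9(4) t1 by (simp add: step_time_def)
              moreover have "\<forall>b<10. r3 b = r b" using 17(1) r2 by auto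
              moreover have "\<forall>b\<ge>7. x3 b = x b" "x3 0 = x 0" using 17(2) x2 by auto
              ultimately show ?case by (intro post new) (simp_all add: adv)
            qed (use r r2 qB q fit3 kn p in \<open>auto simp: a_def\<close>)
            then show ?thesis using r(1-5) r2 kn by (simp add: wp_simps)
          qed
        qed (use r r1 r15 aB bad at1 in auto)
        then show ?thesis using r(1-5) r1 r15 bad by (simp add: wp_simps)
      qed
      let ?\<Psi> = "wp input c B ?rest \<Phi>"
      have bad_code: "wp input c B bad_row_code ?\<Psi> r0 h x0 g t0"
        if r0: "\<forall>b<10. r0 b = r b" "r0 10 = p" "r0 11 = q" "r0 12 = Suc e'" "r0 13 = n + L" "r0 14 = a" "r0 21 = q + 1"
          and x0: "x0 4 = c0" "\<forall>b. b \<noteq> 4 \<longrightarrow> x0 b = x b" and t0: "t0 \<le> t + 16" for r0 x0 t0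
      proof (rule wp_bad_row_code[where a = a and st = st], goal_cases)
        case (9 r1 h1 x1 t1)
        show ?case by (rule after) (use 9 r0 x0 t0 in auto)
      qed (use r r0 aB at in auto)
      show ?thesis unfolding step_code_def
        using r(1-5) p qB S2 q head e Cons lenL fit n_pos
        by (simp add: wp_simps, intro bad_code) (auto simp: a_def)
    qed
  qed
qed

end

text \<open>All copies of the initial status form one block, so the position modulo \<open>n\<close>
  is the column.\<close>

definition fill_code :: com where
  "fill_code = For 17 13
     (Do (WMod 22 17 1) ;;
      If (WLess 22 8) (Do (WConst 23 0)) (If (WLess 8 22) (Do (WConst 23 1)) (Do (WConst 23 2))) ;;
      Do (WAdd 24 21 17) ;; Do (WStore 24 23))"

definition item_code :: com where
  "item_code =
     Do (NMult 7 7 8) ;; Do (WAdd 12 9 2) ;; Do (NOfWord 9 12) ;; Do (NDiv 9 7 9) ;; Do (NStore 6 9) ;;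
     Do (WSub 20 4 9) ;; Do (WStore 6 20) ;;
     Do (WMult 13 12 1) ;; Do (WAdd 21 6 2) ;; Do (WStore 21 13) ;; Do (WAdd 21 21 2) ;;
     fill_code ;; Do (WAdd 10 6 5) ;; While (WLess 6 10) step_code"

definition main_code :: com where
  "main_code = For 8 1
     (Do (NConst 7 (- 1)) ;; Do (GetWeight 8 8) ;; Do (NConst 9 0) ;; Do (NSub 8 9 8) ;; For 9 4 item_code)"

text \<open>\<open>N\<close> is obtained as a word by counting how often n H is multiplied by (H -
  1) / H until it is at most the error. \<open>H\<close> is the only trace of the parameter \<beta>
  in the program.\<close>

definition setup_code :: "nat \<Rightarrow> com" where
  "setup_code H =
     Do (WConst 2 1) ;; Do (WConst 7 32) ;; Do (WAdd 6 7 0) ;; Do (WAdd 6 6 2) ;;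
     Do (NOfWord 1 1) ;; Do (NConst 2 (int H)) ;; Do (NMult 1 1 2) ;; Do (NConst 3 (int H - 1)) ;; Do (NDiv 3 3 2) ;;
     Do (WConst 4 0) ;; While (NLess 0 1) (Do (NMult 1 1 3) ;; Do (WAdd 4 4 2)) ;;
     Do (NConst 0 0) ;; Do (WMult 5 1 4) ;; Do (WAdd 5 5 1) ;; Do (WAdd 5 5 2) ;; Do (WAdd 5 5 2)"

definition program :: "nat \<Rightarrow> com" where
  "program H = setup_code H ;; main_code"

text \<open>With M = 2 (N + 1) (R + 2), \<open>height_ok\<close> allows at most M + 1 slots; an
  expansion needs two more, and one makes the inequality strict.\<close>

locale program_run = sized_machine m n A w c B S \<epsilon> N for m n A w c B S \<epsilon> N +
  fixes R PB :: nat
  assumes row_le: "i < m \<Longrightarrow> card {l. l < n \<and> A i l \<noteq> 0} \<le> R"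
    and space: "base + (2 * (N + 1) * (R + 2) + 4) * S \<le> B"
    and potential_le: "j < n \<Longrightarrow> k < N \<Longrightarrow> potential R [initial_item N j k] \<le> PB"
begin

lemma space': "base + 4 * S \<le> B"
  using space mult_le_mono1[of 4 "2 * (N + 1) * (R + 2) + 4" S] by linarith

lemma N_le_S: "N + 2 \<le> S"
proof -
  have "1 \<le> n" using n_pos by linarith
  from mult_le_mono2[OF this, of "N + 1"] have "N + 1 \<le> (N + 1) * n" by (simp only: mult_1_right)
  then show ?thesis unfolding S_eq by linarith
qed

text \<open>\<open>potential\<close> is the measure of the loop. Accumulator plus values on the
  stack is invariant, so the accumulator holds the whole sum once the stack is empty.\<close>

lemma wp_stack_loop:
  assumes r: "r 0 = m" "r 1 = n" "r 2 = 1" "r 5 = S" "r 6 = base" "r 7 = 32" "r 10 = base + length its * S"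
    and stack: "stack_at h g its" "lengths_ok (N + 1) its" "height_ok R (2 * (N + 1) * (R + 2)) its"
    and post: "\<And>r' h' x' g' t'. \<forall>b<10. r' b = r b \<Longrightarrow> \<forall>b\<ge>7. x' b = x b \<Longrightarrow>
      x' 0 = x 0 + (\<Sum>it\<leftarrow>its. item_value it) \<Longrightarrow> t' \<le> t + 2 + potential R its * (step_time + 2) \<Longrightarrow> \<Phi> r' h' x' g' t'"
  shows "wp input c B (While (WLess 6 10) step_code) \<Phi> r h x g t"
proof -
  let ?M = "2 * (N + 1) * (R + 2)"
  define v where "v = x 0 + (\<Sum>it\<leftarrow>its. item_value it)"
  define T where "T = t + potential R its * (step_time + 2)"
  let ?I = "\<lambda>k r' h' x' g' t'. \<exists>its'. (\<forall>b<10. r' b = r b) \<and> (\<forall>b\<ge>7. x' b = x b) \<and> r' 10 = base + length its' * S \<and>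
     stack_at h' g' its' \<and> lengths_ok (N + 1) its' \<and> height_ok R ?M its' \<and> k = potential R its' \<and>
     x' 0 + (\<Sum>it\<leftarrow>its'. item_value it) = v \<and> t' + k * (step_time + 2) \<le> T"
  have S: "0 < S" by (simp add: S_eq)
  show ?thesis
  proof (rule wp_While[where I = ?I and k = "potential R its"])
    show "?I (potential R its) r h x g t"
      using r stack by (intro exI[of _ its]) (simp add: v_def T_def)
  next
    fix k r1 h1 x1 g1 t1
    assume "?I k r1 h1 x1 g1 t1" and test: "holds (WLess 6 10) r1 x1"
    then obtain its1 where I: "\<forall>b<10. r1 b = r b" "\<forall>b\<ge>7. x1 b = x b" "r1 10 = base + length its1 * S"
      "stack_at h1 g1 its1" "lengths_ok (N + 1) its1" "height_ok R ?M its1" "k = potential R its1"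
      "x1 0 + (\<Sum>it\<leftarrow>its1. item_value it) = v" "t1 + k * (step_time + 2) \<le> T" by blast
    have ne: "its1 \<noteq> []" using test I r by auto
    then obtain it rest where "its1 = it # rest" by (cases its1) auto
    then have "length its1 \<le> ?M + 1" using I(6) by simp
    then have "(length its1 + 2) * S \<le> (?M + 3) * S" by (intro mult_le_mono1) simp
    then have sp: "base + (length its1 + 2) * S < B"
      using space S by (simp add: add_mult_distrib)
    define its2 where "its2 = snd (advance (x1 0, its1))"
    show "wp input c B step_code (\<lambda>r h x g t. \<exists>k'<k. ?I k' r h x g (Suc t)) r1 h1 x1 g1 (Suc t1)"
    proof (rule wp_step_code[where its = its1 and its' = its2], goal_cases)
      case (11 r2 h2 x2 g2 t2)
      have adv: "fst (advance (x1 0, its1)) = x2 0" "snd (advance (x1 0, its1)) = its2"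
        using 11(3) by (metis fst_conv, simp add: its2_def)
      note inv = advance_invariants[OF row_le ne, where acc = "x1 0", unfolded adv]
      have "potential R its2 < k" using inv(1) I(7) by simp
      moreover have "t2 + 1 + potential R its2 * (step_time + 2) \<le> T"
      proof -
        have "(potential R its2 + 1) * (step_time + 2) \<le> k * (step_time + 2)"
          using \<open>potential R its2 < k\<close> by (intro mult_le_mono1) simp
        then show ?thesis using 11(6) I(9) by (simp add: algebra_simps)
      qed
      moreover have "x2 0 + (\<Sum>it\<leftarrow>its2. item_value it) = v"
        using advance_value[of "(x1 0, its1)"] adv I(8) by simp
      ultimately show ?case
        using 11 I inv by (intro exI[of _ "potential R its2"] conjI exI[of _ its2]) simp_all
    qed (use I r ne sp its2_def in auto)
  next
    fix k r1 h1 x1 g1 t1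
    assume "?I k r1 h1 x1 g1 t1" and test: "\<not> holds (WLess 6 10) r1 x1"
    then obtain its1 where I: "\<forall>b<10. r1 b = r b" "\<forall>b\<ge>7. x1 b = x b" "r1 10 = base + length its1 * S"
      "x1 0 + (\<Sum>it\<leftarrow>its1. item_value it) = v" "t1 + k * (step_time + 2) \<le> T" by blast
    then have "its1 = []" using test S r by auto
    then show "\<Phi> r1 h1 x1 g1 (t1 + 2)"
      using I by (intro post) (auto simp: v_def T_def)
  qed simp
qed

lemma wp_fill_code:
  assumes r: "r 1 = n" "r 2 = 1" "r 8 = j" "r 13 = K" "r 21 = a" "32 \<le> a" "a + K < B"
    and post: "\<And>r' t'. \<forall>b. b \<notin> {17, 22, 23, 24} \<longrightarrow> r' b = r b \<Longrightarrow> t' \<le> t + 3 + K * 11 \<Longrightarrow>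
      \<Phi> r' (\<lambda>b. if a \<le> b \<and> b < a + K then initial_status j ((b - a) mod n) else h b) x g t'"
  shows "wp input c B fill_code \<Phi> r h x g t"
proof -
  define H where "H = (\<lambda>u b. if a \<le> b \<and> b < a + u then initial_status j ((b - a) mod n) else h b)"
  have H_Suc: "(H u)(a + u := initial_status j (u mod n)) = H (Suc u)" for u
  proof
    fix b show "((H u)(a + u := initial_status j (u mod n))) b = H (Suc u) b"
      by (auto simp: H_def less_Suc_eq)
  qed
  have H_0: "H 0 = h" by (simp add: H_def fun_eq_iff)
  have B: "2 < B" using r by linarith
  let ?I = "\<lambda>u r' h' x' g'. h' = H u \<and> g' = g \<and> x' = x \<and> (\<forall>b. b \<notin> {17, 22, 23, 24} \<longrightarrow> r' b = r b)"
  show ?thesis unfolding fill_code_def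
  proof (rule wp_For[where I = ?I and K = K and T = 8])
    fix u r' h' x' g' t'
    assume "u < K" "?I u r' h' x' g'" "r' 17 = u" "r' 13 = K" "r' 2 = 1"
    then show "wp input c B (Do (WMod 22 17 1) ;;
      If (WLess 22 8) (Do (WConst 23 0)) (If (WLess 8 22) (Do (WConst 23 1)) (Do (WConst 23 2))) ;;
      Do (WAdd 24 21 17) ;; Do (WStore 24 23))
       (\<lambda>r'' h'' x'' g'' t''. t'' \<le> t' + 8 \<and> r'' 17 = u \<and> r'' 13 = K \<and> r'' 2 = 1 \<and> ?I (Suc u) (r''(17 := Suc u)) h'' x'' g'') r' h' x' g' t'"
      using r B H_Suc[of u] by (auto simp: wp_simps initial_status_def)
  next
    fix r' h' x' g' t'
    assume "?I K r' h' x' g'" "t' \<le> t + 3 + K * (8 + 3)"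
    then show "\<Phi> r' h' x' g' t'" using post[of r' t'] by (simp add: H_def)
  qed (use r in \<open>auto simp: H_0\<close>)
qed

lemma statuses_at_replicate:
  assumes "\<And>i l. i < k \<Longrightarrow> l < n \<Longrightarrow> h (a + (i * n + l)) = st l"
  shows "statuses_at h a (replicate k st)"
  using assms by (induction k) (auto simp: status_at_def add.assoc)

definition item_time :: nat where
  "item_time = 20 + N * n * 11 + PB * (step_time + 2)"

lemma wp_item_code:
  assumes r: "r 0 = m" "r 1 = n" "r 2 = 1" "r 4 = N" "r 5 = S" "r 6 = base" "r 7 = 32" "r 8 = j" "r 9 = k"
    and "j < n" "k < N" and x: "x 7 = - ((- w j) ^ k)" "x 8 = - w j"
    and post: "\<And>r' h' x' g' t'. \<forall>b<10. r' b = r b \<Longrightarrow> x' 7 = - ((- w j) ^ Suc k) \<Longrightarrow> x' 8 = - w j \<Longrightarrow>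
      x' 0 = x 0 + item_value (initial_item N j k) \<Longrightarrow> t' \<le> t + item_time \<Longrightarrow> \<Phi> r' h' x' g' t'"
  shows "wp input c B item_code \<Phi> r h x g t"
proof -
  let ?K = "(k + 1) * n"
  have K: "?K + 2 \<le> S" "?K \<le> N * n"
    using mult_le_mono1[of "k + 1" "N + 1" n] mult_le_mono1[of "k + 1" N n] assms(11) by (simp_all add: S_eq)
  note NS = N_le_S
  have run_stack: "wp input c B (While (WLess 6 10) step_code) \<Phi> r1 h1 x1 g1 t1"
    if r1: "\<forall>b<10. r1 b = r b" "r1 10 = base + S" and t1: "t1 \<le> t + 15 + N * n * 11"
      and h1: "h1 base = N - k" "h1 (base + 1) = ?K"
        "\<And>b. base + 2 \<le> b \<Longrightarrow> b < base + 2 + ?K \<Longrightarrow> h1 b = initial_status j ((b - (base + 2)) mod n)"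
      and x1: "x1 7 = x 7 * x 8" "x1 8 = x 8" "x1 0 = x 0" and g1: "g1 base = x 7 * x 8 / of_nat (Suc k)"
    for r1 h1 x1 g1 t1
  proof (rule wp_stack_loop[where its = "[initial_item N j k]"], goal_cases)
    case 8
    have "statuses_at h1 (base + 2) (replicate (Suc k) (initial_status j))"
    proof (rule statuses_at_replicate)
      fix i l assume "i < Suc k" "l < n"
      have "i * n + l < Suc i * n" using \<open>l < n\<close> by simp
      also have "Suc i * n \<le> ?K" using \<open>i < Suc k\<close> by (intro mult_le_mono1) simp
      finally have lt: "i * n + l < ?K" .
      have "h1 (base + 2 + (i * n + l)) = initial_status j ((base + 2 + (i * n + l) - (base + 2)) mod n)"
        using lt by (intro h1(3)) linarith+
      then show "h1 (base + 2 + (i * n + l)) = initial_status j l"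
        using \<open>l < n\<close> by simp
    qed
    moreover have "x 7 * x 8 = - ((- w j) ^ Suc k)" using x by simp
    ultimately show ?case using h1(1,2) by (simp add: item_at_def initial_item_def g1 del: replicate_Suc)
  next
    case (11 r2 h2 x2 g2 t2)
    have "potential R [initial_item N j k] * (step_time + 2) \<le> PB * (step_time + 2)"
      using potential_le[OF assms(10,11)] by (rule mult_le_mono1)
    then have "t2 \<le> t + item_time" using 11(4) t1 unfolding item_time_def by linarith
    then show ?case using 11 r1 x x1 by (intro post) auto
  qed (use r r1 initial_invariants[OF row_le assms(11), of j, unfolded Suc_eq_plus1] in auto)
  show ?thesis unfolding item_code_def
    using r assms(10,11) K NS space'
  proof (simp add: wp_simps, intro conjI wp_fill_code[where a = "base + 2" and j = j and K = ?K], goal_cases)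
    case (8 r1 t1)
    have "t1 \<le> 14 + t + ?K * 11" using 8 by simp
    then have t1: "t1 + 1 \<le> t + 15 + N * n * 11" using mult_le_mono1[OF K(2), of 11] by linarith
    then show ?case using 8 r K space'
      by (simp add: wp_simps, intro run_stack) (use t1 in auto)
  qed auto
qed

lemma wp_main_code:
  assumes r: "r 0 = m" "r 1 = n" "r 2 = 1" "r 4 = N" "r 5 = S" "r 6 = base" "r 7 = 32" and x: "x 0 = 0"
    and post: "\<And>r' h' x' g' t'. x' 0 = taylor_value N \<Longrightarrow> t' \<le> t + 3 + n * (10 + N * (item_time + 3)) \<Longrightarrow> \<Phi> r' h' x' g' t'"
  shows "wp input c B main_code \<Phi> r h x g t"
proof -
  define V where "V = (\<lambda>j k. \<Sum>k<k. item_value (initial_item N j k))"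
  note NS = N_le_S
  let ?I = "\<lambda>j r' h' x' g'. (\<forall>b<8. r' b = r b) \<and> x' (0::nat) = (\<Sum>j<j. V j N)"
  show ?thesis unfolding main_code_def
  proof (rule wp_For[where I = ?I and K = n and T = "7 + N * (item_time + 3)"])
    fix j r1 h1 x1 g1 t1
    assume j: "j < n" "?I j r1 h1 x1 g1" "r1 8 = j" "r1 1 = n" "r1 2 = 1"
    let ?\<Phi> = "\<lambda>r' h' x' g' t'. t' \<le> t1 + (7 + N * (item_time + 3)) \<and> r' 8 = j \<and> r' 1 = n \<and> r' 2 = 1 \<and>
       ?I (Suc j) (r'(8 := Suc j)) h' x' g'"
    let ?J = "\<lambda>k r' h' x' g'. (\<forall>b<9. r' b = r1 b) \<and> x' (0::nat) = (\<Sum>j<j. V j N) + V j k \<and>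
       x' 7 = - ((- w j) ^ k) \<and> x' 8 = - w j"
    have "wp input c B (For 9 4 item_code) ?\<Phi> r1 h1 (x1(7 := - 1, 9 := 0, 8 := - w j)) g1 (t1 + 1 + 1 + 1 + 1)"
    proof (rule wp_For[where I = ?J and K = N and T = item_time])
      fix k r2 h2 x2 g2 t2
      assume k: "k < N" "?J k r2 h2 x2 g2" "r2 9 = k" "r2 4 = N" "r2 2 = 1"
      show "wp input c B item_code (\<lambda>r' h' x' g' t'. t' \<le> t2 + item_time \<and> r' 9 = k \<and> r' 4 = N \<and> r' 2 = 1 \<and>
         ?J (Suc k) (r'(9 := Suc k)) h' x' g') r2 h2 x2 g2 t2"
      proof (rule wp_item_code[where j = j and k = k], goal_cases)
        case (14 r3 h3 x3 g3 t3)
        then show ?case using k by (simp add: V_def)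
      qed (use j k r in auto)
    next
      fix r2 h2 x2 g2 t2
      assume "?J N r2 h2 x2 g2" "t2 \<le> t1 + 1 + 1 + 1 + 1 + 3 + N * (item_time + 3)" "r2 2 = 1"
      then show "?\<Phi> r2 h2 x2 g2 t2" using j r by auto
    qed (use j r NS space' in \<open>auto simp: V_def\<close>)
    then show "wp input c B (Do (NConst 7 (- 1)) ;; Do (GetWeight 8 8) ;; Do (NConst 9 0) ;; Do (NSub 8 9 8) ;; For 9 4 item_code)
        ?\<Phi> r1 h1 x1 g1 t1"
      using j by (simp add: wp_simps fun_upd_twist)
  next
    fix r1 h1 x1 g1 t1
    assume "?I n r1 h1 x1 g1" "t1 \<le> t + 3 + n * (7 + N * (item_time + 3) + 3)"
    then show "\<Phi> r1 h1 x1 g1 t1"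
      by (intro post) (simp_all add: taylor_value_items V_def)
  qed (use r x n_less in auto)
qed

text \<open>The conditions on \<open>N\<close> say that the counting loop of the setup stops after
  exactly \<open>N\<close> rounds.\<close>

lemma wp_program:
  fixes H :: nat
  assumes H: "2 \<le> H"
    and N: "real n * real H * ((real H - 1) / real H) ^ N \<le> \<epsilon>"
      "\<And>i. i < N \<Longrightarrow> \<epsilon> < real n * real H * ((real H - 1) / real H) ^ i"
  shows "wp input c B (program H) (\<lambda>r h x g t. x 0 = taylor_value N \<and> t \<le> 30 + 4 * N + n * (10 + N * (item_time + 3)))
    ((\<lambda>_. 0)(0 := m, 1 := n)) (\<lambda>_. 0) ((\<lambda>_. 0)(0 := of_real \<epsilon>)) (\<lambda>_. 0) 0"
proof -
  let ?q = "(real H - 1) / real H"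
  let ?\<Phi> = "\<lambda>r h x g t. x 0 = taylor_value N \<and> t \<le> 30 + 4 * N + n * (10 + N * (item_time + 3))"
  let ?rest = "Do (NConst 0 0) ;; Do (WMult 5 1 4) ;; Do (WAdd 5 5 1) ;; Do (WAdd 5 5 2) ;; Do (WAdd 5 5 2)"
  note NS = N_le_S
  have S: "n * N + n + 1 + 1 = S" by (simp add: S_eq algebra_simps)
  have loop: "wp input c B (While (NLess 0 1) (Do (NMult 1 1 3) ;; Do (WAdd 4 4 2))) (wp input c B ?rest (wp input c B main_code ?\<Phi>)) r h x g t"
    if r: "r 0 = m" "r 1 = n" "r 2 = 1" "r 4 = 0" "r 6 = base" "r 7 = 32"
      and x: "x 0 = of_real \<epsilon>" "x 1 = of_real (real n * real H)" "x 3 = of_real ?q" and t: "t = 10" for r h x g t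
  proof -
    let ?I = "\<lambda>k r' h' x' g' t'. k \<le> N \<and> (\<forall>b. b \<noteq> 4 \<longrightarrow> r' b = r b) \<and> r' 4 = N - k \<and> (\<forall>b. b \<noteq> 1 \<longrightarrow> x' b = x b) \<and>
        x' 1 = of_real (real n * real H * ?q ^ (N - k)) \<and> t' \<le> t + 4 * (N - k)"
    show ?thesis
    proof (rule wp_While[where I = ?I and k = N])
      fix k r1 h1 x1 g1 t1
      assume I: "?I k r1 h1 x1 g1 t1" and "holds (NLess 0 1) r1 x1"
      then have "\<epsilon> < real n * real H * ?q ^ (N - k)" using x by (simp only: holds.simps) (simp flip: of_real_power)
      then have k: "0 < k" using N(1) by (cases k) auto
      have Nk: "Suc (N - k) = N - (k - 1)" using k I by auto
      have "x1 1 * x1 3 = of_real (real n * real H * ?q ^ (N - (k - 1)))"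
        using I x by (simp flip: Nk add: mult_ac)
      then have "?I (k - 1) (r1(4 := N - k + 1)) h1 (x1(1 := x1 1 * x1 3)) g1 (Suc t1 + 1 + 1 + 1)"
        using I k Nk by auto
      moreover have "k - 1 < k" using k by simp
      ultimately have "\<exists>k'<k. ?I k' (r1(4 := N - k + 1)) h1 (x1(1 := x1 1 * x1 3)) g1 (Suc (Suc t1 + 1 + 1))"
        by (metis Suc_eq_plus1)
      then show "wp input c B (Do (NMult 1 1 3) ;; Do (WAdd 4 4 2)) (\<lambda>r h x g t. \<exists>k'<k. ?I k' r h x g (Suc t)) r1 h1 x1 g1 (Suc t1)"
        using I r NS space' by (simp add: wp_simps)
    next
      fix k r1 h1 x1 g1 t1
      assume I: "?I k r1 h1 x1 g1 t1" and "\<not> holds (NLess 0 1) r1 x1"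
      then have "\<not> \<epsilon> < real n * real H * ?q ^ (N - k)" using x by (simp only: holds.simps) (simp flip: of_real_power)
      then have k: "k = 0" using N(2)[of "N - k"] I by (cases k) auto
      have "S < B" using space' NS by simp
      then show "wp input c B ?rest (wp input c B main_code ?\<Phi>) r1 h1 x1 g1 (t1 + 2)"
        using I r k S
        by (simp add: wp_simps, intro wp_main_code) (use I r k S t in auto)
    qed (use r x in auto)
  qed
  have B: "32 < B" "33 + m < B" using space' NS by auto
  show ?thesis unfolding program_def setup_code_def
    using B by (simp add: wp_simps, intro loop) (use H in \<open>auto simp: of_nat_diff\<close>)
qed

end

section \<open>Running time and word length\<close>

lemma (in program_run) program_computes:
  assumes "2 \<le> H" "real n * real H * ((real H - 1) / real H) ^ N \<le> \<epsilon>"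
    "\<And>i. i < N \<Longrightarrow> \<epsilon> < real n * real H * ((real H - 1) / real H) ^ i"
    and B: "B = 2 ^ b"
  shows "\<exists>t \<le> 30 + 4 * N + n * (10 + N * (item_time + 3)).
    ram_computes (compile 0 (program H)) input c b t (taylor_value N)"
proof -
  let ?r = "(\<lambda>_. 0)(0 := m, 1 := n) :: regs" and ?x = "(\<lambda>_. 0)(0 := of_real \<epsilon>) :: nregs"
  from wp_program[OF assms(1-3)] obtain t r h x g where
    run: "run input c (2 ^ b) (program H) (?r, \<lambda>_. 0, ?x, \<lambda>_. 0) t (r, h, x, g)"
    and x: "x 0 = taylor_value N" and t: "t \<le> 30 + 4 * N + n * (10 + N * (item_time + 3))"
    unfolding wp_def B by auto
  have B32: "33 + m \<le> 2 ^ b" "n < 2 ^ b" using base_le n_less B by auto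
  have init: "ram_init input = ram_of 0 (?r, \<lambda>_. 0, ?x, \<lambda>_. 0)"
    by (auto simp: ram_init_def joined_def fun_eq_iff)
  have fits: "fits_word_length b (ram_of 0 (?r, \<lambda>_. 0, ?x, \<lambda>_. 0))"
    using B32 unfolding fits_word_length_joined by auto
  have pow: "32 \<le> (2::nat) ^ b" using B32 by linarith
  let ?P = "compile 0 (program H)"
  have correct: "fits_word_length b (ram_of p' (r, h, x, g)) \<and>
      (\<forall>u s''. ram_exec ?P input c b (ram_of (0 + length ?P) (r, h, x, g)) u s'' \<longrightarrow>
        ram_exec ?P input c b (ram_of 0 (?r, \<lambda>_. 0, ?x, \<lambda>_. 0)) (t + u) s'')" for p'
    by (rule compile_correct[OF run pow fits, of _ "[]" "[]"]) simp_all
  have "ram_exec ?P input c b (ram_of (length ?P) (r, h, x, g)) 0 (ram_of (length ?P) (r, h, x, g))"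
    using correct by (intro ram_exec.halted) (auto simp del: ram_of.simps)
  then have "ram_exec ?P input c b (ram_init input) t (ram_of (length ?P) (r, h, x, g))"
    using correct unfolding init by (metis add.right_neutral add_0)
  then have "ram_computes ?P input c b t (taylor_value N)"
    unfolding ram_computes_def using x by (intro exI[of _ "ram_of (length ?P) (r, h, x, g)"]) (simp add: joined_def)
  then show ?thesis using t by blast
qed

text \<open>A step costs O(W^3), an item takes at most \<open>PB\<close> steps, and there are n N
  items, hence O(W^6); the seventh factor absorbs the constants.\<close>

lemma (in program_run) time_bound:
  assumes "n \<le> W" "c \<le> W" "N \<le> W" "PB \<le> W" "1000 \<le> W"
  shows "30 + 4 * N + n * (10 + N * (item_time + 3)) \<le> W ^ 7"
proof -
  define W2 W3 W4 W5 W6 where "W2 = W * W" and "W3 = W * W2" and "W4 = W * W3" and "W5 = W * W4" and "W6 = W * W5"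
  have expand: "W * (12 + W * (15 + 10 * W)) = 12 * W + 15 * W2 + 10 * W3" "W * (12 * W3) = 12 * W4"
    "W * (13 * W4) = 13 * W5" "W * (14 * W5) = 14 * W6"
    by (simp_all add: W2_def W3_def W4_def W5_def W6_def algebra_simps)
  have ge: "1000 * W \<le> W2" "1000 * W2 \<le> W3" "1000 * W3 \<le> W4" "1000 * W4 \<le> W5" "1000 * W5 \<le> W6"
    using assms(5) by (simp_all add: W2_def W3_def W4_def W5_def W6_def)
  have S: "S \<le> 2 * W2"
  proof -
    have "S \<le> (W + 1) * W + 2" unfolding S_eq using assms by (intro add_mono mult_le_mono) auto
    then have "S \<le> W2 + W + 2" by (simp add: W2_def add_mult_distrib)
    then show ?thesis using ge assms(5) by linarith
  qed
  have "c * (15 + 10 * n) \<le> W * (15 + 10 * W)" using assms by (intro mult_le_mono add_mono) auto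
  then have "n * (12 + c * (15 + 10 * n)) \<le> W * (12 + W * (15 + 10 * W))"
    using assms by (intro mult_le_mono add_mono) auto
  then have "step_time + 2 \<le> W * (12 + W * (15 + 10 * W)) + (2 * W2) * 9 + W * 19 + 72"
    unfolding step_time_def using S assms(1) by linarith
  also have "\<dots> \<le> 12 * W3"
    unfolding expand using ge assms(5) by linarith
  finally have "PB * (step_time + 2) \<le> W * (12 * W3)" using assms(4) by (intro mult_le_mono)
  moreover have "N * n \<le> W2" unfolding W2_def using assms by (intro mult_le_mono)
  ultimately have "item_time + 3 \<le> 13 * W4"
    unfolding item_time_def expand using ge assms(5) by linarith
  then have "N * (item_time + 3) \<le> W * (13 * W4)" using assms(3) by (intro mult_le_mono)
  then have "10 + N * (item_time + 3) \<le> 14 * W5" unfolding expand using ge assms(5) by linarith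
  then have "n * (10 + N * (item_time + 3)) \<le> W * (14 * W5)" using assms(1) by (intro mult_le_mono)
  then have "30 + 4 * N + n * (10 + N * (item_time + 3)) \<le> 15 * W6"
    unfolding expand using ge assms(3,5) by linarith
  also have "\<dots> \<le> W * W6" using assms(5) by (intro mult_le_mono1) simp
  also have "\<dots> = W ^ 7" unfolding W2_def W3_def W4_def W5_def W6_def by algebra
  finally show ?thesis .
qed

text \<open>The maximum keeps the exponent away from 0 when n = 1 and the error is large; the
  minimum keeps an error above 1 from cancelling ln n.\<close>

definition log_size :: "nat \<Rightarrow> real \<Rightarrow> real" where
  "log_size n \<epsilon> = max 1 (ln (real n) - ln (min \<epsilon> 1))"

text \<open>\<open>N\<close> is the least admissible order, and taking logarithms at N - 1, which
  still fails, bounds it. As \<open>log_size\<close> is at least 1, the additive constants may be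
  multiplied by it.\<close>

lemma truncation_order:
  fixes H n :: nat
  assumes "2 \<le> H" "1 \<le> n" "0 < \<epsilon>"
  obtains N where "real n * real H * ((real H - 1) / real H) ^ N \<le> \<epsilon>"
    "\<And>i. i < N \<Longrightarrow> \<epsilon> < real n * real H * ((real H - 1) / real H) ^ i"
    "real N \<le> (1 + (ln (real H) + 1) / ln (real H / (real H - 1))) * log_size n \<epsilon>"
proof -
  let ?q = "(real H - 1) / real H" and ?d = "ln (real H / (real H - 1))"
  define P where "P = (\<lambda>N. real n * real H * ?q ^ N \<le> \<epsilon>)"
  have q: "0 < ?q" "?q < 1" using assms by auto
  have d: "0 < ?d" "ln ?q = - ?d" using assms by (simp_all add: ln_div)
  have "(\<lambda>N. real n * real H * ?q ^ N) \<longlonglongrightarrow> real n * real H * 0"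
    using q by (intro tendsto_mult tendsto_const LIMSEQ_realpow_zero) auto
  then have "eventually (\<lambda>N. real n * real H * ?q ^ N < \<epsilon>) sequentially"
    using assms(3) by (intro order_tendstoD) auto
  then obtain N0 where "P N0" unfolding P_def eventually_sequentially by (meson less_imp_le order_refl)
  define N where "N = (LEAST N. P N)"
  have N: "P N" "\<And>i. i < N \<Longrightarrow> \<not> P i"
    unfolding N_def using LeastI[of P N0] not_less_Least[of _ P] \<open>P N0\<close> by blast+
  let ?l = "log_size n \<epsilon>"
  have l: "1 \<le> ?l" "ln (real n) - ln (min \<epsilon> 1) \<le> ?l" by (auto simp: log_size_def)
  have "real N \<le> 1 + (ln (real H) + ?l) / ?d"
  proof (cases N)
    case 0
    have "0 \<le> (ln (real H) + ?l) / ?d" using l d assms by (intro divide_nonneg_pos add_nonneg_nonneg) auto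
    then show ?thesis using 0 by simp
  next
    case (Suc N')
    then have "\<epsilon> < real n * real H * ?q ^ N'" using N(2)[of N'] by (simp add: P_def)
    then have "ln \<epsilon> < ln (real n * real H * ?q ^ N')" using assms by (subst ln_less_cancel_iff) auto
    also have "\<dots> = ln (real n) + ln (real H) + real N' * ln ?q"
      using assms q by (simp add: ln_mult ln_realpow)
    finally have "real N' * ?d < ln (real n) + ln (real H) - ln \<epsilon>" using d by simp
    moreover have "ln (min \<epsilon> 1) \<le> ln \<epsilon>" using assms by (intro ln_mono) auto
    ultimately have "real N' * ?d \<le> ln (real H) + ?l" using l(2) by linarith
    then show ?thesis using d Suc by (simp add: pos_le_divide_eq)
  qed
  also have "\<dots> \<le> ?l + (ln (real H) * ?l + ?l) / ?d"
    using l d assms by (intro add_mono divide_right_mono) (auto simp: mult_le_cancel_left1)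
  also have "\<dots> = (1 + (ln (real H) + 1) / ?d) * ?l" using d by (simp add: field_simps)
  finally show ?thesis using N that by (auto simp: P_def not_le)
qed

lemma log_size_le:
  assumes "1 \<le> n" "0 < \<epsilon>"
  shows "log_size n \<epsilon> \<le> 1 + real n + 1 / \<epsilon>"
proof -
  have "ln (real n) \<le> real n" using assms ln_le_minus_one[of "real n"] by simp
  moreover have "- ln (min \<epsilon> 1) \<le> 1 / \<epsilon>"
  proof (cases "\<epsilon> \<le> 1")
    case True
    then show ?thesis using ln_le_minus_one[of "1 / \<epsilon>"] assms by (simp add: ln_div min_def)
  qed (use assms in simp)
  ultimately show ?thesis using assms by (simp add: log_size_def)
qed

text \<open>From a^2 \<ge> 4 \<ge> e the square of \<open>a powr log_size n \<epsilon>\<close>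
  dominates \<open>exp (log_size n \<epsilon>)\<close>, hence \<open>n\<close> and
  \<open>log_size\<close> itself.\<close>

lemma exp_log_size:
  assumes "2 \<le> a" and that: "1 \<le> n" "0 < \<epsilon>"
  shows "real n \<le> (a powr log_size n \<epsilon>) ^ 2" "log_size n \<epsilon> \<le> (a powr log_size n \<epsilon>) ^ 2" "2 \<le> a powr log_size n \<epsilon>" "a \<le> a powr log_size n \<epsilon>"
proof -
  let ?l = "log_size n \<epsilon>"
  have l: "1 \<le> ?l" "ln (real n) - ln (min \<epsilon> 1) \<le> ?l" by (auto simp: log_size_def)
  have "a powr 1 \<le> a powr ?l" using l assms by (intro powr_mono) auto
  then show "a \<le> a powr ?l" using assms by simp
  then show "2 \<le> a powr ?l" using assms by linarith
  have "exp 1 \<le> (4::real)" using exp_le by linarith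
  then have "ln (exp 1) \<le> ln (4::real)" by (subst ln_le_cancel_iff) auto
  also have "ln (4::real) = 2 * ln 2" using ln_realpow[of "2::real" 2] by simp
  also have "\<dots> \<le> 2 * ln a" using assms by simp
  finally have "1 \<le> 2 * ln a" by simp
  then have "?l \<le> ?l * (2 * ln a)" using l by (simp add: mult_le_cancel_left1)
  then have "exp ?l \<le> exp (?l * (2 * ln a))" by simp
  also have "\<dots> = (a powr ?l) ^ 2" using assms by (simp add: powr_def flip: exp_of_nat_mult)
  finally have e: "exp ?l \<le> (a powr ?l) ^ 2" .
  have "ln (min \<epsilon> 1) \<le> 0" using that by simp
  then have "ln (real n) \<le> ?l" using l by linarith
  then have "real n \<le> exp ?l" using that by (metis exp_le_cancel_iff exp_ln of_nat_0_less_iff order_less_le_trans zero_less_one)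
  then show "real n \<le> (a powr ?l) ^ 2" using e by linarith
  have "?l \<le> exp ?l" using exp_ge_add_one_self[of ?l] by linarith
  then show "?l \<le> (a powr ?l) ^ 2" using e by linarith
qed

text \<open>For fixed \<open>a\<close> the exponential is a power,
  \<open>a powr (K * ln y) = y powr (K * ln a)\<close>, and y = n / min \<epsilon> 1 is at most the
  square of n + 1/\<epsilon>.\<close>

lemma powr_log_size_le_poly:
  assumes "2 \<le> a" "0 \<le> K" "1 \<le> n" "0 < \<epsilon>"
    and D: "a powr K \<le> real D" "2 * (K * ln a) \<le> real D"
  shows "a powr (K * log_size n \<epsilon>) \<le> real D * (real n + 1 / \<epsilon>) ^ D"
proof -
  let ?Y = "real n + 1 / \<epsilon>"
  define y where "y = real n / min \<epsilon> 1"
  have Y: "1 \<le> ?Y" using assms by (simp add: add_increasing2)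
  have y: "1 \<le> y" "ln y = ln (real n) - ln (min \<epsilon> 1)"
    using assms by (auto simp: y_def ln_div min_def field_simps)
  have "y \<le> ?Y * ?Y"
  proof (cases "\<epsilon> \<le> 1")
    case True
    have "real n * (1 / \<epsilon>) \<le> ?Y * ?Y" using assms by (intro mult_mono) auto
    then show ?thesis using True by (simp add: y_def min_def)
  next
    case False
    have "real n * 1 \<le> ?Y * ?Y" using assms Y by (intro mult_mono) auto
    then show ?thesis using False by (simp add: y_def)
  qed
  then have yY: "y \<le> ?Y powr 2" using Y by (simp add: powr_numeral power2_eq_square)
  have "log_size n \<epsilon> \<le> 1 + ln y" using y ln_ge_zero[OF y(1)] by (simp add: log_size_def)
  then have "a powr (K * log_size n \<epsilon>) \<le> a powr (K * (1 + ln y))"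
    using assms by (intro powr_mono mult_left_mono) auto
  also have "\<dots> = a powr K * (a powr (K * ln y))" by (simp add: distrib_left powr_add)
  also have "a powr (K * ln y) = y powr (K * ln a)" using assms y by (simp add: powr_def mult_ac)
  also have "\<dots> \<le> (?Y powr 2) powr (K * ln a)" using assms y yY by (intro powr_mono2) auto
  also have "\<dots> = ?Y powr (2 * (K * ln a))" by (simp add: powr_powr)
  also have "\<dots> \<le> ?Y powr real D" using Y D by (intro powr_mono) auto
  also have "\<dots> = ?Y ^ D" using Y by (simp add: powr_realpow)
  finally have "a powr (K * log_size n \<epsilon>) \<le> a powr K * ?Y ^ D" using assms by (simp add: mult_left_mono)
  also have "\<dots> \<le> real D * ?Y ^ D" using D Y by (intro mult_right_mono) auto
  finally show ?thesis .
qed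

text \<open>A slot has O(Y^2) words and the stack O(Y^2) slots; \<open>R \<le> n\<close> expresses
  the height through \<open>n\<close> instead of the sparsity.\<close>

lemma space_bound:
  fixes K Y :: real and m n N R S :: nat
  assumes "0 \<le> K" "2 \<le> Y" "real N \<le> K * (2 * Y)" "real m \<le> Y" "real n \<le> Y" "R \<le> n" "S = (N + 1) * n + 2"
  shows "real (33 + m + (2 * (N + 1) * (R + 2) + 4) * S) \<le> (34 + 8 * (2 * K + 2) ^ 2) * Y ^ 4"
proof -
  define C where "C = 2 * K + 1"
  have C: "1 \<le> C" using assms by (simp add: C_def)
  have Y: "Y \<le> Y ^ 2" "Y ^ 2 \<le> Y ^ 4" "4 \<le> Y ^ 2" "1 \<le> Y ^ 4"
    using assms(2) power_mono[of 2 Y 2] by (auto simp: self_le_power power_increasing one_le_power)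
  have N: "real N + 1 \<le> C * Y" using assms(2,3) by (simp add: C_def algebra_simps)
  have "(real N + 1) * real n \<le> C * Y * Y" using N assms by (intro mult_mono) (auto intro: order_trans)
  then have "real S \<le> C * Y ^ 2 + 2" using assms(7) by (simp add: power2_eq_square algebra_simps)
  also have "\<dots> \<le> (C + 1) * Y ^ 2" using Y by (simp add: algebra_simps)
  finally have S: "real S \<le> (C + 1) * Y ^ 2" .
  have "(real N + 1) * (real R + 2) \<le> (C * Y) * (2 * Y)"
    using N assms by (intro mult_mono) auto
  then have "real (2 * (N + 1) * (R + 2) + 4) \<le> 4 * C * Y ^ 2 + 4" by (simp add: power2_eq_square algebra_simps)
  also have "\<dots> \<le> 8 * (C + 1) * Y ^ 2"
  proof -
    have "0 \<le> C * Y ^ 2" using C by simp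
    then show ?thesis using Y by (simp add: algebra_simps)
  qed
  finally have "real (2 * (N + 1) * (R + 2) + 4) * real S \<le> (8 * (C + 1) * Y ^ 2) * ((C + 1) * Y ^ 2)"
    using S C by (intro mult_mono) auto
  also have "\<dots> = 8 * (2 * K + 2) ^ 2 * Y ^ 4" unfolding C_def by algebra
  finally have "real ((2 * (N + 1) * (R + 2) + 4) * S) \<le> 8 * (2 * K + 2) ^ 2 * Y ^ 4" by (simp only: of_nat_mult)
  moreover have "real (33 + m) \<le> 34 * Y ^ 4" using assms(4) Y by simp
  ultimately show ?thesis by (simp only: of_nat_add[of "33 + m"] distrib_right)
qed

lemma word_length_exists:
  fixes X :: nat and C Y :: real
  assumes "1 \<le> X" "real X \<le> C * Y ^ 4" "1 \<le> C" "2 \<le> Y"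
  obtains b where "X \<le> 2 ^ b" "real b \<le> (log 2 C + 5) * log 2 Y"
proof
  define b where "b = nat \<lceil>log 2 (real X)\<rceil>"
  have l: "0 \<le> log 2 (real X)" "1 \<le> log 2 Y" "0 \<le> log 2 C" using assms by (auto simp: le_log_iff)
  have "real X = 2 powr log 2 (real X)" using assms by simp
  also have "\<dots> \<le> 2 powr real b" unfolding b_def using l by (intro powr_mono) linarith+
  finally have "real X \<le> real (2 ^ b)" by (simp add: powr_realpow)
  then show "X \<le> 2 ^ b" by (simp only: of_nat_le_iff)
  have "log 2 (real X) \<le> log 2 (C * Y ^ 4)" using assms by (subst log_le_cancel_iff) auto
  also have "\<dots> = log 2 C + 4 * log 2 Y" using assms by (simp add: log_mult log_nat_power)
  finally have "real b \<le> log 2 C + 4 * log 2 Y + 1" unfolding b_def using l by linarith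
  also have "\<dots> \<le> log 2 C * log 2 Y + 4 * log 2 Y + log 2 Y"
    using l mult_left_mono[of 1 "log 2 Y" "log 2 C"] by simp
  finally show "real b \<le> (log 2 C + 5) * log 2 Y" by (simp add: algebra_simps)
qed

theorem mainTheorem3:
  fixes \<beta> :: real
  assumes "0 < \<beta>" and "\<beta> < 0.46"
  shows "\<exists>(P :: instr list) (K :: real) (D :: nat \<Rightarrow> nat \<Rightarrow> nat).
    \<forall>(r :: nat) (c :: nat) (m :: nat) (n :: nat) (A :: nat \<Rightarrow> nat \<Rightarrow> int)
      (w :: nat \<Rightarrow> complex) (\<epsilon> :: real).
      2 \<le> r \<and> 1 \<le> c \<and> 1 \<le> m \<and> 1 \<le> n \<and> sparse_matrix m n r c A \<and>
      (\<forall>j<n. cmod (w j) \<le> \<beta> / (real r * sqrt (real c))) \<and> 0 < \<epsilon> \<longrightarrow>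
      (\<exists>b t T.
        ram_computes P \<lparr>rows = m, cols = n, entry = A, wt = w, err = \<epsilon>\<rparr> c b t T \<and>
        approximates \<epsilon> T (weight n w (solutions m n A)) \<and>
        real b \<le> K * log 2 (real m + real n + 1 / \<epsilon>) \<and>
        real t \<le> real (r * c) powr (K * max 1 (ln (real n) - ln (min \<epsilon> 1))) \<and>
        real t \<le> real (D r c) * (real n + 1 / \<epsilon>) ^ D r c)"
proof -
  \<comment> \<open>Makes \<rho> = H / (H - 1) small enough for
    \<open>\<beta> * \<rho> \<le> 0.46\<close>; being an integer, \<open>H\<close> can be a constant
    of the program.\<close>
  define H where "H = nat \<lceil>0.46 / (0.46 - \<beta>)\<rceil> + 2"
  have H: "2 \<le> H" "0.46 / (0.46 - \<beta>) \<le> real H" unfolding H_def by linarith+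
  define \<rho> where "\<rho> = real H / (real H - 1)"
  have \<rho>: "1 < \<rho>" "inverse \<rho> = (real H - 1) / real H" "1 / (\<rho> - 1) = real H - 1"
    using H(1) by (auto simp: \<rho>_def field_simps)
  have "0.46 \<le> real H * (0.46 - \<beta>)"
    using H(2) assms(2) pos_divide_le_eq[of "0.46 - \<beta>" "0.46" "real H"] by linarith
  then have "\<beta> * real H \<le> 0.46 * (real H - 1)" by (simp add: algebra_simps)
  moreover have "0 < real H - 1" using H(1) by simp
  ultimately have \<beta>\<rho>: "\<beta> * \<rho> \<le> 0.46" by (simp only: \<rho>_def times_divide_eq_right pos_divide_le_eq)
  define K1 where "K1 = 1 + (ln (real H) + 1) / ln (real H / (real H - 1))"
  have K1: "1 \<le> K1" unfolding K1_def using H(1) by simp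
  \<comment> \<open>Exponents of \<open>Z\<close> below: \<open>k\<close> for the constant
    \<open>K1\<close>, \<open>p\<close> for the tree size \<open>PB\<close>; the 12 leaves room for
    the other bounds, such as 1000 \<le> Z^10.\<close>
  define k p e where "k = nat \<lceil>K1\<rceil>" and "p = nat \<lceil>6 * (K1 + 1)\<rceil>" and "e = k + p + 12"
  define CS where "CS = 34 + 8 * (2 * K1 + 2) ^ 2"
  define K where "K = max (log 2 CS + 5) (real (7 * (e + 1)))"
  define D where "D = (\<lambda>r c. nat \<lceil>max (real (r * c) powr K) (2 * (K * ln (real (r * c))))\<rceil>)"
  have K0: "0 \<le> K" by (simp add: K_def)
  have main: "\<exists>b t T.
        ram_computes (compile 0 (program H)) \<lparr>rows = m, cols = n, entry = A, wt = w, err = \<epsilon>\<rparr> c b t T \<and>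
        approximates \<epsilon> T (weight n w (solutions m n A)) \<and>
        real b \<le> K * log 2 (real m + real n + 1 / \<epsilon>) \<and>
        real t \<le> real (r * c) powr (K * max 1 (ln (real n) - ln (min \<epsilon> 1))) \<and>
        real t \<le> real (D r c) * (real n + 1 / \<epsilon>) ^ D r c"
    if r: "2 \<le> r" and c: "1 \<le> c" and m: "1 \<le> m" and n: "1 \<le> n" and sparse: "sparse_matrix m n r c A"
      and w: "\<forall>j<n. cmod (w j) \<le> \<beta> / (real r * sqrt (real c))" and \<epsilon>: "0 < \<epsilon>" for r c m n A w \<epsilon>
  proof -
    obtain N where N: "real n * real H * ((real H - 1) / real H) ^ N \<le> \<epsilon>"
      "\<And>i. i < N \<Longrightarrow> \<epsilon> < real n * real H * ((real H - 1) / real H) ^ i"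
      "real N \<le> K1 * log_size n \<epsilon>"
      using truncation_order[OF H(1) n \<epsilon>] unfolding K1_def by blast
    \<comment> \<open>The running time needs a tree bounded by \<open>r\<close>, the word length a
      stack bounded by \<open>n\<close>, as it may depend on \<open>m\<close>, \<open>n\<close> and
      \<open>\<epsilon>\<close> only.\<close>
    define R where "R = min r n"
    define S where "S = (N + 1) * n + 2"
    define X where "X = 33 + m + (2 * (N + 1) * (R + 2) + 4) * S"
    define Y where "Y = real m + real n + 1 / \<epsilon>"
    have Y: "2 \<le> Y" "real m \<le> Y" "real n \<le> Y" "1 + real n + 1 / \<epsilon> \<le> 2 * Y"
    proof -
      define u where "u = 1 / \<epsilon>"
      have "1 \<le> real m" "1 \<le> real n" "0 < u" using m n \<epsilon> by (auto simp: u_def)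
      note u = this
      show "2 \<le> Y" "real m \<le> Y" "real n \<le> Y" using u unfolding Y_def u_def[symmetric] by simp_all
      have "1 + real n + u \<le> 2 * (real m + real n + u)" unfolding distrib_left using u by linarith
      then show "1 + real n + 1 / \<epsilon> \<le> 2 * Y" unfolding Y_def u_def .
    qed
    have "K1 * log_size n \<epsilon> \<le> K1 * (2 * Y)"
      using log_size_le[OF n \<epsilon>] Y(4) K1 by (intro mult_left_mono) auto
    then have "real N \<le> K1 * (2 * Y)" using N(3) by linarith
    from space_bound[OF _ Y(1) this Y(2,3) _ S_def, of R] K1 have "real X \<le> CS * Y ^ 4"
      by (simp add: X_def CS_def R_def)
    moreover have "1 \<le> CS" by (simp add: CS_def add_increasing2)
    moreover have "1 \<le> X" by (simp add: X_def)
    ultimately obtain b where b: "X \<le> 2 ^ b" "real b \<le> (log 2 CS + 5) * log 2 Y"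
      using word_length_exists[of X CS Y] Y(1) by blast
    have "0 \<le> log 2 Y" using Y(1) by simp
    then have bK: "real b \<le> K * log 2 Y"
      using b(2) mult_right_mono[of "log 2 CS + 5" K "log 2 Y"] by (simp add: K_def)
    define PB where "PB = (13 * Suc R) ^ Suc N"
    have row: "card {l. l < n \<and> A i l \<noteq> 0} \<le> R" if "i < m" for i
    proof -
      have "card {l. l < n \<and> A i l \<noteq> 0} \<le> card {..<n}" by (intro card_mono) auto
      then show ?thesis using sparse that by (simp add: sparse_matrix_def R_def)
    qed
    have "S \<le> (2 * (N + 1) * (R + 2) + 4) * S" by simp
    moreover have sp: "33 + m + (2 * (N + 1) * (R + 2) + 4) * S \<le> 2 ^ b" using b(1) unfolding X_def .
    ultimately have "S + 33 + m \<le> 2 ^ b" by linarith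
    moreover have "n < S" by (simp add: S_def add_mult_distrib)
    ultimately have B: "33 + m \<le> 2 ^ b" "n < 2 ^ b" by linarith+
    interpret program_run m n A w c "2 ^ b" S \<epsilon> N R PB
    proof unfold_locales
      fix j k assume "j < n" "k < N"
      then have "real (weighted_system.potential m n A R [weighted_system.initial_item w N j k]) \<le> real PB"
        using weighted_system.initial_potential[where R = R and N = N and j = j and k = k and w = w and m = m and n = n and A = A] row by (simp add: PB_def)
      then show "weighted_system.potential m n A R [weighted_system.initial_item w N j k] \<le> PB" by simp
    qed (use sparse B sp n row in \<open>auto simp: sparse_matrix_def S_def\<close>)
    obtain t where t: "t \<le> 30 + 4 * N + n * (10 + N * (item_time + 3))"
      "ram_computes (compile 0 (program H)) input c b t (taylor_value N)"
      using program_computes[OF H(1) N(1,2) refl] by blast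
    have "cmod (w j) * \<rho> \<le> 0.46 / (real r * sqrt c)" if "j < n" for j
    proof -
      have "cmod (w j) * \<rho> \<le> \<beta> / (real r * sqrt c) * \<rho>" using w that \<rho>(1) by (intro mult_right_mono) auto
      also have "\<dots> = \<beta> * \<rho> / (real r * sqrt c)" by simp
      also have "\<dots> \<le> 0.46 / (real r * sqrt c)" by (intro divide_right_mono \<beta>\<rho>) auto
      finally show ?thesis .
    qed
    then obtain L where L: "exp L = weight n w (solutions m n A)"
      "cmod (L - taylor_value N) \<le> real n * (inverse \<rho> ^ N / (\<rho> - 1))"
      using taylor_value_approximates[OF r c sparse \<rho>(1)] by blast
    \<comment> \<open>Since 1 / (\<rho> - 1) = H - 1, the quantity compared with the error in the
      setup loop dominates the truncation error.\<close>
    have "real n * (inverse \<rho> ^ N / (\<rho> - 1)) = real n * ((real H - 1) / real H) ^ N * (1 / (\<rho> - 1))"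
      by (simp add: \<rho>(2))
    also have "\<dots> \<le> real n * ((real H - 1) / real H) ^ N * real H"
      unfolding \<rho>(3) using H(1) by (intro mult_left_mono) auto
    also have "\<dots> \<le> \<epsilon>" using N(1) by (simp add: mult_ac)
    finally have approx: "approximates \<epsilon> (taylor_value N) (weight n w (solutions m n A))"
      unfolding approximates_def using L by (metis exp_not_eq_zero order_trans)
    define a where "a = real (r * c)"
    define Z where "Z = a powr log_size n \<epsilon>"
    have "2 * 1 \<le> r * c" "r * 1 \<le> r * c" "1 * c \<le> r * c" using r c by (intro mult_le_mono; simp)+
    then have "real 2 \<le> a" "real r \<le> a" "real c \<le> a" unfolding a_def of_nat_le_iff by simp_all
    then have a: "2 \<le> a" "real r \<le> a" "real c \<le> a" by simp_all
    note Z = exp_log_size[OF a(1) n \<epsilon>, folded Z_def]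
    have Z1: "1 \<le> Z" using Z(3) by linarith
    have up: "Z ^ i \<le> Z ^ e" if "i \<le> e" for i using that Z1 by (rule power_increasing)
    \<comment> \<open>A single bound for all quantities in \<open>time_bound\<close>; rounding up
      costs at most a factor 2 \<le> Z, hence the exponent e + 1.\<close>
    define W where "W = nat \<lceil>Z ^ e\<rceil>"
    have We: "Z ^ e \<le> real W" "real W \<le> Z ^ (e + 1)"
    proof -
      have "1 \<le> Z ^ e" using Z1 by (rule one_le_power)
      show "Z ^ e \<le> real W" unfolding W_def by linarith
      have "real W \<le> Z ^ e + 1" unfolding W_def using \<open>1 \<le> Z ^ e\<close> by linarith
      also have "\<dots> \<le> Z ^ e * 2" using \<open>1 \<le> Z ^ e\<close> by simp
      also have "\<dots> \<le> Z ^ e * Z" using Z(3) \<open>1 \<le> Z ^ e\<close> by (intro mult_left_mono) auto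
      finally show "real W \<le> Z ^ (e + 1)" by (simp only: power_add power_one_right)
    qed
    have le_W: "q \<le> W" if "real q \<le> Z ^ i" "i \<le> e" for q i
    proof -
      have "real q \<le> real W" using that up[of i] We(1) by linarith
      then show ?thesis by simp
    qed
    have "n \<le> W" by (rule le_W[OF Z(1)]) (simp add: e_def)
    moreover have "c \<le> W" by (rule le_W[of _ 1]) (use Z(4) a(3) in \<open>auto simp: e_def\<close>)
    moreover have "1000 \<le> W"
    proof (rule le_W[of _ 10])
      have "2 ^ 10 \<le> Z ^ 10" using Z(3) by (intro power_mono) auto
      then show "real 1000 \<le> Z ^ 10" by simp
    qed (simp add: e_def)
    moreover have "N \<le> W"
    proof (rule le_W[of _ "k + 2"])
      have "K1 \<le> real k" unfolding k_def by linarith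
      also have "\<dots> \<le> 2 ^ k" using of_nat_less_two_power[of k, where 'a = real] by linarith
      also have "\<dots> \<le> Z ^ k" using Z(3) by (intro power_mono) auto
      finally have "K1 * log_size n \<epsilon> \<le> Z ^ k * Z ^ 2" using Z(2) K1 by (intro mult_mono) (auto simp: log_size_def)
      then show "real N \<le> Z ^ (k + 2)" using N(3) by (simp only: power_add)
    qed (simp add: e_def)
    moreover have "PB \<le> W"
    proof (rule le_W[of _ p])
      \<comment> \<open>Prepares 13 (R + 1) \<le> 32 a \<le> a^6, using R \<le> r \<le> a and a
        \<ge> 2; this is the 6 in \<open>p\<close>.\<close>
      have "2 ^ 5 \<le> a ^ 5" using a by (intro power_mono) auto
      have "real (13 * Suc R) \<le> 32 * a" using a r by (simp add: R_def)
      also have "\<dots> \<le> a ^ 5 * a" using \<open>2 ^ 5 \<le> a ^ 5\<close> a by (intro mult_right_mono) auto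
      also have "\<dots> = a ^ 6" using power_Suc2[of a 5] by simp
      finally have "real PB \<le> (a ^ 6) ^ Suc N" unfolding PB_def of_nat_power by (intro power_mono) auto
      also have "\<dots> = a ^ (6 * Suc N)" by (rule power_mult[symmetric])
      also have "\<dots> = a powr real (6 * Suc N)" by (rule powr_realpow[symmetric]) (use a in linarith)
      also have "real (6 * Suc N) = 6 * (real N + 1)" by simp
      finally have "real PB \<le> a powr (6 * (real N + 1))" .
      also have "\<dots> \<le> a powr (log_size n \<epsilon> * (6 * (K1 + 1)))"
      proof (intro powr_mono)
        have "1 \<le> log_size n \<epsilon>" by (simp add: log_size_def)
        then show "6 * (real N + 1) \<le> log_size n \<epsilon> * (6 * (K1 + 1))" using N(3) by (simp add: algebra_simps)
      qed (use a in auto)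
      also have "\<dots> = Z powr (6 * (K1 + 1))" by (simp add: Z_def powr_powr)
      also have "\<dots> \<le> Z powr real p" unfolding p_def using Z1 by (intro powr_mono) linarith+
      also have "\<dots> = Z ^ p" using Z1 by (simp add: powr_realpow)
      finally show "real PB \<le> Z ^ p" .
    qed (simp add: e_def)
    ultimately have "t \<le> W ^ 7" using t(1) time_bound[of W] by linarith
    then have "real t \<le> real W ^ 7" by (metis of_nat_le_iff of_nat_power)
    also have "\<dots> \<le> (Z ^ (e + 1)) ^ 7" using We(2) by (intro power_mono) auto
    also have "\<dots> = Z ^ (7 * (e + 1))" by (simp only: power_mult[symmetric] mult.commute)
    also have "\<dots> = Z powr real (7 * (e + 1))" by (rule powr_realpow[symmetric]) (use Z1 in linarith)
    also have "\<dots> \<le> Z powr K" using Z1 by (intro powr_mono) (auto simp: K_def)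
    also have "\<dots> = a powr (K * log_size n \<epsilon>)" by (simp add: Z_def powr_powr mult.commute)
    finally have time: "real t \<le> a powr (K * log_size n \<epsilon>)" .
    have "a powr K \<le> real (D r c)" "2 * (K * ln a) \<le> real (D r c)" unfolding D_def a_def by linarith+
    from powr_log_size_le_poly[OF a(1) K0 n \<epsilon> this] time
    have "real t \<le> real (D r c) * (real n + 1 / \<epsilon>) ^ D r c" by linarith
    with t(2) approx bK time show ?thesis
      unfolding input_def Y_def a_def log_size_def by blast
  qed
  show ?thesis
    by (intro exI[of _ "compile 0 (program H)"] exI[of _ K] exI[of _ D] allI impI, elim conjE) (rule main)
qed

end
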